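(* Let $\alpha\in\mathbb{N}^n$ be a multi-index, let $j\ge2$ be an integer, and let $q\in W^{|\alpha|,2}(\mathbb{R}^n)$ be a compactly supported function. Then $$D^\alpha Q_j(q)=\sum_{\substack{\beta_1+\dots+\beta_j=\alpha\\ \beta_1,\dots,\beta_j\ge0}}\frac{\alpha!}{\beta_1!\cdots\beta_j!}\,Q_j\big(D^{\beta_1}q,\dots,D^{\beta_j}q\big),$$ where the sum runs over multi-indices $\beta_1,\dots,\beta_j\in\mathbb{N}^n$.
   Context: $\mathbb{N}$ includes $0$, and $D^\alpha=\partial_{x_1}^{\alpha_1}\cdots\partial_{x_n}^{\alpha_n}$. Fourier transform: $\hat f(\xi)=\mathcal F f(\xi)=\int_{\mathbb{R}^n}e^{-i\xi\cdot x}f(x)\,dx$. $W^{s,2}(\mathbb{R}^n)=\{f\in\mathcal S'(\mathbb{R}^n): (1+|\cdot|^2)^{s/2}\hat f\in L^2(\mathbb{R}^n)\}$. For $k>0$ the outgoing resolvent $R_k$ of the Laplacian is defined by $\widehat{R_k(f)}(\xi)=(-|\xi|^2+k^2+i0)^{-1}\hat f(\xi)$. The multilinear form $Q_j(f_1,\dots,f_j)$ is defined on the Fourier side by $$\mathcal F\big(Q_j(f_1,\dots,f_j)\big)(\xi)=\int_{\mathbb{R}^n}e^{ik\theta\cdot y}(f_1R_k)(f_2R_k)\cdots(f_{j-1}R_k)\big(f_j(\cdot)e^{ik\theta\cdot(\cdot)}\big)(y)\,dy,\qquad k=|\xi|/2,\ \theta=-\xi/|\xi|,$$ where $(fR_k)(g)=f\cdot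 R_k(g)$, and $Q_j(q)=Q_j(q,\dots,q)$.
   Formalization: Additionally assumes that Q_j(q) and every Q_j(D^{β_1}q,…,D^{β_j}q) in the sum is well defined (resolvents, products and integrals exist for a.e. ξ; the Fourier-side function is integrable against Schwartz functions), which can fail for q in W^{|α|,2} in high dimension. *)

theory Defs
  imports "HOL-Analysis.Analysis"
begin

(* The coordinates x_1, ..., x_n of R^n are indexed by a finite linear order 'n, and a
   multi-index is an element of nat ^ 'n (so that multi-indices can be added). *)

type_synonym 'n cfun = "real ^ 'n \<Rightarrow> complex"

(* Distributions are functionals on complex-valued functions; only their values on Schwartz
   functions are meaningful, so equality of distributions is equality on Schwartz functions. *)
type_synonym 'n dist = "(real ^ 'n \<Rightarrow> complex) \<Rightarrow> complex"


subsection \<open>Partial derivatives and multi-indices\<close>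

definition partial_deriv :: "'n::finite \<Rightarrow> 'n cfun \<Rightarrow> 'n cfun" where
  "partial_deriv i f = (\<lambda>x. vector_derivative (\<lambda>t::real. f (x + t *\<^sub>R axis i 1)) (at 0))"

definition partials :: "'n::finite list \<Rightarrow> 'n cfun \<Rightarrow> 'n cfun" where
  "partials is f = foldr partial_deriv is f"

definition D :: "nat ^ 'n::{finite,linorder} \<Rightarrow> 'n cfun \<Rightarrow> 'n cfun" where
  "D \<alpha> = partials (concat (map (\<lambda>i. replicate (\<alpha> $ i) i) (sorted_list_of_set UNIV)))"

definition mi_abs :: "nat ^ 'n::finite \<Rightarrow> nat" where
  "mi_abs \<alpha> = (\<Sum>i\<in>UNIV. \<alpha> $ i)"

definition mi_fact :: "nat ^ 'n::finite \<Rightarrow> nat" where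
  "mi_fact \<alpha> = (\<Prod>i\<in>UNIV. fact (\<alpha> $ i))"


subsection \<open>Schwartz functions, Fourier transform, tempered distributions\<close>

definition smooth :: "'n::finite cfun \<Rightarrow> bool" where
  "smooth \<phi> \<longleftrightarrow> (\<forall>is. partials is \<phi> differentiable_on UNIV)"

definition schwartz :: "'n::{finite,linorder} cfun \<Rightarrow> bool" where
  "schwartz \<phi> \<longleftrightarrow> smooth \<phi> \<and>
     (\<forall>\<alpha> N. bounded (range (\<lambda>x. (1 + norm x) ^ N * norm (D \<alpha> \<phi> x))))"

definition supp :: "'n::finite cfun \<Rightarrow> (real ^ 'n) set" where
  "supp \<phi> = closure {x. \<phi> x \<noteq> 0}"

definition schwartz_norm :: "nat \<Rightarrow> 'n::{finite,linorder} cfun \<Rightarrow> real" where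
  "schwartz_norm N \<phi> =
     (\<Sum>\<alpha> | mi_abs \<alpha> \<le> N. SUP x. (1 + norm x) ^ N * norm (D \<alpha> \<phi> x))"

definition tempered :: "'n::{finite,linorder} dist \<Rightarrow> bool" where
  "tempered T \<longleftrightarrow>
     (\<forall>\<phi> \<psi>. schwartz \<phi> \<longrightarrow> schwartz \<psi> \<longrightarrow> T (\<lambda>x. \<phi> x + \<psi> x) = T \<phi> + T \<psi>) \<and>
     (\<forall>c \<phi>. schwartz \<phi> \<longrightarrow> T (\<lambda>x. c * \<phi> x) = c * T \<phi>) \<and>
     (\<exists>C N. \<forall>\<phi>. schwartz \<phi> \<longrightarrow> norm (T \<phi>) \<le> C * schwartz_norm N \<phi>)"

definition fourier :: "'n::finite cfun \<Rightarrow> 'n cfun" where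
  "fourier f \<xi> = (LINT x|lborel. cis (- (\<xi> \<bullet> x)) * f x)"

definition inv_fourier :: "'n::finite cfun \<Rightarrow> 'n cfun" where
  "inv_fourier f x = (LINT \<xi>|lborel. cis (x \<bullet> \<xi>) * f \<xi>) / (2 * pi) ^ CARD('n)"

definition fourier_dist :: "'n::finite dist \<Rightarrow> 'n dist" where
  "fourier_dist T \<phi> = T (fourier \<phi>)"

definition inv_fourier_dist :: "'n::finite dist \<Rightarrow> 'n dist" where
  "inv_fourier_dist T \<phi> = T (inv_fourier \<phi>)"

definition mult_dist :: "'n cfun \<Rightarrow> 'n dist \<Rightarrow> 'n dist" where
  "mult_dist m T \<phi> = T (\<lambda>x. m x * \<phi> x)"

definition D_dist :: "nat ^ 'n::{finite,linorder} \<Rightarrow> 'n dist \<Rightarrow> 'n dist" where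
  "D_dist \<alpha> T \<phi> = (- 1) ^ mi_abs \<alpha> * T (D \<alpha> \<phi>)"

definition compactly_supported :: "'n::{finite,linorder} dist \<Rightarrow> bool" where
  "compactly_supported T \<longleftrightarrow>
     (\<exists>K. compact K \<and> (\<forall>\<phi>. schwartz \<phi> \<longrightarrow> supp \<phi> \<inter> K = {} \<longrightarrow> T \<phi> = 0))"


subsection \<open>Distributions given by functions, Sobolev spaces\<close>

definition dist_of :: "'n::finite cfun \<Rightarrow> 'n dist" where
  "dist_of u \<phi> = (LINT x|lborel. u x * \<phi> x)"

definition locally_integrable :: "'n::finite cfun \<Rightarrow> bool" where
  "locally_integrable u \<longleftrightarrow> (\<forall>K. compact K \<longrightarrow> set_integrable lborel K u)"

(* Tested on compactly supported functions only: for u merely locally integrable the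
   integral of u * phi need not converge for every Schwartz function phi. *)
definition represents :: "'n::{finite,linorder} cfun \<Rightarrow> 'n dist \<Rightarrow> bool" where
  "represents u T \<longleftrightarrow> locally_integrable u \<and>
     (\<forall>\<phi>. smooth \<phi> \<longrightarrow> compact (supp \<phi>) \<longrightarrow> T \<phi> = dist_of u \<phi>)"

definition regular :: "'n::{finite,linorder} dist \<Rightarrow> bool" where
  "regular T \<longleftrightarrow> (\<exists>u. represents u T)"

(* The function a regular distribution is identified with, unique up to null sets. *)
definition fun_of :: "'n::{finite,linorder} dist \<Rightarrow> 'n cfun" where
  "fun_of T = (SOME u. represents u T)"

definition in_L2 :: "'n::{finite,linorder} dist \<Rightarrow> bool" where
  "in_L2 T \<longleftrightarrow> (\<exists>g. g \<in> borel_measurable lborel \<and> integrable lborel (\<lambda>x. (norm (g x))\<^sup>2) \<and>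
     (\<forall>\<phi>. schwartz \<phi> \<longrightarrow> T \<phi> = dist_of g \<phi>))"

definition sobolev_W2 :: "real \<Rightarrow> 'n::{finite,linorder} dist set" where
  "sobolev_W2 s = {T. tempered T \<and>
     in_L2 (mult_dist (\<lambda>\<xi>. complex_of_real ((1 + (norm \<xi>)\<^sup>2) powr (s / 2))) (fourier_dist T))}"


subsection \<open>The outgoing resolvent and the multilinear forms\<close>

definition resolvent_eps :: "real \<Rightarrow> real \<Rightarrow> 'n::finite dist \<Rightarrow> 'n dist" where
  "resolvent_eps k \<epsilon> T =
     inv_fourier_dist
       (mult_dist (\<lambda>\<xi>. 1 / (complex_of_real (- (norm \<xi>)\<^sup>2 + k\<^sup>2) + \<i> * complex_of_real \<epsilon>))
         (fourier_dist T))"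

(* The "+ i0" in the multiplier is the limit of "+ i epsilon" as epsilon decreases to 0, in the
   topology of tempered distributions. *)
definition resolvent :: "real \<Rightarrow> 'n::finite dist \<Rightarrow> 'n dist" where
  "resolvent k T \<phi> = Lim (at_right 0) (\<lambda>\<epsilon>. resolvent_eps k \<epsilon> T \<phi>)"

definition resolvent_exists :: "real \<Rightarrow> 'n::{finite,linorder} dist \<Rightarrow> bool" where
  "resolvent_exists k T \<longleftrightarrow>
     (\<forall>\<phi>. schwartz \<phi> \<longrightarrow> (\<exists>l. ((\<lambda>\<epsilon>. resolvent_eps k \<epsilon> T \<phi>) \<longlongrightarrow> l) (at_right 0)))"

definition fR :: "real \<Rightarrow> 'n::{finite,linorder} cfun \<Rightarrow> 'n cfun \<Rightarrow> 'n cfun" where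
  "fR k f g = (\<lambda>x. f x * fun_of (resolvent k (dist_of g)) x)"

definition fR_defined :: "real \<Rightarrow> 'n::{finite,linorder} cfun \<Rightarrow> 'n cfun \<Rightarrow> bool" where
  "fR_defined k f g \<longleftrightarrow> resolvent_exists k (dist_of g) \<and> regular (resolvent k (dist_of g)) \<and>
     locally_integrable (fR k f g)"

(* born k e [f_1, ..., f_j] = (f_1 R_k) ... (f_{j-1} R_k) (f_j e) *)
fun born :: "real \<Rightarrow> 'n::{finite,linorder} cfun \<Rightarrow> 'n cfun list \<Rightarrow> 'n cfun" where
  "born k e [] = (\<lambda>x. 0)"
| "born k e [f] = (\<lambda>x. f x * e x)"
| "born k e (f # g # fs) = fR k f (born k e (g # fs))"

fun born_defined :: "real \<Rightarrow> 'n::{finite,linorder} cfun \<Rightarrow> 'n cfun list \<Rightarrow> bool" where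
  "born_defined k e [] \<longleftrightarrow> False"
| "born_defined k e [f] \<longleftrightarrow> locally_integrable (\<lambda>x. f x * e x)"
| "born_defined k e (f # g # fs) \<longleftrightarrow>
     born_defined k e (g # fs) \<and> fR_defined k f (born k e (g # fs))"

definition wavenumber :: "real ^ 'n::finite \<Rightarrow> real" where
  "wavenumber \<xi> = norm \<xi> / 2"

definition direction :: "real ^ 'n::finite \<Rightarrow> real ^ 'n" where
  "direction \<xi> = - (\<xi> /\<^sub>R norm \<xi>)"

definition plane_wave :: "real \<Rightarrow> real ^ 'n::finite \<Rightarrow> 'n cfun" where
  "plane_wave k \<theta> y = cis (k * (\<theta> \<bullet> y))"

definition Q_integrand :: "'n::{finite,linorder} dist list \<Rightarrow> (real, 'n) vec \<Rightarrow> 'n cfun" where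
  "Q_integrand fs \<xi> =
     (let k = wavenumber \<xi>; e = plane_wave k (direction \<xi>)
      in (\<lambda>y. e y * born k e (map fun_of fs) y))"

definition Q_hat :: "'n::{finite,linorder} dist list \<Rightarrow> 'n cfun" where
  "Q_hat fs \<xi> = (LINT y|lborel. Q_integrand fs \<xi> y)"

definition Q :: "'n::{finite,linorder} dist list \<Rightarrow> 'n dist" where
  "Q fs = inv_fourier_dist (dist_of (Q_hat fs))"

(* Q [f_1, ..., f_j] is a meaningful expression for compactly supported f_i: for almost every
   frequency all resolvents, products and integrals in its definition exist, and the resulting
   function of the frequency defines a distribution on Schwartz functions, whose inverse Fourier
   transform can be taken. For square integrable f_i this can fail in high dimension, where the
   product of f_i with a resolvent need not be locally integrable. *)
definition Q_defined :: "'n::{finite,linorder} dist list \<Rightarrow> bool" where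
  "Q_defined fs \<longleftrightarrow>
     (\<forall>f\<in>set fs. regular f) \<and>
     (AE \<xi> in lborel.
        born_defined (wavenumber \<xi>) (plane_wave (wavenumber \<xi>) (direction \<xi>)) (map fun_of fs) \<and>
        integrable lborel (Q_integrand fs \<xi>)) \<and>
     (\<forall>\<phi>. schwartz \<phi> \<longrightarrow> integrable lborel (\<lambda>\<xi>. Q_hat fs \<xi> * \<phi> \<xi>))"

end

theory Submission
  imports Defs
begin

text \<open>
  Fix a frequency \<open>\<xi>\<close> and let \<open>e y = cis (- (\<xi> \<bullet> y) / 2)\<close> be the plane wave in the definition of the
  multilinear form. Writing \<open>P f = e\<^sup>-\<^sup>1 R\<^sub>k (e f)\<close>, the form at \<open>\<xi>\<close> is the integral of
  \<open>cis (- (\<xi> \<bullet> y)) f\<^sub>1 P (f\<^sub>2 P (\<dots> f\<^sub>j))\<close>. The operator \<open>P\<close> commutes with translations, hence with weak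
  derivatives, so that multiplication by \<open>\<i> \<xi>\<^sub>i\<close> distributes by integration by parts and the product
  rule over the \<open>j\<close> factors; iterating gives the multinomial sum for almost every \<open>\<xi>\<close>.

  The hypotheses only provide integrability of the outermost products \<open>D\<^sup>\<beta> q \<cdot> D\<^sup>\<gamma> (P \<dots>)\<close> for
  \<open>\<beta> = \<gamma> = 0\<close> and for \<open>\<beta> + \<gamma> = \<alpha>\<close>, whereas the iteration passes through all \<open>\<beta> + \<gamma> \<le> \<alpha>\<close>. On almost
  every plane spanned by the directions \<open>i\<close> with \<open>\<alpha>\<^sub>i > 0\<close> these products are integrable, because in each
  such direction one of the two factors still has a derivative to spare and is therefore bounded by an
  integral along that direction. Cutting off to the planes on which the relevant integrals are at most
  \<open>N\<close> leaves the weak derivatives in these directions intact, and one lets \<open>N\<close> tend to infinity in the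
  final identity only.
\<close>


section \<open>Integration on Euclidean space\<close>

text \<open>The hypotheses speak only of lists of multi-indices with sum exactly \<alpha>, and of
  the zero list. A proper tail of such a list may nevertheless have any sum \<le> \<alpha>, because
  the missing derivatives can be put on a factor in front of it; so the inner products of all orders
  up to \<alpha> are under control and the induction over their length needs no cut-off. Only at
  full length \<open>j\<close> is no factor left to take up the surplus, and this is where the
  integrability gap opens. The resolvent is known only as a limit of regularised multipliers tested
  on Schwartz functions, and the function representing it only through compactly supported tests.
  Commutation with derivatives is therefore carried out on the test side for \<epsilon> > 0, where
  the symbol is bounded, and only the resulting identity is passed to the limit. Test functions are
  tensor products: \<open>D\<close> acts on them factor by factor, so no partial derivatives are
  ever interchanged, and averages over coordinate segments stay in the class.\<close>

lemma nn_integral_translate: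
  fixes a :: "'a::euclidean_space"
  assumes [measurable]: "f \<in> borel_measurable borel"
  shows "(\<integral>\<^sup>+x. f (x + a) \<partial>lborel) = (\<integral>\<^sup>+x. f x \<partial>lborel)"
proof -
  have "(\<integral>\<^sup>+x. f x \<partial>lborel) = (\<integral>\<^sup>+x. f x \<partial>distr lborel borel ((+) a))"
    by (simp add: lborel_distr_plus)
  also have "\<dots> = (\<integral>\<^sup>+x. f (x + a) \<partial>lborel)"
    by (subst nn_integral_distr) (auto simp: add.commute)
  finally show ?thesis by simp
qed

lemma integrable_translate:
  fixes a :: "'a::euclidean_space" and f :: "'a \<Rightarrow> 'b::{banach, second_countable_topology}"
  assumes "integrable lborel f"
  shows "integrable lborel (\<lambda>x. f (x + a))"
proof -
  have [measurable]: "f \<in> borel_measurable borel"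
    using borel_measurable_integrable[OF assms] by simp
  have "integrable (distr lborel borel ((+) a)) f"
    using assms by (simp add: lborel_distr_plus)
  then show ?thesis
    by (subst (asm) integrable_distr_eq) (auto simp: add.commute)
qed

lemma integral_translate:
  fixes a :: "'a::euclidean_space" and f :: "'a \<Rightarrow> 'b::{banach, second_countable_topology}"
  shows "(LINT x|lborel. f (x + a)) = (LINT x|lborel. f x)"
proof (cases "integrable lborel f")
  case True
  have [measurable]: "f \<in> borel_measurable borel"
    using borel_measurable_integrable[OF True] by simp
  have "(LINT x|lborel. f x) = (LINT x|distr lborel borel ((+) a). f x)"
    by (simp add: lborel_distr_plus)
  also have "\<dots> = (LINT x|lborel. f (x + a))"
    by (subst integral_distr) (auto simp: add.commute)
  finally show ?thesis by simp
next
  case False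
  moreover have "\<not> integrable lborel (\<lambda>x. f (x + a))"
    using integrable_translate[of "\<lambda>x. f (x + a)" "-a"] False by auto
  ultimately show ?thesis by (simp add: not_integrable_integral_eq)
qed

lemma AE_translate:
  fixes a :: "'a::euclidean_space"
  assumes "AE x in lborel. P x"
  shows "AE x in lborel. P (x + a)"
proof -
  obtain N where N: "{x. \<not> P x} \<subseteq> N" "N \<in> sets lborel" "emeasure lborel N = 0"
    using AE_E[OF assms] by auto
  have [measurable]: "N \<in> sets borel" using N by simp
  have "AE x in lborel. x \<notin> N"
    using AE_not_in[of N lborel] N by (auto simp: null_sets_def)
  then have "AE x in distr lborel borel ((+) a). x \<notin> N"
    by (subst lborel_distr_plus)
  then have "AE x in lborel. a + x \<notin> N"
    by (subst (asm) AE_distr_iff) auto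
  then show ?thesis
    using N(1) by (rule_tac AE_mp) (auto simp: add.commute)
qed

lemma compact_subset_symmetric_cbox:
  fixes K :: "(real ^ 'n) set"
  assumes "compact K"
  shows "\<exists>L>0. K \<subseteq> cbox (\<chi> i. - L) (\<chi> i. L)"
proof -
  obtain L where L: "L > 0" "\<And>x. x \<in> K \<Longrightarrow> norm x \<le> L"
    using compact_imp_bounded[OF assms] by (auto simp: bounded_pos)
  have "K \<subseteq> cbox (\<chi> i. - L) (\<chi> i. L)"
  proof
    fix x assume "x \<in> K"
    then have "\<bar>x $ i\<bar> \<le> L" for i
      using L(2) component_le_norm_cart[of x i] order_trans by blast
    then show "x \<in> cbox (\<chi> i. - L) (\<chi> i. L)"
      by (auto simp: mem_box_cart abs_le_iff) (metis add.inverse_inverse neg_le_iff_le)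
  qed
  with L(1) show ?thesis by blast
qed

text \<open>Cutting off to balls of integer radius gives integrable, hence measurable, functions
  that converge pointwise to \<open>u\<close>.\<close>

lemma locally_integrable_measurable:
  fixes u :: "'n::finite cfun"
  assumes "locally_integrable u"
  shows "u \<in> borel_measurable borel"
proof -
  have "(\<lambda>x. indicat_real (cball 0 (real m)) x *\<^sub>R u x) \<in> borel_measurable borel" for m :: nat
  proof -
    have "integrable lborel (\<lambda>x. indicat_real (cball 0 (real m)) x *\<^sub>R u x)"
      using assms compact_cball unfolding locally_integrable_def set_integrable_def by blast
    from borel_measurable_integrable[OF this] show ?thesis by simp
  qed
  moreover have "(\<lambda>m. indicat_real (cball 0 (real m)) x *\<^sub>R u x) \<longlonglongrightarrow> u x" for x
  proof -
    obtain m0 :: nat where m0: "norm x \<le> m0" using real_arch_simple by blast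
    have "\<forall>\<^sub>F m in sequentially. indicat_real (cball 0 (real m)) x *\<^sub>R u x = u x"
      using eventually_ge_at_top[of m0]
      by eventually_elim (use m0 in \<open>auto simp: indicator_def\<close>)
    then show ?thesis by (rule tendsto_eventually)
  qed
  ultimately show ?thesis
    by (rule borel_measurable_LIMSEQ_metric)
qed

lemma integrable_imp_locally_integrable:
  fixes u :: "'n::finite cfun"
  assumes "integrable lborel u"
  shows "locally_integrable u"
  unfolding locally_integrable_def set_integrable_def
  using assms by (auto intro!: integrable_mult_indicator dest: compact_imp_closed)

lemma locally_integrable_add:
  fixes u v :: "'n::finite cfun"
  assumes "locally_integrable u" "locally_integrable v"
  shows "locally_integrable (\<lambda>x. u x + v x)"
  using assms unfolding locally_integrable_def by auto

lemma locally_integrable_sum: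
  fixes u :: "'b \<Rightarrow> 'n::finite cfun"
  assumes "\<And>a. a \<in> A \<Longrightarrow> locally_integrable (u a)"
  shows "locally_integrable (\<lambda>x. \<Sum>a\<in>A. u a x)"
  using assms
  by (induction A rule: infinite_finite_induct)
     (auto intro!: locally_integrable_add simp: integrable_imp_locally_integrable)

lemma locally_integrable_mult_bounded:
  fixes u m :: "'n::finite cfun"
  assumes u: "locally_integrable u" and [measurable]: "m \<in> borel_measurable borel"
    and B: "\<And>x. norm (m x) \<le> B"
  shows "locally_integrable (\<lambda>x. m x * u x)"
  unfolding locally_integrable_def set_integrable_def
proof (intro allI impI)
  fix K :: "(real ^ 'n) set" assume K: "compact K"
  then have [measurable]: "K \<in> sets borel" by (auto dest: compact_imp_closed)
  note [measurable] = locally_integrable_measurable[OF u]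
  have B0: "B \<ge> 0" using B norm_ge_zero order_trans by blast
  show "integrable lborel (\<lambda>x. indicat_real K x *\<^sub>R (m x * u x))"
  proof (rule Bochner_Integration.integrable_bound)
    show "integrable lborel (\<lambda>x. B * norm (indicat_real K x *\<^sub>R u x))"
      using u K unfolding locally_integrable_def set_integrable_def by (intro integrable_mult_right integrable_norm) auto
    show "AE x in lborel. norm (indicat_real K x *\<^sub>R (m x * u x)) \<le> norm (B * norm (indicat_real K x *\<^sub>R u x))"
      using B B0 by (auto simp: norm_mult indicator_def intro!: mult_right_mono)
  qed measurable
qed

lemma integrable_mult_bounded:
  fixes u m :: "'n::finite cfun"
  assumes u: "integrable lborel u" and [measurable]: "m \<in> borel_measurable borel"
    and B: "\<And>x. norm (m x) \<le> B"
  shows "integrable lborel (\<lambda>x. u x * m x)"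
proof (rule Bochner_Integration.integrable_bound)
  have [measurable]: "u \<in> borel_measurable borel"
    using borel_measurable_integrable[OF u] by simp
  have B0: "B \<ge> 0" using B norm_ge_zero order_trans by blast
  show "integrable lborel (\<lambda>x. norm (u x) * B)"
    using u by (intro integrable_mult_left integrable_norm) auto
  show "AE x in lborel. norm (u x * m x) \<le> norm (norm (u x) * B)"
    using B B0 by (auto simp: norm_mult intro!: mult_left_mono)
  show "(\<lambda>x. u x * m x) \<in> borel_measurable lborel" by measurable
qed

lemma locally_integrable_vanishing_outside:
  fixes u :: "'n::finite cfun"
  assumes u: "locally_integrable u" and K: "compact K" and 0: "AE x in lborel. x \<notin> K \<longrightarrow> u x = 0"
  shows "integrable lborel u"
proof -
  have [measurable]: "K \<in> sets borel" using K by (auto dest: compact_imp_closed)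
  note [measurable] = locally_integrable_measurable[OF u]
  have "integrable lborel (\<lambda>x. indicator K x *\<^sub>R u x)"
    using u K by (auto simp: locally_integrable_def set_integrable_def)
  then show ?thesis
    by (rule integrable_cong_AE_imp) (use 0 in \<open>auto simp: indicator_def\<close>)
qed


section \<open>Smooth compactly supported functions\<close>

text \<open>Coinduction replaces counting orders of differentiability: a function is smooth once it
  lies in some class whose members are differentiable with derivatives in the same class.\<close>

coinductive smooth1 :: "(real \<Rightarrow> complex) \<Rightarrow> bool" where
  smooth1I: "(\<And>x. (g has_vector_derivative g' x) (at x)) \<Longrightarrow> smooth1 g' \<Longrightarrow> smooth1 g"

definition vderiv :: "(real \<Rightarrow> complex) \<Rightarrow> real \<Rightarrow> complex" where
  "vderiv g t = vector_derivative g (at t)"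

lemma vderiv_eqI: "(\<And>x. (g has_vector_derivative g' x) (at x)) \<Longrightarrow> vderiv g = g'"
  unfolding vderiv_def using vector_derivative_at by blast

lemma smooth1_vderiv:
  assumes "smooth1 g"
  shows "(g has_vector_derivative vderiv g x) (at x)" "smooth1 (vderiv g)"
proof -
  obtain g' where g': "\<And>x. (g has_vector_derivative g' x) (at x)" "smooth1 g'"
    using assms by (cases rule: smooth1.cases) blast
  moreover have "vderiv g = g'" by (rule vderiv_eqI) (rule g'(1))
  ultimately show "(g has_vector_derivative vderiv g x) (at x)" "smooth1 (vderiv g)" by simp_all
qed

lemma smooth1_funpow_vderiv: "smooth1 g \<Longrightarrow> smooth1 ((vderiv ^^ m) g)"
  by (induction m) (auto simp: smooth1_vderiv)

lemma smooth1_continuous: "smooth1 g \<Longrightarrow> isCont g x"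
  using smooth1_vderiv(1)[of g x] by (rule has_vector_derivative_continuous)

text \<open>This closure lets the coinduction run up to sums, products and known smooth functions:
  if every generator has a derivative in the algebra, then so has every element, and the algebra is
  a class closed under differentiation.\<close>

inductive alg_gen :: "(real \<Rightarrow> complex) set \<Rightarrow> (real \<Rightarrow> complex) \<Rightarrow> bool" for S where
  base: "g \<in> S \<Longrightarrow> alg_gen S g"
| smooth: "smooth1 g \<Longrightarrow> alg_gen S g"
| add: "alg_gen S f \<Longrightarrow> alg_gen S g \<Longrightarrow> alg_gen S (\<lambda>t. f t + g t)"
| mult: "alg_gen S f \<Longrightarrow> alg_gen S g \<Longrightarrow> alg_gen S (\<lambda>t. f t * g t)"

lemma smooth1_alg_gen:
  assumes S: "\<And>g. g \<in> S \<Longrightarrow> \<exists>g'. alg_gen S g' \<and> (\<forall>x. (g has_vector_derivative g' x) (at x))"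
    and "alg_gen S g"
  shows "smooth1 g"
proof -
  have D: "\<exists>g'. alg_gen S g' \<and> (\<forall>x. (g has_vector_derivative g' x) (at x))" if "alg_gen S g" for g
    using that
  proof induction
    case (smooth g)
    then show ?case using smooth1_vderiv alg_gen.smooth by blast
  next
    case (add f g)
    then obtain f' g' where "alg_gen S f'" "\<forall>x. (f has_vector_derivative f' x) (at x)"
      "alg_gen S g'" "\<forall>x. (g has_vector_derivative g' x) (at x)" by blast
    then show ?case
      by (intro exI[of _ "\<lambda>t. f' t + g' t"]) (auto intro!: alg_gen.add derivative_eq_intros)
  next
    case (mult f g)
    then obtain f' g' where "alg_gen S f'" "\<forall>x. (f has_vector_derivative f' x) (at x)"
      "alg_gen S g'" "\<forall>x. (g has_vector_derivative g' x) (at x)" by blast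
    with mult show ?case
      by (intro exI[of _ "\<lambda>t. f t * g' t + f' t * g t"])
         (auto intro!: alg_gen.add alg_gen.mult has_vector_derivative_mult)
  qed (use S in blast)
  show ?thesis
    using assms(2) by (coinduction arbitrary: g) (use D in blast)
qed

lemma smooth1_const: "smooth1 (\<lambda>_. c)"
proof -
  have "\<exists>c. g = (\<lambda>_. c) \<Longrightarrow> smooth1 g" for g :: "real \<Rightarrow> complex"
    by (coinduction arbitrary: g) (auto intro!: exI[of _ "\<lambda>_. 0"] derivative_eq_intros)
  then show ?thesis by blast
qed

lemma smooth1_mult: "smooth1 f \<Longrightarrow> smooth1 g \<Longrightarrow> smooth1 (\<lambda>t. f t * g t)"
  by (rule smooth1_alg_gen[of "{}"]) (auto intro: alg_gen.intros)

lemma smooth1_add: "smooth1 f \<Longrightarrow> smooth1 g \<Longrightarrow> smooth1 (\<lambda>t. f t + g t)"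
  by (rule smooth1_alg_gen[of "{}"]) (auto intro: alg_gen.intros)

lemma smooth1_diff:
  assumes "smooth1 f" "smooth1 g"
  shows "smooth1 (\<lambda>t. f t - g t)"
  using smooth1_add[OF assms(1) smooth1_mult[OF smooth1_const[of "-1"] assms(2)]] by simp

lemma smooth1_cis: "smooth1 (\<lambda>t. cis (c * t))"
proof (rule smooth1_alg_gen[of "{\<lambda>t. cis (c * t)}"])
  show "\<exists>g'. alg_gen {\<lambda>t. cis (c * t)} g' \<and> (\<forall>x. (g has_vector_derivative g' x) (at x))"
    if "g \<in> {\<lambda>t. cis (c * t)}" for g
    using that
  proof (intro exI[of _ "\<lambda>t. (\<i> * of_real c) * cis (c * t)"] conjI allI)
    show "alg_gen {\<lambda>t. cis (c * t)} (\<lambda>t. (\<i> * of_real c) * cis (c * t))"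
      by (intro alg_gen.mult alg_gen.base alg_gen.smooth smooth1_const) auto
    show "(g has_vector_derivative \<i> * of_real c * cis (c * x)) (at x)" for x
      using that by (auto intro!: derivative_eq_intros simp: has_vector_derivative_def scaleR_conv_of_real)
  qed
qed (auto intro: alg_gen.base)

lemma smooth1_affine:
  assumes "smooth1 g"
  shows "smooth1 (\<lambda>t. g (s * t + r))"
proof -
  \<comment> \<open>The scalar \<open>c\<close> is there to absorb the factor \<open>s\<close> that
    the chain rule produces at each differentiation.\<close>
  have "smooth1 f" if "\<exists>g c. smooth1 g \<and> f = (\<lambda>t. of_real c * g (s * t + r))" for f
    using that
  proof (coinduction arbitrary: f)
    case (smooth1 f)
    then obtain g c where g: "smooth1 g" "f = (\<lambda>t. complex_of_real c * g (s * t + r))" by blast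
    have "((g \<circ> (\<lambda>t. s * t + r)) has_vector_derivative s *\<^sub>R vderiv g (s * x + r)) (at x)" for x
      by (rule vector_diff_chain_at) (auto intro!: derivative_eq_intros smooth1_vderiv g)
    then have "(f has_vector_derivative of_real c * (s *\<^sub>R vderiv g (s * x + r))) (at x)" for x
      unfolding g(2) o_def by (rule has_vector_derivative_mult_right)
    moreover have "(\<lambda>x. of_real c * (s *\<^sub>R vderiv g (s * x + r))) = (\<lambda>t. of_real (c * s) * vderiv g (s * t + r))"
      by (simp add: scaleR_conv_of_real mult_ac)
    ultimately show ?case
      using smooth1_vderiv(2)[OF g(1)] by (intro exI[of _ f] exI[of _ "\<lambda>x. of_real c * (s *\<^sub>R vderiv g (s * x + r))"]) blast
  qed
  from this[of "\<lambda>t. g (s * t + r)"] assms show ?thesis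
    by (metis (no_types, lifting) ext mult_1 of_real_1)
qed

text \<open>For \<open>k = 0\<close> this is the standard flat function. The powers of 1/t close the
  family under differentiation, up to linear combinations, and the rate \<open>c\<close> is kept
  free because c \<rightarrow> 0 yields the indicator of the positive half-line.\<close>

definition flat_exp :: "real \<Rightarrow> nat \<Rightarrow> real \<Rightarrow> complex" where
  "flat_exp c k t = (if t > 0 then of_real (exp (- c / t) / t ^ k) else 0)"

text \<open>The substitution y = 1/t reduces this to the decay of y^(k+1) exp(-c y) at infinity. The
  exponent is \<open>Suc k\<close> because the difference quotient of \<open>flat_exp c k\<close> at
  0 costs one further power of t.\<close>

lemma flat_exp_over_t_tendsto:
  assumes "c > 0"
  shows "((\<lambda>t. exp (- c / t) / t ^ Suc k) \<longlongrightarrow> 0) (at_right (0::real))"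
proof -
  have *: "((\<lambda>y::real. y ^ Suc k * exp (- c * y)) \<longlongrightarrow> 0) at_top"
  proof -
    have "((\<lambda>y::real. (c * y) ^ Suc k / exp (c * y)) \<longlongrightarrow> 0) at_top"
      by (rule filterlim_compose[OF tendsto_power_div_exp_0])
         (use assms in \<open>auto intro: filterlim_tendsto_pos_mult_at_top[OF tendsto_const] simp: filterlim_ident\<close>)
    from tendsto_mult[OF tendsto_const[of "1 / c ^ Suc k"] this] show ?thesis
      using assms by (simp add: power_mult_distrib exp_minus field_simps)
  qed
  have "((\<lambda>t::real. (inverse t) ^ Suc k * exp (- c * inverse t)) \<longlongrightarrow> 0) (at_right 0)"
    by (rule filterlim_compose[OF * filterlim_inverse_at_top_right])
  then show ?thesis by (simp add: field_simps)
qed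

lemma flat_exp_has_vector_derivative:
  assumes "c > 0"
  shows "(flat_exp c k has_vector_derivative
    (of_real c * flat_exp c (k + 2) x - of_nat k * flat_exp c (k + 1) x)) (at x)"
proof -
  consider "x > 0" | "x < 0" | "x = 0" by linarith
  then show ?thesis
  proof cases
    case 1
    \<comment> \<open>For \<open>k = 0\<close> the truncated exponent \<open>k - 1\<close> is wrong
      but harmless, since its coefficient vanishes; hence the case distinction.\<close>
    have y: "real k * inverse x ^ (k - 1) * (inverse x * inverse x) = k * inverse x ^ (k + 1)"
      by (cases k) (simp_all add: algebra_simps)
    have "((\<lambda>t. exp (- c * inverse t) * inverse t ^ k) has_real_derivative
        (exp (- c * inverse x) * (c * (inverse x * inverse x)) * inverse x ^ k
          - exp (- c * inverse x) * (real k * inverse x ^ (k - 1) * (inverse x * inverse x)))) (at x)"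
      using 1 by (auto intro!: derivative_eq_intros)
    then have "((\<lambda>t. exp (- c / t) / t ^ k) has_real_derivative
        (c * (exp (- c / x) / x ^ (k + 2)) - k * (exp (- c / x) / x ^ (k + 1)))) (at x)"
      unfolding y by (simp add: divide_inverse power_inverse algebra_simps)
    then have "((\<lambda>t. complex_of_real (exp (- c / t) / t ^ k)) has_vector_derivative
        of_real (c * (exp (- c / x) / x ^ (k + 2)) - k * (exp (- c / x) / x ^ (k + 1)))) (at x)"
      unfolding has_real_derivative_iff_has_vector_derivative by (rule bounded_linear.has_vector_derivative[OF bounded_linear_of_real])
    then have "(flat_exp c k has_vector_derivative
        of_real (c * (exp (- c / x) / x ^ (k + 2)) - k * (exp (- c / x) / x ^ (k + 1)))) (at x)"
      by (rule has_vector_derivative_transform_within_open[of _ _ _ "{0<..}"])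
         (use 1 in \<open>auto simp: flat_exp_def\<close>)
    then show ?thesis using 1 by (simp add: flat_exp_def)
  next
    case 2
    have "(flat_exp c k has_vector_derivative 0) (at x)"
      by (rule has_vector_derivative_transform_within_open[of "\<lambda>_. 0" _ _ "{..<0}"])
         (use 2 in \<open>auto simp: flat_exp_def\<close>)
    then show ?thesis using 2 by (simp add: flat_exp_def)
  next
    case 3
    \<comment> \<open>The value at the origin is 0, so this is the difference quotient there. It is
      identically 0 from the left and tends to 0 from the right by exponential decay.\<close>
    have "((\<lambda>y. norm (flat_exp c k y / of_real y)) \<longlongrightarrow> 0) (at 0)"
    proof (rule filterlim_split_at)
      have "\<forall>\<^sub>F y in at_left 0. norm (flat_exp c k y / of_real y) = 0"
        by (rule eventually_mono[OF eventually_at_left_real[of "-1" 0]]) (auto simp: flat_exp_def)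
      then show "((\<lambda>y. norm (flat_exp c k y / of_real y)) \<longlongrightarrow> 0) (at_left 0)"
        by (rule tendsto_eventually)
      have "\<forall>\<^sub>F y in at_right 0. exp (- c / y) / y ^ Suc k = norm (flat_exp c k y / of_real y)"
        by (rule eventually_mono[OF eventually_at_right_real[of 0 1]])
           (auto simp: flat_exp_def norm_divide norm_mult norm_power)
      then show "((\<lambda>y. norm (flat_exp c k y / of_real y)) \<longlongrightarrow> 0) (at_right 0)"
        using flat_exp_over_t_tendsto[OF assms] by (rule Lim_transform_eventually[rotated])
    qed
    moreover have "flat_exp c m 0 = 0" for m by (simp add: flat_exp_def)
    ultimately show ?thesis using 3
      by (simp add: has_vector_derivative_def has_derivative_at bounded_linear_zero norm_divide)
  qed
qed

lemma smooth1_flat_exp: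
  assumes "c > 0"
  shows "smooth1 (flat_exp c k)"
proof (rule smooth1_alg_gen[of "range (flat_exp c)"])
  show "\<exists>g'. alg_gen (range (flat_exp c)) g' \<and> (\<forall>x. (g has_vector_derivative g' x) (at x))"
    if g: "g \<in> range (flat_exp c)" for g
  proof -
    obtain k where k: "g = flat_exp c k" using g by auto
    have "alg_gen (range (flat_exp c))
        (\<lambda>x. of_real c * flat_exp c (k + 2) x + (- of_nat k) * flat_exp c (k + 1) x)"
      by (intro alg_gen.add alg_gen.mult alg_gen.base alg_gen.smooth smooth1_const) auto
    with flat_exp_has_vector_derivative[OF assms, of k] k show ?thesis
      by (intro exI[of _ "\<lambda>x. of_real c * flat_exp c (k + 2) x + (- of_nat k) * flat_exp c (k + 1) x"]) auto
  qed
qed (auto intro: alg_gen.base)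

section \<open>Compactly supported test functions of one variable\<close>

definition test1 :: "real \<Rightarrow> real \<Rightarrow> (real \<Rightarrow> complex) \<Rightarrow> bool" where
  "test1 a b g \<longleftrightarrow> smooth1 g \<and> (\<forall>t. t \<notin> {a..b} \<longrightarrow> g t = 0)"

lemma test1_vderiv:
  assumes "test1 a b g"
  shows "test1 a b (vderiv g)"
proof -
  have "vderiv g t = 0" if "t \<notin> {a..b}" for t
  proof -
    have "(g has_vector_derivative 0) (at t)"
      by (rule has_vector_derivative_transform_within_open[of "\<lambda>_. 0" _ _ "- {a..b}"])
         (use that assms in \<open>auto simp: test1_def open_Compl\<close>)
    then show ?thesis by (simp add: vderiv_def vector_derivative_at)
  qed
  then show ?thesis using assms by (auto simp: test1_def smooth1_vderiv)
qed

lemma test1_funpow_vderiv: "test1 a b g \<Longrightarrow> test1 a b ((vderiv ^^ m) g)"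
  by (induction m) (auto simp: test1_vderiv)

lemma test1_mult_cis: "test1 a b g \<Longrightarrow> test1 a b (\<lambda>t. cis (c * t) * g t)"
  by (auto simp: test1_def intro: smooth1_mult smooth1_cis)

lemma test1_shift: 
  assumes "test1 a b g"
  shows "test1 (a + h) (b + h) (\<lambda>t. g (t - h))"
  using assms smooth1_affine[of g 1 "-h"] by (auto simp: test1_def)

text \<open>With a primitive B of g, the average is B(t) - B(t - h). Thus a finite difference of a
  test function is the derivative of another test function, which is how the segment form of weak
  differentiability is matched with distributional derivatives.\<close>

lemma test1_average:
  assumes g: "test1 a b g" and h: "h \<ge> 0"
  defines "A \<equiv> (\<lambda>t. LINT s:{0..h}|lborel. g (t - s))"
  shows "test1 a (b + h) A" "vderiv A = (\<lambda>t. g t - g (t - h))"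
proof -
  have cont: "continuous_on X g" for X
    using g smooth1_continuous by (auto simp: test1_def continuous_at_imp_continuous_on)
  \<comment> \<open>The base point lies strictly to the left of the support, so this is the
    primitive that vanishes left of \<open>a\<close>, and the interval is nondegenerate at every
    point where \<open>g\<close> can be nonzero.\<close>
  define B where "B t = integral {a - 1..t} g" for t
  have B: "(B has_vector_derivative g t) (at t)" for t
  proof (cases "t > a - 1")
    case True
    have "(B has_vector_derivative g t) (at t within {a - 1..t + 1})"
      unfolding B_def[abs_def] by (rule integral_has_vector_derivative) (use True cont in auto)
    then show ?thesis
      using True by (subst (asm) at_within_interior) (auto simp: interior_atLeastAtMost_real)
  next
    case False
    then have "t < a" by simp
    have B0: "B s = 0" if "s < a" for s
    proof -
      have "B s = integral {a - 1..s} (\<lambda>_. 0)" unfolding B_def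
        by (rule Henstock_Kurzweil_Integration.integral_cong) (use g that in \<open>auto simp: test1_def\<close>)
      then show ?thesis by simp
    qed
    have "(B has_vector_derivative 0) (at t)"
      by (rule has_vector_derivative_transform_within_open[of "\<lambda>_. 0" _ _ "{..<a}"]) (use \<open>t < a\<close> B0 in auto)
    moreover have "g t = 0" using g \<open>t < a\<close> by (auto simp: test1_def)
    ultimately show ?thesis by simp
  qed
  have A: "A t = B t - B (t - h)" for t
  proof -
    have "((B \<circ> (\<lambda>s. t - s)) has_vector_derivative ((-1) *\<^sub>R g (t - s))) (at s)" for s
      by (rule vector_diff_chain_at) (auto intro!: derivative_eq_intros B)
    then have "((\<lambda>s. - B (t - s)) has_vector_derivative g (t - s)) (at s within {0..h})" for s
      using has_vector_derivative_minus[THEN has_vector_derivative_at_within, of _ "- g (t - s)"] by (simp add: o_def)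
    then have "(LINT s|lborel. indicat_real {0..h} s *\<^sub>R g (t - s)) = - B (t - h) - - B (t - 0)"
      by (intro integral_FTC_atLeastAtMost[OF h] continuous_on_compose2[OF cont[of UNIV]])
         (auto intro!: continuous_intros)
    then show ?thesis by (simp add: A_def set_lebesgue_integral_def)
  qed
  have DA: "(A has_vector_derivative g t - g (t - h)) (at t)" for t
  proof -
    have "((B \<circ> (\<lambda>s. s - h)) has_vector_derivative (1 *\<^sub>R g (t - h))) (at t)"
      by (rule vector_diff_chain_at) (auto intro!: derivative_eq_intros B)
    then have "((\<lambda>s. B s - B (s - h)) has_vector_derivative (g t - g (t - h))) (at t)"
      using B by (auto intro!: derivative_eq_intros simp: o_def)
    then show ?thesis using A by presburger
  qed
  then show vdA: "vderiv A = (\<lambda>t. g t - g (t - h))" by (rule vderiv_eqI)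
  have "smooth1 (\<lambda>t. g t - g (t - h))"
    using test1_shift[OF g, of h] g smooth1_diff by (auto simp: test1_def)
  then have "smooth1 A" using DA by (rule smooth1I[rotated])
  moreover have "A t = 0" if "t \<notin> {a..b + h}" for t
  proof -
    have "A t = (LINT s:{0..h}|lborel. 0)" unfolding A_def
      by (rule set_lebesgue_integral_cong) (use g that h in \<open>auto simp: test1_def\<close>)
    then show ?thesis by simp
  qed
  ultimately show "test1 a (b + h) A" by (auto simp: test1_def)
qed

section \<open>Tensor products of one-dimensional test functions\<close>

definition tensor :: "('n::finite \<Rightarrow> real \<Rightarrow> complex) \<Rightarrow> 'n cfun" where
  "tensor g x = (\<Prod>i\<in>UNIV. g i (x $ i))"

lemma tensor_update: "tensor (g(i := f)) x = f (x $ i) * (\<Prod>l\<in>UNIV - {i}. g l (x $ l))"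
proof -
  have "tensor (g(i := f)) x = f (x $ i) * (\<Prod>l\<in>UNIV - {i}. (g(i := f)) l (x $ l))"
    unfolding tensor_def by (subst prod.remove[of UNIV i]) auto
  also have "(\<Prod>l\<in>UNIV - {i}. (g(i := f)) l (x $ l)) = (\<Prod>l\<in>UNIV - {i}. g l (x $ l))"
    by (intro prod.cong) auto
  finally show ?thesis .
qed

lemma tensor_shift:
  "tensor g (x + t *\<^sub>R axis i 1) = g i (x $ i + t) * (\<Prod>l\<in>UNIV - {i}. g l (x $ l))"
proof -
  have "tensor g (x + t *\<^sub>R axis i 1) = g i (x $ i + t) * (\<Prod>l\<in>UNIV - {i}. g l ((x + t *\<^sub>R axis i 1) $ l))"
    unfolding tensor_def by (subst prod.remove[of UNIV i]) auto
  also have "(\<Prod>l\<in>UNIV - {i}. g l ((x + t *\<^sub>R axis i 1) $ l)) = (\<Prod>l\<in>UNIV - {i}. g l (x $ l))"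
    by (intro prod.cong) (auto simp: axis_def)
  finally show ?thesis .
qed

lemma partial_deriv_tensor:
  assumes "smooth1 (g i)"
  shows "partial_deriv i (tensor g) = tensor (g(i := vderiv (g i)))"
proof
  fix x
  let ?P = "\<Prod>l\<in>UNIV - {i}. g l (x $ l)"
  have "((g i \<circ> (\<lambda>t. x $ i + t)) has_vector_derivative (1 *\<^sub>R vderiv (g i) (x $ i))) (at 0)"
    by (rule vector_diff_chain_at) (auto intro!: derivative_eq_intros smooth1_vderiv assms)
  from has_vector_derivative_mult_left[OF this, of ?P]
  have "((\<lambda>t. tensor g (x + t *\<^sub>R axis i 1)) has_vector_derivative vderiv (g i) (x $ i) * ?P) (at 0)"
    by (simp add: tensor_shift o_def)
  then show "partial_deriv i (tensor g) x = tensor (g(i := vderiv (g i))) x"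
    unfolding partial_deriv_def by (simp add: vector_derivative_at tensor_update)
qed

lemma tensor_differentiable:
  fixes g :: "'n::finite \<Rightarrow> real \<Rightarrow> complex"
  assumes "\<And>i. smooth1 (g i)"
  shows "tensor g differentiable_on UNIV"
proof -
  have "(\<lambda>x. \<Prod>i\<in>A. g i (x $ i)) differentiable at x" if "finite A" for A and x :: "real ^ 'n"
    using that
  proof induction
    case (insert i A)
    have "((\<lambda>x. g i (x $ i)) has_derivative (\<lambda>h. (h $ i) *\<^sub>R vderiv (g i) (x $ i))) (at x)"
      using has_derivative_compose[of "\<lambda>x. x $ i" "\<lambda>h. h $ i" x UNIV "g i"]
        smooth1_vderiv(1)[OF assms[of i], of "x $ i"]
        bounded_linear_imp_has_derivative[OF bounded_linear_vec_nth[of i]]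
      by (auto simp: has_vector_derivative_def)
    then have "(\<lambda>x. g i (x $ i)) differentiable at x"
      by (auto simp: differentiable_def)
    with insert show ?case
      by (auto intro: differentiable_mult)
  qed auto
  then show ?thesis
    unfolding tensor_def[abs_def] differentiable_on_def by (auto intro: differentiable_at_withinI)
qed

lemma tensor_continuous:
  assumes "\<And>i. smooth1 (g i)"
  shows "continuous_on X (tensor g)"
  by (rule continuous_on_subset[OF differentiable_imp_continuous_on[OF tensor_differentiable[OF assms]]]) auto

lemma tensor_measurable [measurable]:
  assumes "\<And>i. smooth1 (g i)"
  shows "tensor g \<in> borel_measurable borel"
  using tensor_continuous[OF assms] by (rule borel_measurable_continuous_onI)

lemma partials_append: "partials (xs @ ys) f = partials xs (partials ys f)"
  by (simp add: partials_def)

lemma partials_tensor: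
  assumes "\<And>i. smooth1 (g i)"
  shows "\<exists>g'. (\<forall>i. smooth1 (g' i)) \<and> partials is (tensor g) = tensor g'"
proof (induction "is")
  case Nil
  then show ?case using assms by (auto simp: partials_def)
next
  case (Cons i "is")
  then obtain g' where g': "\<forall>i. smooth1 (g' i)" "partials is (tensor g) = tensor g'" by blast
  then have "partials (i # is) (tensor g) = tensor (g'(i := vderiv (g' i)))"
    by (simp add: partials_def partial_deriv_tensor)
  moreover have "\<forall>l. smooth1 ((g'(i := vderiv (g' i))) l)" using g' by (auto simp: smooth1_vderiv)
  ultimately show ?case by blast
qed

lemma smooth_tensor:
  assumes "\<And>i. smooth1 (g i)"
  shows "smooth (tensor g)"
  unfolding smooth_def
proof
  fix "is"
  obtain g' where g': "\<forall>i. smooth1 (g' i)" "partials is (tensor g) = tensor g'"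
    using partials_tensor[of g "is", OF assms] by blast
  then show "partials is (tensor g) differentiable_on UNIV" using tensor_differentiable by metis
qed

text \<open>Each direction occurs in the list behind \<open>D\<close> as a single block, and that
  block differentiates its own factor only. The induction runs over arbitrary lists of distinct
  directions, so that one block can be split off at a time.\<close>

lemma D_tensor:
  fixes g :: "'n::{finite,linorder} \<Rightarrow> real \<Rightarrow> complex"
  assumes "\<And>i. smooth1 (g i)"
  shows "D \<alpha> (tensor g) = tensor (\<lambda>i. (vderiv ^^ (\<alpha> $ i)) (g i))"
proof -
  have rep: "partials (replicate m i) (tensor f) = tensor (f(i := (vderiv ^^ m) (f i)))"
    if "smooth1 (f i)" for m i and f :: "'n \<Rightarrow> real \<Rightarrow> complex"
  proof (induction m)
    case 0
    then show ?case by (simp add: partials_def)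
  next
    case (Suc m)
    let ?f = "f(i := (vderiv ^^ m) (f i))"
    have "partials (replicate (Suc m) i) (tensor f) = partial_deriv i (partials (replicate m i) (tensor f))"
      by (simp add: partials_def)
    also have "\<dots> = partial_deriv i (tensor ?f)" by (simp only: Suc)
    also have "\<dots> = tensor (?f(i := vderiv (?f i)))"
      by (rule partial_deriv_tensor) (simp add: smooth1_funpow_vderiv[OF that])
    finally show ?case by (simp only: fun_upd_upd fun_upd_same funpow.simps o_apply)
  qed
  have "distinct xs \<Longrightarrow> partials (concat (map (\<lambda>i. replicate (\<alpha> $ i) i) xs)) (tensor g)
      = tensor (\<lambda>i. if i \<in> set xs then (vderiv ^^ (\<alpha> $ i)) (g i) else g i)" for xs
  proof (induction xs)
    case Nil
    then show ?case by (simp add: partials_def)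
  next
    case (Cons i xs)
    let ?f = "\<lambda>i. if i \<in> set xs then (vderiv ^^ (\<alpha> $ i)) (g i) else g i"
    have "partials (concat (map (\<lambda>i. replicate (\<alpha> $ i) i) (i # xs))) (tensor g)
        = partials (replicate (\<alpha> $ i) i) (tensor ?f)"
      using Cons by (simp add: partials_append)
    also have "\<dots> = tensor (?f(i := (vderiv ^^ (\<alpha> $ i)) (?f i)))"
      by (rule rep) (use Cons assms in auto)
    also have "?f(i := (vderiv ^^ (\<alpha> $ i)) (?f i)) = (\<lambda>l. if l \<in> set (i # xs) then (vderiv ^^ (\<alpha> $ l)) (g l) else g l)"
      using Cons by auto
    finally show ?case .
  qed
  from this[of "sorted_list_of_set UNIV"] show ?thesis
    unfolding D_def by simp
qed

definition test :: "real ^ 'n::finite \<Rightarrow> real ^ 'n \<Rightarrow> ('n \<Rightarrow> real \<Rightarrow> complex) \<Rightarrow> bool" where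
  "test a b g \<longleftrightarrow> (\<forall>i. test1 (a $ i) (b $ i) (g i))"

lemma test_smooth1: "test a b g \<Longrightarrow> smooth1 (g i)"
  by (auto simp: test_def test1_def)

lemma tensor_eq_0_outside:
  assumes "test a b g" "x \<notin> cbox a b"
  shows "tensor g x = 0"
proof -
  obtain i where "x $ i \<notin> {a $ i..b $ i}" using assms(2) by (auto simp: mem_box_cart)
  then have "g i (x $ i) = 0" using assms(1) by (auto simp: test_def test1_def)
  then show ?thesis unfolding tensor_def by (intro prod_zero) auto
qed

lemma test_D: "test a b g \<Longrightarrow> test a b (\<lambda>i. (vderiv ^^ (\<alpha> $ i)) (g i))"
  by (auto simp: test_def test1_funpow_vderiv)

lemma supp_tensor_subset:
  assumes "test a b g"
  shows "supp (tensor g) \<subseteq> cbox a b"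
  unfolding supp_def by (rule closure_minimal) (use tensor_eq_0_outside[OF assms] in auto)

lemma compact_supp_tensor:
  assumes "test a b g"
  shows "compact (supp (tensor g))"
  using supp_tensor_subset[OF assms] unfolding supp_def
  by (meson bounded_cbox bounded_subset closed_closure compact_eq_bounded_closed)

lemma tensor_bounded:
  fixes g :: "'n::finite \<Rightarrow> real \<Rightarrow> complex"
  assumes "test a b g"
  shows "\<exists>B. \<forall>x. (1 + norm x) ^ N * norm (tensor g x) \<le> B"
proof -
  have "continuous_on (cbox a b) (\<lambda>x. (1 + norm x) ^ N * norm (tensor g x))"
    by (intro continuous_intros tensor_continuous test_smooth1[OF assms])
  from compact_imp_bounded[OF compact_continuous_image[OF this compact_cbox]]
  obtain B where B: "\<And>x. x \<in> cbox a b \<Longrightarrow> \<bar>(1 + norm x) ^ N * norm (tensor g x)\<bar> \<le> B" "B > 0"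
    unfolding bounded_pos by auto
  have "(1 + norm x) ^ N * norm (tensor g x) \<le> B" for x
  proof (cases "x \<in> cbox a b")
    case True
    then show ?thesis using B(1)[of x] by linarith
  next
    case False
    then show ?thesis using B(2) tensor_eq_0_outside[OF assms] by simp
  qed
  then show ?thesis by blast
qed

lemma schwartz_tensor:
  fixes g :: "'n::{finite,linorder} \<Rightarrow> real \<Rightarrow> complex"
  assumes "test a b g"
  shows "schwartz (tensor g)"
  unfolding schwartz_def
proof (intro conjI allI)
  show "smooth (tensor g)" by (intro smooth_tensor test_smooth1[OF assms])
  fix \<alpha> :: "(nat, 'n) vec" and N
  have t: "test a b (\<lambda>i. (vderiv ^^ (\<alpha> $ i)) (g i))" using test_D[OF assms] .
  obtain B where "\<forall>x. (1 + norm x) ^ N * norm (tensor (\<lambda>i. (vderiv ^^ (\<alpha> $ i)) (g i)) x) \<le> B"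
    using tensor_bounded[OF t] by blast
  then show "bounded (range (\<lambda>x. (1 + norm x) ^ N * norm (D \<alpha> (tensor g) x)))"
    unfolding D_tensor[of g, OF test_smooth1[OF assms]]
    by (intro boundedI[of _ B]) auto
qed

lemma tensor_integrable:
  fixes g :: "'n::finite \<Rightarrow> real \<Rightarrow> complex"
  assumes "test a b g"
  shows "integrable lborel (tensor g)"
proof -
  have "integrable lborel (\<lambda>x. indicator (cbox a b) x *\<^sub>R tensor g x)"
    by (rule borel_integrable_compact) (auto intro!: tensor_continuous test_smooth1[OF assms])
  moreover have "(\<lambda>x. indicat_real (cbox a b) x *\<^sub>R tensor g x) = tensor g"
    using tensor_eq_0_outside[OF assms] by (auto simp: indicator_def)
  ultimately show ?thesis by simp
qed

section \<open>Bump functions on boxes and the vanishing criterion\<close>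

definition bump :: "real \<Rightarrow> real ^ 'n \<Rightarrow> real ^ 'n \<Rightarrow> 'n \<Rightarrow> real \<Rightarrow> complex" where
  "bump c a b i t = flat_exp c 0 (t - a $ i) * flat_exp c 0 (b $ i - t)"

lemma test_bump:
  assumes "c > 0"
  shows "test a b (bump c a b)"
  unfolding test_def test1_def
proof (intro conjI allI impI)
  fix i
  show "smooth1 (bump c a b i)"
    unfolding bump_def[abs_def]
    using smooth1_mult[OF smooth1_affine[OF smooth1_flat_exp[OF assms], of 0 1 "- a $ i"]
       smooth1_affine[OF smooth1_flat_exp[OF assms], of 0 "-1" "b $ i"]]
    by (simp add: algebra_simps)
qed (auto simp: bump_def flat_exp_def)

text \<open>As the rate tends to 0, each one-sided factor exp(-c/t) tends to 1 for t > 0 and stays 0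
  for t \<le> 0, which is why the limit is the open box.\<close>

lemma bump_tendsto_indicator:
  "(\<lambda>m. tensor (bump (1 / real (Suc m)) a b) x) \<longlonglongrightarrow> indicator (box a b) x"
proof -
  have *: "(\<lambda>m. flat_exp (1 / real (Suc m)) 0 t) \<longlonglongrightarrow> (if t > 0 then 1 else 0)" for t
  proof (cases "t > 0")
    case True
    have "(\<lambda>m. 1 / real (Suc m)) \<longlonglongrightarrow> 0"
      by (rule LIMSEQ_Suc[OF lim_1_over_n])
    then have "(\<lambda>m. (1 / real (Suc m)) / t) \<longlonglongrightarrow> 0 / t"
      using True by (intro tendsto_divide tendsto_const) auto
    then have "(\<lambda>m. complex_of_real (exp (- ((1 / real (Suc m)) / t)))) \<longlonglongrightarrow> complex_of_real (exp (- (0 / t)))"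
      by (intro tendsto_of_real tendsto_exp tendsto_minus)
    then show ?thesis using True by (simp add: flat_exp_def)
  qed (simp add: flat_exp_def)
  have "(\<lambda>m. tensor (bump (1 / real (Suc m)) a b) x) \<longlonglongrightarrow>
      (\<Prod>i\<in>UNIV. (if x $ i - a $ i > 0 then 1 else 0) * (if b $ i - x $ i > 0 then 1 else 0))"
    unfolding tensor_def bump_def by (intro tendsto_prod tendsto_mult *)
  also have "(\<Prod>i\<in>UNIV. (if x $ i - a $ i > 0 then 1 else 0) * (if b $ i - x $ i > 0 then 1 else 0))
     = (indicator (box a b) x :: complex)"
  proof (cases "x \<in> box a b")
    case True
    then show ?thesis by (auto simp: mem_box_cart)
  next
    case False
    then obtain i where "\<not> (a $ i < x $ i \<and> x $ i < b $ i)" by (auto simp: mem_box_cart)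
    then show ?thesis using False
      by (subst prod_zero) (auto intro!: bexI[of _ i])
  qed
  finally show ?thesis .
qed

lemma norm_bump_le: "c > 0 \<Longrightarrow> norm (tensor (bump c a b) x) \<le> indicator (cbox a b) x"
proof -
  assume c: "c > 0"
  have *: "norm (flat_exp c 0 t) \<le> 1" for t using c by (auto simp: flat_exp_def)
  have "norm (tensor (bump c a b) x) \<le> 1"
    unfolding tensor_def prod_norm[symmetric] bump_def norm_mult
    by (intro prod_le_1) (auto intro!: mult_le_one *)
  then show ?thesis
    using tensor_eq_0_outside[OF test_bump[OF c]] by (cases "x \<in> cbox a b") auto
qed

text \<open>Bumps converge boundedly to indicators of boxes, so no mollification is needed.\<close>
lemma integral_bump_zero_imp_integral_box_zero:
  fixes w :: "'n::finite cfun"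
  assumes w: "locally_integrable w"
    and 0: "\<And>c. c > 0 \<Longrightarrow> (LINT x|lborel. w x * tensor (bump c a b) x) = 0"
  shows "(LINT x|lborel. indicat_real (box a b) x *\<^sub>R w x) = 0"
proof -
  note [measurable] = locally_integrable_measurable[OF w]
  have [measurable]: "tensor (bump c a b) \<in> borel_measurable borel" if "c > 0" for c
    by (rule tensor_measurable) (rule test_smooth1[OF test_bump[OF that]])
  have "(\<lambda>m. LINT x|lborel. w x * tensor (bump (1 / real (Suc m)) a b) x) \<longlonglongrightarrow> (LINT x|lborel. w x * indicator (box a b) x)"
  proof (rule integral_dominated_convergence[where w = "\<lambda>x. norm (indicat_real (cbox a b) x *\<^sub>R w x)"])
    show "integrable lborel (\<lambda>x. norm (indicat_real (cbox a b) x *\<^sub>R w x))"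
      using w compact_cbox unfolding locally_integrable_def set_integrable_def by (intro integrable_norm) blast
    show "AE x in lborel. (\<lambda>m. w x * tensor (bump (1 / real (Suc m)) a b) x) \<longlonglongrightarrow> w x * indicator (box a b) x"
      by (intro AE_I2 tendsto_mult tendsto_const bump_tendsto_indicator)
    show "AE x in lborel. norm (w x * tensor (bump (1 / real (Suc m)) a b) x) \<le> norm (indicat_real (cbox a b) x *\<^sub>R w x)" for m
      using norm_bump_le[of "1 / real (Suc m)" a b]
      by (auto simp: norm_mult mult.commute[of "norm (w _)"] intro!: mult_right_mono)
  qed (measurable; simp)+
  then have "(LINT x|lborel. w x * indicator (box a b) x) = 0"
    using 0 by (simp add: LIMSEQ_const_iff)
  moreover have "w x * indicator (box a b) x = indicat_real (box a b) x *\<^sub>R w x" for x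
    by (auto simp: indicator_def)
  ultimately show ?thesis by simp
qed

text \<open>Open boxes form an intersection-stable generator of the Borel sets, and the sets over
  which \<open>w\<close> integrates to 0 form a Dynkin system. Closure under complements requires
  the total integral to vanish, which follows by exhausting the space with cubes.\<close>

lemma integral_boxes_zero_imp_AE_zero:
  fixes w :: "'n::finite cfun"
  assumes w: "integrable lborel w"
    and 0: "\<And>a b. (LINT x|lborel. indicat_real (box a b) x *\<^sub>R w x) = 0"
  shows "AE x in lborel. w x = 0"
proof (rule sigma_finite_measure.density_zero[OF sigma_finite_lborel w])
  fix A :: "(real ^ 'n) set" assume A: "A \<in> sets lborel"
  let ?E = "range (\<lambda>(a, b). box a b :: (real ^ 'n) set)"
  have w_A: "integrable lborel (\<lambda>x. indicat_real A x *\<^sub>R w x)" if "A \<in> sets lborel" for A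
    using integrable_mult_indicator[OF that w] .
  have total: "(LINT x|lborel. w x) = 0"
  proof -
    have "(\<lambda>m. LINT x|lborel. indicat_real (box (\<chi> i. - real m) (\<chi> i. real m)) x *\<^sub>R w x) \<longlonglongrightarrow> (LINT x|lborel. w x)"
    proof (rule integral_dominated_convergence[where w = "\<lambda>x. norm (w x)"])
      show "AE x in lborel. (\<lambda>m. indicat_real (box (\<chi> i. - real m) (\<chi> i. real m)) x *\<^sub>R w x) \<longlonglongrightarrow> w x"
      proof (rule AE_I2)
        fix x :: "real ^ 'n"
        obtain m0 :: nat where m0: "norm x < m0" using reals_Archimedean2 by blast
        have "\<forall>\<^sub>F m in sequentially. indicat_real (box (\<chi> i. - real m) (\<chi> i. real m)) x *\<^sub>R w x = w x"
          using eventually_ge_at_top[of m0]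
        proof eventually_elim
          case (elim m)
          have "\<bar>x $ i\<bar> < m" for i
            using component_le_norm_cart[of x i] m0 elim by linarith
          then have "x \<in> box (\<chi> i. - real m) (\<chi> i. real m)"
            by (auto simp: mem_box_cart abs_less_iff minus_less_iff)
          then show ?case by simp
        qed
        then show "(\<lambda>m. indicat_real (box (\<chi> i. - real m) (\<chi> i. real m)) x *\<^sub>R w x) \<longlonglongrightarrow> w x"
          by (rule tendsto_eventually)
      qed
    qed (use w borel_measurable_integrable[OF w] in \<open>auto simp: indicator_def intro!: borel_measurable_integrable w_A\<close>)
    then show ?thesis using 0 by (simp add: LIMSEQ_const_iff)
  qed
  have "A \<in> sigma_sets UNIV ?E"
    using A by (simp add: borel_eq_box)
  have st: "Int_stable ?E"
    by (auto simp: Int_stable_def box_Int_box)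
  have sub: "?E \<subseteq> Pow UNIV" by simp
  have "(LINT x|lborel. indicat_real A x *\<^sub>R w x) = 0"
    using \<open>A \<in> sigma_sets UNIV ?E\<close>
  proof (induction A rule: sigma_sets_induct_disjoint[OF st sub, consumes 1, case_names basic empty compl union])
    case (basic A)
    then show ?case using 0 by auto
  next
    case empty
    show ?case by simp
  next
    case (compl A)
    then have A: "A \<in> sets lborel" by (simp add: borel_eq_box)
    have "(LINT x|lborel. indicat_real (UNIV - A) x *\<^sub>R w x) = (LINT x|lborel. w x - indicat_real A x *\<^sub>R w x)"
      by (intro Bochner_Integration.integral_cong) (auto simp: indicator_def)
    also have "\<dots> = (LINT x|lborel. w x) - (LINT x|lborel. indicat_real A x *\<^sub>R w x)"
      by (rule Bochner_Integration.integral_diff) (use w w_A[OF A] in auto)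
    finally show ?case using compl total by simp
  next
    case (union A)
    then have A: "\<And>i. A i \<in> sets lborel" by (auto simp: borel_eq_box)
    have "(LINT x:(\<Union>i. A i)|lborel. w x) = (\<Sum>i. LINT x:A i|lborel. w x)"
      by (rule lebesgue_integral_countable_add)
         (use A union w_A[of "\<Union>i. A i"] in \<open>auto simp: disjoint_family_on_def set_integrable_def\<close>)
    then show ?case using union by (simp add: set_lebesgue_integral_def)
  qed
  then show "set_lebesgue_integral lborel A w = 0" by (simp add: set_lebesgue_integral_def)
qed

text \<open>An open set is a countable union of closed boxes, and on each of them \<open>w\<close>
  is integrable, so the criterion for integrable functions applies box by box.\<close>

lemma integral_bump_zero_imp_AE_zero:
  fixes w :: "'n::finite cfun"
  assumes w: "locally_integrable w" and U: "open U"
    and 0: "\<And>a b c. c > 0 \<Longrightarrow> cbox a b \<subseteq> U \<Longrightarrow> (LINT x|lborel. w x * tensor (bump c a b) x) = 0"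
  shows "AE x in lborel. x \<in> U \<longrightarrow> w x = 0"
proof -
  have box: "AE x in lborel. x \<in> cbox p q \<longrightarrow> w x = 0" if pq: "cbox p q \<subseteq> U" for p q
  proof -
    have "AE x in lborel. indicat_real (cbox p q) x *\<^sub>R w x = 0"
    proof (rule integral_boxes_zero_imp_AE_zero)
      show "integrable lborel (\<lambda>x. indicat_real (cbox p q) x *\<^sub>R w x)"
        using w compact_cbox unfolding locally_integrable_def set_integrable_def by blast
      fix a b
      \<comment> \<open>These corners cut the test box down to \<open>cbox p q\<close>, so the
        closed box stays inside \<open>U\<close>. The open box obtained differs from the required
        intersection only by faces of \<open>cbox p q\<close>, which are null.\<close>
      let ?a = "(\<chi> i. max (a $ i) (p $ i)) :: real ^ 'n" and ?b = "(\<chi> i. min (b $ i) (q $ i)) :: real ^ 'n"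
      have "(LINT x|lborel. indicat_real (box ?a ?b) x *\<^sub>R w x) = 0"
        by (rule integral_bump_zero_imp_integral_box_zero[OF w 0])
           (use pq in \<open>auto simp: mem_box_cart subset_iff\<close>)
      moreover have "AE x in lborel. indicat_real (box ?a ?b) x *\<^sub>R w x =
          indicat_real (box a b) x *\<^sub>R indicat_real (cbox p q) x *\<^sub>R w x"
      proof -
        have "emeasure lborel (cbox p q - box p q) = 0"
          using emeasure_lborel_cbox_eq[of p q] emeasure_lborel_box_eq[of p q]
          by (subst emeasure_Diff) (auto simp: box_subset_cbox)
        then have *: "AE x in lborel. x \<notin> cbox p q - box p q"
          by (intro AE_not_in) (auto simp: null_sets_def)
        have bx: "box ?a ?b = box a b \<inter> box p q"
          by (auto simp: mem_box_cart)
        show ?thesis using *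
          by eventually_elim (use bx box_subset_cbox[of p q] in \<open>auto simp: indicator_def\<close>)
      qed
      ultimately show "(LINT x|lborel. indicat_real (box a b) x *\<^sub>R indicat_real (cbox p q) x *\<^sub>R w x) = 0"
        using locally_integrable_measurable[OF w]
        by (subst integral_cong_AE[of _ _ "\<lambda>x. indicat_real (box ?a ?b) x *\<^sub>R w x"]) (auto elim: eventually_mono)
    qed
    then show ?thesis by eventually_elim (auto simp: indicator_def)
  qed
  obtain \<D> where \<D>: "countable \<D>" "\<D> \<subseteq> Pow U" "\<And>X. X \<in> \<D> \<Longrightarrow> \<exists>a b. X = cbox a b" "\<Union>\<D> = U"
    using open_countable_Union_open_cbox[OF U] by metis
  have "AE x in lborel. \<forall>X\<in>\<D>. x \<in> X \<longrightarrow> w x = 0"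
    unfolding AE_ball_countable[OF \<D>(1)] using \<D>(2,3) box by blast
  then show ?thesis by eventually_elim (use \<D>(4) in auto)
qed


section \<open>Weak derivatives\<close>

text \<open>The uniform bound \<open>C\<close> on the L^1 norms of the slices, together with the
  finite length of the segment, makes the integrand integrable on the product space.\<close>

lemma fubini_segment:
  fixes f :: "real \<Rightarrow> 'a::euclidean_space \<Rightarrow> complex"
  assumes [measurable]: "(\<lambda>(t, x). f t x) \<in> borel_measurable (lborel \<Otimes>\<^sub>M lborel)"
    and int: "\<And>t. t \<in> {0..h} \<Longrightarrow> integrable lborel (f t)"
    and C: "\<And>t. t \<in> {0..h} \<Longrightarrow> (LINT x|lborel. norm (f t x)) \<le> C"
  shows "(LINT x|lborel. (LINT t:{0..h}|lborel. f t x)) = (LINT t:{0..h}|lborel. (LINT x|lborel. f t x))"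
    and "integrable lborel (\<lambda>x. LINT t:{0..h}|lborel. f t x)"
    and "AE x in lborel. set_integrable lborel {0..h} (\<lambda>t. f t x)"
proof -
  let ?g = "\<lambda>(t, x). indicat_real {0..h} t *\<^sub>R f t x"
  have [measurable]: "?g \<in> borel_measurable (lborel \<Otimes>\<^sub>M lborel)"
    by measurable
  have "integrable (lborel \<Otimes>\<^sub>M lborel) ?g"
  proof (rule lborel_pair.Fubini_integrable)
    show "AE t in lborel. integrable lborel (\<lambda>x. ?g (t, x))"
    proof (rule AE_I2)
      fix t show "integrable lborel (\<lambda>x. ?g (t, x))"
        using int by (cases "t \<in> {0..h}") auto
    qed
    show "integrable lborel (\<lambda>t. LINT x|lborel. norm (?g (t, x)))"
    proof (rule Bochner_Integration.integrable_bound)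
      show "integrable lborel (\<lambda>t. C * indicat_real {0..h} t)"
        by (intro integrable_mult_right integrable_real_indicator) (auto simp: emeasure_lborel_Icc_eq)
      show "AE t in lborel. norm (LINT x|lborel. norm (?g (t, x))) \<le> norm (C * indicat_real {0..h} t)"
      proof (rule AE_I2)
        fix t show "norm (LINT x|lborel. norm (?g (t, x))) \<le> norm (C * indicat_real {0..h} t)"
          using C[of t] by (cases "t \<in> {0..h}") (auto simp: Bochner_Integration.integral_nonneg)
      qed
    qed measurable
  qed measurable
  then have I: "integrable (lborel \<Otimes>\<^sub>M lborel) (\<lambda>(t, x). (\<lambda>t x. indicat_real {0..h} t *\<^sub>R f t x) t x)"
    by simp
  have "(LINT x|lborel. LINT t|lborel. indicat_real {0..h} t *\<^sub>R f t x)
      = (LINT t|lborel. LINT x|lborel. indicat_real {0..h} t *\<^sub>R f t x)"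
    by (rule lborel_pair.Fubini_integral[OF I])
  then show "(LINT x|lborel. (LINT t:{0..h}|lborel. f t x)) = (LINT t:{0..h}|lborel. (LINT x|lborel. f t x))"
    by (simp add: set_lebesgue_integral_def)
  show "integrable lborel (\<lambda>x. LINT t:{0..h}|lborel. f t x)"
    unfolding set_lebesgue_integral_def by (rule lborel_pair.integrable_snd[OF I])
  show "AE x in lborel. set_integrable lborel {0..h} (\<lambda>t. f t x)"
    unfolding set_integrable_def by (rule lborel_pair.AE_integrable_snd[OF I])
qed

lemma measurable_line_integral [measurable]:
  fixes f :: "'a::euclidean_space \<Rightarrow> complex"
  assumes [measurable]: "f \<in> borel_measurable borel"
  shows "(\<lambda>x. LINT t:{p..q}|lborel. f (x + t *\<^sub>R a)) \<in> borel_measurable borel"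
    "(\<lambda>x. LINT t:{p..q}|lborel. f (x - t *\<^sub>R a)) \<in> borel_measurable borel"
proof -
  have "(\<lambda>x. LINT t:{p..q}|lborel. f (x + t *\<^sub>R a)) \<in> borel_measurable lborel"
    "(\<lambda>x. LINT t:{p..q}|lborel. f (x - t *\<^sub>R a)) \<in> borel_measurable lborel"
    unfolding set_lebesgue_integral_def by measurable
  then show "(\<lambda>x. LINT t:{p..q}|lborel. f (x + t *\<^sub>R a)) \<in> borel_measurable borel"
    "(\<lambda>x. LINT t:{p..q}|lborel. f (x - t *\<^sub>R a)) \<in> borel_measurable borel" by simp_all
qed

text \<open>Averaging along \<open>a\<close> is adjoint to averaging along \<open>-a\<close>: for
  each fixed parameter this is translation invariance, and Fubini collects the parameters.\<close>

lemma integral_line_mult_swap: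
  fixes u \<Psi> :: "'n::finite cfun"
  assumes u: "integrable lborel u" and [measurable]: "\<Psi> \<in> borel_measurable borel"
    and B: "\<And>x. norm (\<Psi> x) \<le> B"
  shows "(LINT x|lborel. (LINT t:{0..h}|lborel. u (x + t *\<^sub>R a)) * \<Psi> x)
    = (LINT x|lborel. u x * (LINT t:{0..h}|lborel. \<Psi> (x - t *\<^sub>R a)))"
proof -
  have [measurable]: "u \<in> borel_measurable borel" using borel_measurable_integrable[OF u] by simp
  have B0: "B \<ge> 0" using B norm_ge_zero order_trans by blast
  have i1: "integrable lborel (\<lambda>x. u (x + t *\<^sub>R a) * \<Psi> x)" for t
    by (rule integrable_mult_bounded[OF integrable_translate[OF u]]) (use B in auto)
  have i2: "integrable lborel (\<lambda>x. u x * \<Psi> (x - t *\<^sub>R a))" for t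
    by (rule integrable_mult_bounded[OF u]) (use B in auto)
  have b: "(LINT x|lborel. norm (v x * \<Phi> x)) \<le> (LINT x|lborel. norm (v x) * B)"
    if "integrable lborel v" "\<And>x. norm (\<Phi> x) \<le> B" "integrable lborel (\<lambda>x. v x * \<Phi> x)" for v \<Phi> :: "'n cfun"
    by (rule integral_mono[OF integrable_norm[OF that(3)] integrable_mult_left[OF integrable_norm[OF that(1)]]])
       (use that(2) in \<open>auto simp: norm_mult intro!: mult_left_mono\<close>)
  have b1: "(LINT x|lborel. norm (u (x + t *\<^sub>R a) * \<Psi> x)) \<le> (LINT x|lborel. norm (u x)) * B" for t
    using b[OF integrable_translate[OF u] B i1, of t]
    by (simp add: integral_translate[of "\<lambda>x. norm (u x)"])
  have b2: "(LINT x|lborel. norm (u x * \<Psi> (x - t *\<^sub>R a))) \<le> (LINT x|lborel. norm (u x)) * B" for t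
    using b[OF u B i2, of t] by simp
  have "(LINT x|lborel. (LINT t:{0..h}|lborel. u (x + t *\<^sub>R a)) * \<Psi> x)
      = (LINT x|lborel. (LINT t:{0..h}|lborel. u (x + t *\<^sub>R a) * \<Psi> x))"
    by simp
  also have "\<dots> = (LINT t:{0..h}|lborel. (LINT x|lborel. u (x + t *\<^sub>R a) * \<Psi> x))"
    by (rule fubini_segment(1)[OF _ i1 b1]) measurable
  also have "\<dots> = (LINT t:{0..h}|lborel. (LINT x|lborel. u x * \<Psi> (x - t *\<^sub>R a)))"
    using integral_translate[of "\<lambda>x. u x * \<Psi> (x - t *\<^sub>R a)" "t *\<^sub>R a" for t] by simp
  also have "\<dots> = (LINT x|lborel. (LINT t:{0..h}|lborel. u x * \<Psi> (x - t *\<^sub>R a)))"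
    by (rule fubini_segment(1)[OF _ i2 b2, symmetric]) measurable
  finally show ?thesis by simp
qed

text \<open>Weak differentiability, expressed by the fundamental theorem of calculus on almost every line.
  In contrast to testing against smooth functions, this form survives multiplication by rough
  functions that are invariant in the direction of differentiation.\<close>
definition weak_deriv :: "'n::finite \<Rightarrow> 'n cfun \<Rightarrow> 'n cfun \<Rightarrow> bool" where
  "weak_deriv i u u' \<longleftrightarrow> locally_integrable u \<and> locally_integrable u' \<and>
     (\<forall>h>0. AE x in lborel. u (x + h *\<^sub>R axis i 1) - u x = (LINT t:{0..h}|lborel. u' (x + t *\<^sub>R axis i 1)))"

text \<open>Integration by parts in integrated form: the difference operator and the segment average
  are both moved onto \<Psi>. As \<Psi> is never differentiated, it can be a plane wave or the image
  of a test function under a multiplier.\<close>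

lemma integral_weak_deriv_adjoint:
  fixes w w' \<Psi> :: "'n::finite cfun"
  assumes weak_deriv: "weak_deriv i w w'" and w: "integrable lborel w" "integrable lborel w'"
    and [measurable]: "\<Psi> \<in> borel_measurable borel" and B: "\<And>x. norm (\<Psi> x) \<le> B" and h: "h > 0"
  shows "(LINT x|lborel. w x * (\<Psi> (x - h *\<^sub>R axis i 1) - \<Psi> x))
    = (LINT x|lborel. w' x * (LINT t:{0..h}|lborel. \<Psi> (x - t *\<^sub>R axis i 1)))"
proof -
  have [measurable]: "w \<in> borel_measurable borel" "w' \<in> borel_measurable borel"
    using w borel_measurable_integrable by force+
  have i1: "integrable lborel (\<lambda>x. w (x + h *\<^sub>R axis i 1) * \<Psi> x)"
    by (rule integrable_mult_bounded[OF integrable_translate[OF w(1)]]) (use B in auto)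
  have i2: "integrable lborel (\<lambda>x. w x * \<Psi> (x - h *\<^sub>R axis i 1))"
    by (rule integrable_mult_bounded[OF w(1)]) (use B in auto)
  have i3: "integrable lborel (\<lambda>x. w x * \<Psi> x)"
    by (rule integrable_mult_bounded[OF w(1)]) (use B in auto)
  have "(LINT x|lborel. w x * (\<Psi> (x - h *\<^sub>R axis i 1) - \<Psi> x))
      = (LINT x|lborel. w x * \<Psi> (x - h *\<^sub>R axis i 1)) - (LINT x|lborel. w x * \<Psi> x)"
    using i2 i3 by (simp add: right_diff_distrib)
  also have "(LINT x|lborel. w x * \<Psi> (x - h *\<^sub>R axis i 1)) = (LINT x|lborel. w (x + h *\<^sub>R axis i 1) * \<Psi> x)"
    using integral_translate[of "\<lambda>x. w x * \<Psi> (x - h *\<^sub>R axis i 1)" "h *\<^sub>R axis i 1"] by simp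
  also have "\<dots> - (LINT x|lborel. w x * \<Psi> x)
      = (LINT x|lborel. (w (x + h *\<^sub>R axis i 1) - w x) * \<Psi> x)"
    using i1 i3 by (simp add: left_diff_distrib)
  also have "\<dots> = (LINT x|lborel. (LINT t:{0..h}|lborel. w' (x + t *\<^sub>R axis i 1)) * \<Psi> x)"
    by (rule integral_cong_AE) (use weak_deriv h in \<open>auto simp: weak_deriv_def elim!: allE[of _ h]\<close>)
  also have "\<dots> = (LINT x|lborel. w' x * (LINT t:{0..h}|lborel. \<Psi> (x - t *\<^sub>R axis i 1)))"
    by (rule integral_line_mult_swap[OF w(2) _ B]) measurable
  finally show ?thesis .
qed

lemma integral_cis_segment:
  assumes "c \<noteq> 0" "h \<ge> 0"
  shows "(LINT t:{0..h}|lborel. cis (c * t)) = (cis (c * h) - 1) / (\<i> * c)"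
proof -
  have "((\<lambda>t. cis (c * t) / (\<i> * of_real c)) has_vector_derivative cis (c * t)) (at t within {0..h})" for t
    using assms(1)
    by (auto intro!: derivative_eq_intros simp: has_vector_derivative_def scaleR_conv_of_real field_simps)
  then have "(LINT t|lborel. indicat_real {0..h} t *\<^sub>R cis (c * t)) = cis (c * h) / (\<i> * c) - cis (c * 0) / (\<i> * c)"
    by (intro integral_FTC_atLeastAtMost assms(2)) (auto intro!: continuous_intros)
  then show ?thesis by (simp add: set_lebesgue_integral_def diff_divide_distrib)
qed

text \<open>Translation along the i-th axis multiplies the character by a scalar, so the adjoint
  identity becomes, for each h > 0, a scalar relation between the two integrals; a suitable h
  isolates the integral of \<open>w'\<close>.\<close>

lemma integral_cis_weak_deriv:
  fixes w w' :: "'n::finite cfun"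
  assumes weak_deriv: "weak_deriv i w w'" and w: "integrable lborel w" "integrable lborel w'"
  shows "(LINT x|lborel. cis (\<xi> \<bullet> x) * w' x) = - \<i> * (\<xi> $ i) * (LINT x|lborel. cis (\<xi> \<bullet> x) * w x)"
proof -
  define A where "A = (LINT x|lborel. w x * cis (\<xi> \<bullet> x))"
  define A' where "A' = (LINT x|lborel. w' x * cis (\<xi> \<bullet> x))"
  have shift: "cis (\<xi> \<bullet> (x - t *\<^sub>R axis i 1)) = cis (\<xi> \<bullet> x) * cis (- \<xi> $ i * t)" for x t
    by (simp add: inner_diff_right inner_axis cis_mult mult.commute)
  have *: "(cis (- \<xi> $ i * h) - 1) * A = A' * (LINT t:{0..h}|lborel. cis (- \<xi> $ i * t))" if "h > 0" for h
  proof -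
    have "(LINT x|lborel. w x * (cis (\<xi> \<bullet> (x - h *\<^sub>R axis i 1)) - cis (\<xi> \<bullet> x)))
      = (LINT x|lborel. w' x * (LINT t:{0..h}|lborel. cis (\<xi> \<bullet> (x - t *\<^sub>R axis i 1))))"
      by (rule integral_weak_deriv_adjoint[OF weak_deriv w _ _ that, of _ 1]) (auto intro!: borel_measurable_continuous_onI continuous_intros)
    also have "\<dots> = A' * (LINT t:{0..h}|lborel. cis (- \<xi> $ i * t))"
      by (simp add: shift A'_def mult.assoc[symmetric])
    also have "(LINT x|lborel. w x * (cis (\<xi> \<bullet> (x - h *\<^sub>R axis i 1)) - cis (\<xi> \<bullet> x)))
        = (LINT x|lborel. (w x * cis (\<xi> \<bullet> x)) * (cis (- \<xi> $ i * h) - 1))"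
      by (intro Bochner_Integration.integral_cong refl) (simp only: shift ring_distribs mult.assoc mult_1_right)
    also have "\<dots> = A * (cis (- \<xi> $ i * h) - 1)"
      by (simp only: integral_mult_left_zero A_def)
    finally show ?thesis by (simp add: mult.commute)
  qed
  have "A' = - \<i> * (\<xi> $ i) * A"
  proof (cases "\<xi> $ i = 0")
    case True
    then have "A' * (LINT t:{0..1::real}|lborel. 1) = 0" using *[of 1] by simp
    then show ?thesis using True by (simp add: set_lebesgue_integral_def)
  next
    case False
    \<comment> \<open>Half a period of the character in direction \<open>i\<close>: it changes sign
      over this length, so both scalar factors in the relation are nonzero. For a vanishing
      frequency component, h = 1 already gave A' = 0.\<close>
    let ?h = "pi / \<bar>\<xi> $ i\<bar>"
    have h: "?h > 0" using False by simp
    have c: "cis (- \<xi> $ i * ?h) = -1"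
      using False by (cases "\<xi> $ i > 0") (auto simp: cis.ctr complex_eq_iff)
    define z where "z = \<i> * complex_of_real (\<xi> $ i)"
    have z: "z \<noteq> 0" using False by (simp add: z_def)
    have "(-1 - 1) * A = A' * ((-1 - 1) / (\<i> * (- \<xi> $ i)))"
      using *[OF h] integral_cis_segment[of "- \<xi> $ i" ?h] False h unfolding c by simp
    then have eq: "A' * (2 / z) = - 2 * A" by (simp add: z_def)
    have "A' = (A' * (2 / z)) * (z / 2)" using z by simp
    also have "\<dots> = - z * A" unfolding eq by simp
    finally show ?thesis by (simp add: z_def)
  qed
  then show ?thesis by (simp add: A_def A'_def mult.commute)
qed

lemma weak_deriv_of_partial:
  fixes f f' :: "'n::finite cfun"
  assumes D: "\<And>x. ((\<lambda>t. f (x + t *\<^sub>R axis i 1)) has_vector_derivative f' x) (at 0)"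
    and f': "continuous_on UNIV f'" and "locally_integrable f" "locally_integrable f'"
  shows "weak_deriv i f f'"
  unfolding weak_deriv_def
proof (intro conjI allI impI AE_I2)
  fix h :: real and x :: "real ^ 'n"
  assume h: "h > 0"
  have "((\<lambda>t. f (x + t *\<^sub>R axis i 1)) has_vector_derivative f' (x + t *\<^sub>R axis i 1)) (at t within {0..h})" for t
  proof -
    have "(((\<lambda>s. f ((x + t *\<^sub>R axis i 1) + s *\<^sub>R axis i 1)) \<circ> (\<lambda>s. s - t)) has_vector_derivative
        1 *\<^sub>R f' (x + t *\<^sub>R axis i 1)) (at t)"
      by (rule vector_diff_chain_at) (use D in \<open>auto intro!: derivative_eq_intros\<close>)
    then show ?thesis
      by (auto simp: o_def algebra_simps intro: has_vector_derivative_at_within)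
  qed
  then have "(LINT t|lborel. indicat_real {0..h} t *\<^sub>R f' (x + t *\<^sub>R axis i 1)) = f (x + h *\<^sub>R axis i 1) - f (x + 0 *\<^sub>R axis i 1)"
    by (intro integral_FTC_atLeastAtMost continuous_on_compose2[OF f'])
       (use h in \<open>auto intro!: continuous_intros\<close>)
  then show "f (x + h *\<^sub>R axis i 1) - f x = (LINT t:{0..h}|lborel. f' (x + t *\<^sub>R axis i 1))"
    by (simp add: set_lebesgue_integral_def)
qed fact+

section \<open>Locally integrable functions along segments\<close>

lemma locally_integrable_translate:
  fixes u :: "'n::finite cfun"
  assumes "locally_integrable u"
  shows "locally_integrable (\<lambda>x. u (x + a))"
  unfolding locally_integrable_def set_integrable_def
proof (intro allI impI)
  fix K :: "(real ^ 'n) set" assume "compact K"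
  then have "compact ((+) a ` K)" by (rule compact_translation)
  then have "integrable lborel (\<lambda>x. indicat_real ((+) a ` K) x *\<^sub>R u x)"
    using assms by (auto simp: locally_integrable_def set_integrable_def)
  then have "integrable lborel (\<lambda>x. indicat_real ((+) a ` K) (x + a) *\<^sub>R u (x + a))"
    by (rule integrable_translate)
  moreover have "indicat_real ((+) a ` K) (x + a) = indicat_real K x" for x
    by (auto simp: indicator_def add.commute)
  ultimately show "integrable lborel (\<lambda>x. indicat_real K x *\<^sub>R u (x + a))" by simp
qed

text \<open>For base points in a compact set, only the values of \<open>u\<close> on the compact set
  swept out by the segments matter; cutting \<open>u\<close> off there reduces the claim to an
  integrable function.\<close>

lemma locally_integrable_line_integral:
  fixes u :: "'n::finite cfun"
  assumes u: "locally_integrable u"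
  shows "locally_integrable (\<lambda>x. LINT t:{0..h}|lborel. u (x + t *\<^sub>R a))"
  unfolding locally_integrable_def set_integrable_def
proof (intro allI impI)
  note [measurable] = locally_integrable_measurable[OF u]
  fix K :: "(real ^ 'n) set" assume K: "compact K"
  then have [measurable]: "K \<in> sets borel" by (auto dest: compact_imp_closed)
  define K' where "K' = (\<lambda>(t, x). x + t *\<^sub>R a) ` ({0..h} \<times> K)"
  have K': "compact K'"
    unfolding K'_def
    by (intro compact_continuous_image compact_Times K) (auto intro!: continuous_intros simp: case_prod_beta)
  then have [measurable]: "K' \<in> sets borel" by (auto dest: compact_imp_closed)
  define v where "v = (\<lambda>x. indicat_real K' x *\<^sub>R u x)"
  have v: "integrable lborel v"
    using u K' by (auto simp: locally_integrable_def set_integrable_def v_def)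
  have [measurable]: "v \<in> borel_measurable borel" unfolding v_def by measurable
  have "integrable lborel (\<lambda>x. LINT t:{0..h}|lborel. v (x + t *\<^sub>R a))"
  proof (rule fubini_segment(2)[where C = "LINT x|lborel. norm (v x)"])
    show "integrable lborel (\<lambda>x. v (x + t *\<^sub>R a))" for t by (rule integrable_translate[OF v])
    show "(LINT x|lborel. norm (v (x + t *\<^sub>R a))) \<le> (LINT x|lborel. norm (v x))" for t
      by (simp add: integral_translate[of "\<lambda>x. norm (v x)"])
  qed measurable
  then have "integrable lborel (\<lambda>x. indicat_real K x *\<^sub>R (LINT t:{0..h}|lborel. v (x + t *\<^sub>R a)))"
    by (intro integrable_mult_indicator) auto
  moreover have "(\<lambda>x. indicat_real K x *\<^sub>R (LINT t:{0..h}|lborel. v (x + t *\<^sub>R a)))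
      = (\<lambda>x. indicat_real K x *\<^sub>R (LINT t:{0..h}|lborel. u (x + t *\<^sub>R a)))"
  proof
    fix x
    show "indicat_real K x *\<^sub>R (LINT t:{0..h}|lborel. v (x + t *\<^sub>R a))
        = indicat_real K x *\<^sub>R (LINT t:{0..h}|lborel. u (x + t *\<^sub>R a))"
    proof (cases "x \<in> K")
      case True
      have "(LINT t:{0..h}|lborel. v (x + t *\<^sub>R a)) = (LINT t:{0..h}|lborel. u (x + t *\<^sub>R a))"
      proof (rule set_lebesgue_integral_cong)
        have "x + t *\<^sub>R a \<in> K'" if "t \<in> {0..h}" for t
          unfolding K'_def by (rule image_eqI[of _ _ "(t, x)"]) (use that True in auto)
        then show "\<forall>t. t \<in> {0..h} \<longrightarrow> v (x + t *\<^sub>R a) = u (x + t *\<^sub>R a)"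
          by (simp add: v_def)
      qed simp
      then show ?thesis by simp
    qed simp
  qed
  ultimately show "integrable lborel (\<lambda>x. indicat_real K x *\<^sub>R (LINT t:{0..h}|lborel. u (x + t *\<^sub>R a)))"
    by simp
qed

lemma integrable_mult_tensor:
  fixes u :: "'n::finite cfun"
  assumes u: "locally_integrable u" and g: "test a b g"
  shows "integrable lborel (\<lambda>x. u x * tensor g x)"
proof -
  have [measurable]: "tensor g \<in> borel_measurable borel"
    by (rule tensor_measurable) (rule test_smooth1[OF g])
  obtain B where "\<And>x. norm (tensor g x) \<le> B" using tensor_bounded[OF g, of 0] by auto
  moreover have "integrable lborel (\<lambda>x. indicat_real (cbox a b) x *\<^sub>R u x)"
    using u compact_cbox unfolding locally_integrable_def set_integrable_def by blast
  ultimately have "integrable lborel (\<lambda>x. (indicat_real (cbox a b) x *\<^sub>R u x) * tensor g x)"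
    by (intro integrable_mult_bounded) auto
  moreover have "(indicat_real (cbox a b) x *\<^sub>R u x) * tensor g x = u x * tensor g x" for x
    using tensor_eq_0_outside[OF g] by (auto simp: indicator_def)
  ultimately show ?thesis by simp
qed

lemma integral_line_mult_tensor_swap:
  fixes u :: "'n::finite cfun"
  assumes u: "locally_integrable u" and g: "test a b g"
  shows "(LINT x|lborel. (LINT t:{0..h}|lborel. u (x + t *\<^sub>R axis i 1)) * tensor g x)
    = (LINT x|lborel. u x * (LINT t:{0..h}|lborel. tensor g (x - t *\<^sub>R axis i 1)))"
proof -
  have [measurable]: "tensor g \<in> borel_measurable borel"
    by (rule tensor_measurable) (rule test_smooth1[OF g])
  obtain B where B: "\<And>x. norm (tensor g x) \<le> B" using tensor_bounded[OF g, of 0] by auto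
  \<comment> \<open>The support box enlarged by \<open>h\<close> in direction \<open>i\<close>
    contains all its translates by t \<in> [0, h], so \<open>u\<close> can be cut off to it without
    changing either side.\<close>
  define K where "K = cbox a (b + h *\<^sub>R axis i 1)"
  define v where "v = (\<lambda>x. indicat_real K x *\<^sub>R u x)"
  have v: "integrable lborel v"
    using u compact_cbox unfolding locally_integrable_def set_integrable_def v_def K_def by blast
  have K: "x \<in> K" if "t \<in> {0..h}" "x - t *\<^sub>R axis i 1 \<in> cbox a b" for x t
    unfolding K_def mem_box_cart
  proof
    fix l
    have "a $ l \<le> x $ l - t * axis i 1 $ l" "x $ l - t * axis i 1 $ l \<le> b $ l"
      using that(2) by (auto simp: mem_box_cart)
    then show "a $ l \<le> x $ l \<and> x $ l \<le> (b + h *\<^sub>R axis i 1) $ l"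
      using that(1) by (cases "l = i") (auto simp: axis_def)
  qed
  have "(LINT x|lborel. (LINT t:{0..h}|lborel. v (x + t *\<^sub>R axis i 1)) * tensor g x)
      = (LINT x|lborel. v x * (LINT t:{0..h}|lborel. tensor g (x - t *\<^sub>R axis i 1)))"
    by (rule integral_line_mult_swap[OF v _ B]) measurable
  moreover have "(LINT t:{0..h}|lborel. v (x + t *\<^sub>R axis i 1)) * tensor g x
      = (LINT t:{0..h}|lborel. u (x + t *\<^sub>R axis i 1)) * tensor g x" for x
  proof (cases "x \<in> cbox a b")
    case True
    have "(LINT t:{0..h}|lborel. v (x + t *\<^sub>R axis i 1)) = (LINT t:{0..h}|lborel. u (x + t *\<^sub>R axis i 1))"
      by (rule set_lebesgue_integral_cong) (use True K[of _ "x + _ *\<^sub>R axis i 1"] in \<open>auto simp: v_def\<close>)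
    then show ?thesis by simp
  qed (simp add: tensor_eq_0_outside[OF g])
  moreover have "v x * (LINT t:{0..h}|lborel. tensor g (x - t *\<^sub>R axis i 1))
      = u x * (LINT t:{0..h}|lborel. tensor g (x - t *\<^sub>R axis i 1))" for x
  proof (cases "x \<in> K")
    case False
    have "(LINT t:{0..h}|lborel. tensor g (x - t *\<^sub>R axis i 1)) = (LINT t:{0..h}|lborel. 0)"
    proof (rule set_lebesgue_integral_cong)
      show "\<forall>t. t \<in> {0..h} \<longrightarrow> tensor g (x - t *\<^sub>R axis i 1) = 0"
        using False K[of _ x] tensor_eq_0_outside[OF g, of "x - _ *\<^sub>R axis i 1"] by metis
    qed simp
    then show ?thesis by simp
  qed (simp add: v_def)
  ultimately show ?thesis by simp
qed

text \<open>Moving shift and average back from the bump to \<open>u\<close> and \<open>u'\<close>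
  shows that the defect in the fundamental theorem of calculus integrates to 0 against every bump,
  hence vanishes almost everywhere.\<close>

lemma weak_derivI_bump:
  fixes u u' :: "'n::finite cfun"
  assumes u: "locally_integrable u" and u': "locally_integrable u'"
    and eq: "\<And>a b c h. c > 0 \<Longrightarrow> h > 0 \<Longrightarrow>
      (LINT x|lborel. u x * (tensor (bump c a b) (x - h *\<^sub>R axis i 1) - tensor (bump c a b) x))
      = (LINT x|lborel. u' x * (LINT t:{0..h}|lborel. tensor (bump c a b) (x - t *\<^sub>R axis i 1)))"
  shows "weak_deriv i u u'"
  unfolding weak_deriv_def
proof (intro conjI allI impI u u')
  fix h :: real assume h: "h > 0"
  let ?e = "axis i 1 :: real ^ 'n"
  let ?A = "\<lambda>x. LINT t:{0..h}|lborel. u' (x + t *\<^sub>R ?e)"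
  have A: "locally_integrable ?A" by (rule locally_integrable_line_integral[OF u'])
  have uh: "locally_integrable (\<lambda>x. u (x + h *\<^sub>R ?e))" by (rule locally_integrable_translate[OF u])
  have m1: "locally_integrable (\<lambda>x. - 1 * v x)" if "locally_integrable v" for v :: "'n cfun"
    by (rule locally_integrable_mult_bounded[OF that, of "\<lambda>_. -1" 1]) auto
  have w: "locally_integrable (\<lambda>x. u (x + h *\<^sub>R ?e) + (- 1 * u x + - 1 * ?A x))"
    by (intro locally_integrable_add uh m1 u A)
  have "AE x in lborel. x \<in> UNIV \<longrightarrow> u (x + h *\<^sub>R ?e) + (- 1 * u x + - 1 * ?A x) = 0"
  proof (rule integral_bump_zero_imp_AE_zero[OF w open_UNIV])
    fix a b :: "real ^ 'n" and c :: real assume c: "c > 0"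
    let ?b = "tensor (bump c a b)"
    note t = test_bump[OF c, of a b]
    have shift: "u (x + h *\<^sub>R ?e) * ?b x = (\<lambda>y. u y * ?b (y - h *\<^sub>R ?e)) (x + h *\<^sub>R ?e)" for x by simp
    have i1: "integrable lborel (\<lambda>x. u x * ?b (x - h *\<^sub>R ?e))"
      using integrable_translate[OF integrable_mult_tensor[OF uh t], of "- h *\<^sub>R ?e"] by simp
    have "(LINT x|lborel. (u (x + h *\<^sub>R ?e) + (- 1 * u x + - 1 * ?A x)) * ?b x)
      = (LINT x|lborel. u (x + h *\<^sub>R ?e) * ?b x - u x * ?b x - ?A x * ?b x)"
      by (intro Bochner_Integration.integral_cong) (auto simp: algebra_simps)
    also have "\<dots> = (LINT x|lborel. u (x + h *\<^sub>R ?e) * ?b x) - (LINT x|lborel. u x * ?b x) - (LINT x|lborel. ?A x * ?b x)"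
      using integrable_mult_tensor[OF uh t] integrable_mult_tensor[OF u t] integrable_mult_tensor[OF A t]
      by (subst Bochner_Integration.integral_diff | auto)+
    also have "(LINT x|lborel. u (x + h *\<^sub>R ?e) * ?b x) = (LINT x|lborel. u x * ?b (x - h *\<^sub>R ?e))"
      using integral_translate[of "\<lambda>y. u y * ?b (y - h *\<^sub>R ?e)" "h *\<^sub>R ?e"] by simp
    also have "\<dots> - (LINT x|lborel. u x * ?b x) = (LINT x|lborel. u x * (?b (x - h *\<^sub>R ?e) - ?b x))"
      using i1 integrable_mult_tensor[OF u t] by (simp add: right_diff_distrib)
    also have "\<dots> = (LINT x|lborel. u' x * (LINT t:{0..h}|lborel. ?b (x - t *\<^sub>R ?e)))"
      by (rule eq[OF c h])
    also have "\<dots> = (LINT x|lborel. ?A x * ?b x)"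
      by (rule integral_line_mult_tensor_swap[OF u' t, symmetric])
    finally show "(LINT x|lborel. (u (x + h *\<^sub>R ?e) + (- 1 * u x + - 1 * ?A x)) * ?b x) = 0" by simp
  qed
  then show "AE x in lborel. u (x + h *\<^sub>R ?e) - u x = ?A x"
    by eventually_elim (simp add: algebra_simps add_eq_0_iff)
qed

lemma AE_line_set_integrable:
  fixes u :: "'n::finite cfun"
  assumes u: "locally_integrable u"
  shows "AE x in lborel. set_integrable lborel {0..h} (\<lambda>t. u (x + t *\<^sub>R a))"
proof -
  note [measurable] = locally_integrable_measurable[OF u]
  have "AE x in lborel. x \<in> cball 0 (real m) \<longrightarrow> set_integrable lborel {0..h} (\<lambda>t. u (x + t *\<^sub>R a))" for m
  proof -
    let ?K = "cball 0 (real m) :: (real ^ 'n) set"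
    define K' where "K' = (\<lambda>(t, x). x + t *\<^sub>R a) ` ({0..h} \<times> ?K)"
    have K': "compact K'"
      unfolding K'_def
      by (intro compact_continuous_image compact_Times) (auto intro!: continuous_intros simp: case_prod_beta)
    then have [measurable]: "K' \<in> sets borel" by (auto dest: compact_imp_closed)
    define v where "v = (\<lambda>x. indicat_real K' x *\<^sub>R u x)"
    have v: "integrable lborel v"
      using u K' by (auto simp: locally_integrable_def set_integrable_def v_def)
    have [measurable]: "v \<in> borel_measurable borel" unfolding v_def by measurable
    have "AE x in lborel. set_integrable lborel {0..h} (\<lambda>t. v (x + t *\<^sub>R a))"
    proof (rule fubini_segment(3)[where C = "LINT x|lborel. norm (v x)"])
      show "integrable lborel (\<lambda>x. v (x + t *\<^sub>R a))" for t by (rule integrable_translate[OF v])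
      show "(LINT x|lborel. norm (v (x + t *\<^sub>R a))) \<le> (LINT x|lborel. norm (v x))" for t
        by (simp add: integral_translate[of "\<lambda>x. norm (v x)"])
    qed measurable
    then show ?thesis
    proof eventually_elim
      case (elim x)
      show ?case
      proof
        assume x: "x \<in> ?K"
        have "x + t *\<^sub>R a \<in> K'" if "t \<in> {0..h}" for t
          unfolding K'_def by (rule image_eqI[of _ _ "(t, x)"]) (use that x in auto)
        then have "(\<lambda>t. indicat_real {0..h} t *\<^sub>R v (x + t *\<^sub>R a)) = (\<lambda>t. indicat_real {0..h} t *\<^sub>R u (x + t *\<^sub>R a))"
          by (auto simp: v_def fun_eq_iff indicator_def)
        with elim show "set_integrable lborel {0..h} (\<lambda>t. u (x + t *\<^sub>R a))"
          by (simp add: set_integrable_def)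
      qed
    qed
  qed
  then have "AE x in lborel. \<forall>m::nat. x \<in> cball 0 (real m) \<longrightarrow> set_integrable lborel {0..h} (\<lambda>t. u (x + t *\<^sub>R a))"
    unfolding AE_all_countable by blast
  then show ?thesis
    by eventually_elim (meson mem_cball_0 real_arch_simple)
qed

text \<open>Using \<open>min t 0\<close> and \<open>max t 0\<close> treats both orientations of the segment at once.\<close>
lemma weak_deriv_AE_line:
  fixes u u' :: "'n::finite cfun"
  assumes weak_deriv: "weak_deriv i u u'"
  shows "AE x in lborel. AE t in lborel.
    u (x + max t 0 *\<^sub>R axis i 1) - u (x + min t 0 *\<^sub>R axis i 1)
    = (LINT s:{0..\<bar>t\<bar>}|lborel. u' (x + min t 0 *\<^sub>R axis i 1 + s *\<^sub>R axis i 1))"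
proof -
  have [measurable]: "u \<in> borel_measurable borel" "u' \<in> borel_measurable borel"
    using weak_deriv by (auto simp: weak_deriv_def intro: locally_integrable_measurable)
  let ?e = "axis i 1 :: real ^ 'n"
  let ?P = "\<lambda>x t. u (x + max t 0 *\<^sub>R ?e) - u (x + min t 0 *\<^sub>R ?e)
    = (LINT s|lborel. (if 0 \<le> s \<and> s \<le> \<bar>t\<bar> then 1 else 0) *\<^sub>R u' (x + min t 0 *\<^sub>R ?e + s *\<^sub>R ?e))"
  have eq: "(LINT s:{0..r}|lborel. u' (y + s *\<^sub>R ?e)) = (LINT s|lborel. (if 0 \<le> s \<and> s \<le> r then 1 else 0) *\<^sub>R u' (y + s *\<^sub>R ?e))" for y r
    unfolding set_lebesgue_integral_def by (intro Bochner_Integration.integral_cong) (auto simp: indicator_def)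
  have "AE t in lborel. AE x in lborel. ?P x t"
  proof -
    \<comment> \<open>The definition of \<open>weak_deriv\<close> covers positive lengths only; t =
      0 is discarded as a null set.\<close>
    have "AE t in lborel. t \<noteq> (0::real)" by (rule AE_lborel_singleton)
    then show ?thesis
    proof eventually_elim
      case (elim t)
      have "AE x in lborel. u (x + \<bar>t\<bar> *\<^sub>R ?e) - u x = (LINT s:{0..\<bar>t\<bar>}|lborel. u' (x + s *\<^sub>R ?e))"
        using weak_deriv elim by (simp add: weak_deriv_def)
      from AE_translate[OF this, of "min t 0 *\<^sub>R ?e"]
      show ?case
      proof eventually_elim
        case (elim x)
        have "x + min t 0 *\<^sub>R ?e + \<bar>t\<bar> *\<^sub>R ?e = x + max t 0 *\<^sub>R ?e"
          by (simp add: min_def max_def abs_if algebra_simps)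
        with elim show ?case unfolding eq by simp
      qed
    qed
  qed
  \<comment> \<open>Joint measurability of the identity is what permits exchanging the two
    almost-everywhere quantifiers.\<close>
  moreover have "{z \<in> space (lborel \<Otimes>\<^sub>M lborel). ?P (fst z) (snd z)} \<in> sets (lborel \<Otimes>\<^sub>M lborel)"
  proof -
    define F where "F = (\<lambda>z. LINT s|lborel. (if 0 \<le> s \<and> s \<le> \<bar>snd z\<bar> then 1 else 0) *\<^sub>R u' (fst z + min (snd z) 0 *\<^sub>R ?e + s *\<^sub>R ?e))"
    have F: "F \<in> borel_measurable (lborel \<Otimes>\<^sub>M lborel)"
      unfolding F_def by measurable
    have G: "(\<lambda>z. u (fst z + max (snd z) 0 *\<^sub>R ?e) - u (fst z + min (snd z) 0 *\<^sub>R ?e)) \<in> borel_measurable (lborel \<Otimes>\<^sub>M lborel)"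
      by measurable
    have N: "(\<lambda>z. norm (u (fst z + max (snd z) 0 *\<^sub>R ?e) - u (fst z + min (snd z) 0 *\<^sub>R ?e) - F z)) \<in> borel_measurable (lborel \<Otimes>\<^sub>M lborel)"
      using F G by measurable
    have "Measurable.pred (lborel \<Otimes>\<^sub>M lborel) (\<lambda>z. norm (u (fst z + max (snd z) 0 *\<^sub>R ?e) - u (fst z + min (snd z) 0 *\<^sub>R ?e) - F z) = 0)"
      unfolding pred_def by (rule borel_measurable_eq[OF N borel_measurable_const])
    then have "Measurable.pred (lborel \<Otimes>\<^sub>M lborel) (\<lambda>z. u (fst z + max (snd z) 0 *\<^sub>R ?e) - u (fst z + min (snd z) 0 *\<^sub>R ?e) = F z)"
      by (simp only: norm_eq_zero right_minus_eq)
    then show ?thesis unfolding pred_def F_def .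
  qed
  ultimately have "AE x in lborel. AE t in lborel. ?P x t"
    by (simp only: lborel_pair.AE_commute)
  then show ?thesis unfolding eq .
qed

text \<open>Integration by parts for absolutely continuous functions whose densities are merely
  integrable. The product of the two total integrals is an integral over a square, which is split
  along the diagonal into two triangles.\<close>

lemma integral_parts_segment:
  fixes a b :: "real \<Rightarrow> complex"
  assumes a: "set_integrable lborel {0..h} a" and b: "set_integrable lborel {0..h} b"
  defines "A \<equiv> \<lambda>t. (LINT s:{0..t}|lborel. a s)" and "B \<equiv> \<lambda>t. (LINT s:{0..t}|lborel. b s)"
  shows "(LINT t:{0..h}|lborel. a t * (q + B t) + (p + A t) * b t) = (p + A h) * (q + B h) - p * q"
proof -
  define a0 where "a0 = (\<lambda>t. indicat_real {0..h} t *\<^sub>R a t)"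
  define b0 where "b0 = (\<lambda>t. indicat_real {0..h} t *\<^sub>R b t)"
  have i: "integrable lborel a0" "integrable lborel b0"
    using a b by (auto simp: set_integrable_def a0_def b0_def)
  then have [measurable]: "a0 \<in> borel_measurable borel" "b0 \<in> borel_measurable borel"
    using borel_measurable_integrable by force+
  have prod: "integrable (lborel \<Otimes>\<^sub>M lborel) (\<lambda>(s, t). f s * g t)"
    if f: "integrable lborel f" and g: "integrable lborel g" for f g :: "real \<Rightarrow> complex"
  proof (rule lborel_pair.Fubini_integrable)
    have [measurable]: "f \<in> borel_measurable borel" "g \<in> borel_measurable borel"
      using f g borel_measurable_integrable by force+
    show "(\<lambda>(s, t). f s * g t) \<in> borel_measurable (lborel \<Otimes>\<^sub>M lborel)" by measurable
    show "integrable lborel (\<lambda>s. LINT t|lborel. norm (case (s, t) of (s, t) \<Rightarrow> f s * g t))"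
      using integrable_norm[OF f] by (simp add: norm_mult)
    show "AE s in lborel. integrable lborel (\<lambda>t. case (s, t) of (s, t) \<Rightarrow> f s * g t)"
      using g by simp
  qed
  have tri: "integrable (lborel \<Otimes>\<^sub>M lborel) (\<lambda>(s, t). (if s < t then 1 else 0) * (a0 s * b0 t))"
    by (rule Bochner_Integration.integrable_bound[OF prod[OF i]]) auto
  \<comment> \<open>One inequality is strict and the other is not, so that the two triangles
    partition the square exactly; the diagonal point is null in each inner integral.\<close>
  have A: "A t = (LINT s|lborel. (if s < t then 1 else 0) * a0 s)"
    and B: "B t = (LINT s|lborel. (if s \<le> t then 1 else 0) * b0 s)" if "t \<in> {0..h}" for t
  proof -
    have ne: "AE s in lborel. s \<noteq> t" by (rule AE_lborel_singleton)
    have "A t = (LINT s|lborel. (if s \<le> t then 1 else 0) * a0 s)"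
      unfolding A_def set_lebesgue_integral_def
      by (intro Bochner_Integration.integral_cong) (use that in \<open>auto simp: a0_def indicator_def\<close>)
    also have "\<dots> = (LINT s|lborel. (if s < t then 1 else 0) * a0 s)"
      by (rule integral_cong_AE, measurable) (use ne in eventually_elim, auto)
    finally show "A t = (LINT s|lborel. (if s < t then 1 else 0) * a0 s)" .
    show "B t = (LINT s|lborel. (if s \<le> t then 1 else 0) * b0 s)"
      unfolding B_def set_lebesgue_integral_def
      by (intro Bochner_Integration.integral_cong) (use that in \<open>auto simp: b0_def indicator_def\<close>)
  qed
  have swap: "(LINT s|lborel. a0 s * (LINT t|lborel. (if s < t then 1 else 0) * b0 t))
     = (LINT t|lborel. (LINT s|lborel. (if s < t then 1 else 0) * a0 s) * b0 t)"
  proof -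
    have "(LINT s|lborel. a0 s * (LINT t|lborel. (if s < t then 1 else 0) * b0 t))
      = (LINT s|lborel. LINT t|lborel. (if s < t then 1 else 0) * (a0 s * b0 t))"
      by (simp only: integral_mult_right_zero[symmetric]) (simp only: mult_ac)
    also have "\<dots> = (LINT t|lborel. LINT s|lborel. (if s < t then 1 else 0) * (a0 s * b0 t))"
      by (rule lborel_pair.Fubini_integral[symmetric]) (use tri in simp)
    also have "\<dots> = (LINT t|lborel. (LINT s|lborel. (if s < t then 1 else 0) * a0 s) * b0 t)"
      by (simp only: integral_mult_left_zero[symmetric] mult.assoc)
    finally show ?thesis .
  qed
  have sub: "integrable lborel (\<lambda>t. (if P t then 1 else 0) * f t)"
    if "integrable lborel f" "Measurable.pred borel P" for f :: "real \<Rightarrow> complex" and P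
    by (rule Bochner_Integration.integrable_bound[OF that(1)])
       (use that borel_measurable_integrable[OF that(1)] in auto)
  have i1: "integrable lborel (\<lambda>s. a0 s * (LINT t|lborel. (if s < t then 1 else 0) * b0 t))"
    using lborel_pair.integrable_fst[of "\<lambda>s t. (if s < t then 1 else 0) * (a0 s * b0 t)"] tri
    by (simp add: integral_mult_right_zero[symmetric] mult_ac del: integral_mult_right_zero)
  have i2: "integrable lborel (\<lambda>t. (LINT s|lborel. (if s < t then 1 else 0) * a0 s) * b0 t)"
    using lborel_pair.integrable_snd[of "\<lambda>s t. (if s < t then 1 else 0) * (a0 s * b0 t)"] tri
    by (simp add: integral_mult_left_zero[symmetric] mult.assoc del: integral_mult_left_zero)
  have split: "(LINT t|lborel. b0 t) = (LINT t|lborel. (if t \<le> s then 1 else 0) * b0 t) + (LINT t|lborel. (if s < t then 1 else 0) * b0 t)" for s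
    by (subst Bochner_Integration.integral_add[symmetric])
       (auto intro!: Bochner_Integration.integral_cong sub i)
  have i3: "integrable lborel (\<lambda>s. a0 s * (LINT t|lborel. (if t \<le> s then 1 else 0) * b0 t))"
  proof -
    have "integrable lborel (\<lambda>s. a0 s * (LINT t|lborel. b0 t) - a0 s * (LINT t|lborel. (if s < t then 1 else 0) * b0 t))"
      using i i1 by (intro Bochner_Integration.integrable_diff) auto
    moreover have "a0 s * (LINT t|lborel. b0 t) - a0 s * (LINT t|lborel. (if s < t then 1 else 0) * b0 t)
        = a0 s * (LINT t|lborel. (if t \<le> s then 1 else 0) * b0 t)" for s
      by (simp only: split[of s] distrib_left add_diff_cancel_right')
    ultimately show ?thesis by simp
  qed
  have main: "(LINT s|lborel. a0 s) * (LINT t|lborel. b0 t)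
     = (LINT s|lborel. a0 s * (LINT t|lborel. (if t \<le> s then 1 else 0) * b0 t))
       + (LINT t|lborel. (LINT s|lborel. (if s < t then 1 else 0) * a0 s) * b0 t)"
  proof -
    have "(LINT s|lborel. a0 s) * (LINT t|lborel. b0 t) = (LINT s|lborel. a0 s * (LINT t|lborel. b0 t))"
      by simp
    also have "\<dots> = (LINT s|lborel. a0 s * (LINT t|lborel. (if t \<le> s then 1 else 0) * b0 t)
        + a0 s * (LINT t|lborel. (if s < t then 1 else 0) * b0 t))"
    proof (rule Bochner_Integration.integral_cong[OF refl])
      fix s
      show "a0 s * (LINT t|lborel. b0 t) = a0 s * (LINT t|lborel. (if t \<le> s then 1 else 0) * b0 t)
        + a0 s * (LINT t|lborel. (if s < t then 1 else 0) * b0 t)"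
        unfolding split[of s] by (rule distrib_left)
    qed
    also have "\<dots> = (LINT s|lborel. a0 s * (LINT t|lborel. (if t \<le> s then 1 else 0) * b0 t))
       + (LINT s|lborel. a0 s * (LINT t|lborel. (if s < t then 1 else 0) * b0 t))"
      by (rule Bochner_Integration.integral_add[OF i3 i1])
    finally show ?thesis by (simp only: swap)
  qed
  have ah: "A h = (LINT s|lborel. a0 s)" "B h = (LINT s|lborel. b0 s)"
    by (auto simp: A_def B_def a0_def b0_def set_lebesgue_integral_def)
  have "(LINT t:{0..h}|lborel. a t * (q + B t) + (p + A t) * b t)
     = (LINT t|lborel. (a0 t * q + p * b0 t) + (a0 t * (LINT s|lborel. (if s \<le> t then 1 else 0) * b0 s)
         + (LINT s|lborel. (if s < t then 1 else 0) * a0 s) * b0 t))"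
    unfolding set_lebesgue_integral_def
  proof (rule Bochner_Integration.integral_cong[OF refl])
    fix t
    show "indicat_real {0..h} t *\<^sub>R (a t * (q + B t) + (p + A t) * b t)
      = (a0 t * q + p * b0 t) + (a0 t * (LINT s|lborel. (if s \<le> t then 1 else 0) * b0 s)
         + (LINT s|lborel. (if s < t then 1 else 0) * a0 s) * b0 t)"
    proof (cases "t \<in> {0..h}")
      case True
      then have "a0 t = a t" "b0 t = b t" by (auto simp: a0_def b0_def)
      with True A[OF True] B[OF True] show ?thesis by (simp add: algebra_simps)
    qed (simp add: a0_def b0_def)
  qed
  also have "\<dots> = ((LINT t|lborel. a0 t) * q + p * (LINT t|lborel. b0 t)) + (LINT s|lborel. a0 s) * (LINT t|lborel. b0 t)"
    unfolding main using i i2 i3 by simp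
  finally show ?thesis by (simp add: ah algebra_simps)
qed

text \<open>On almost every line both factors agree, for almost every parameter, with indefinite
  integrals started at the base point. The claim is then integration by parts on a single
  segment.\<close>

lemma weak_deriv_mult:
  fixes u u' v v' :: "'n::finite cfun"
  assumes u: "weak_deriv i u u'" and v: "weak_deriv i v v'"
    and uv: "locally_integrable (\<lambda>x. u x * v x)"
    and uv': "locally_integrable (\<lambda>x. u' x * v x + u x * v' x)"
  shows "weak_deriv i (\<lambda>x. u x * v x) (\<lambda>x. u' x * v x + u x * v' x)"
  unfolding weak_deriv_def
proof (intro conjI allI impI uv uv')
  fix h :: real assume h: "h > 0"
  let ?e = "axis i 1 :: real ^ 'n"
  note [measurable] = locally_integrable_measurable[OF uv']
  have li: "locally_integrable u'" "locally_integrable v'" using u v by (auto simp: weak_deriv_def)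
  have [measurable]: "u' \<in> borel_measurable borel" "v' \<in> borel_measurable borel"
    "u \<in> borel_measurable borel" "v \<in> borel_measurable borel"
    using u v by (auto simp: weak_deriv_def intro: locally_integrable_measurable)
  have hu: "AE x in lborel. u (x + h *\<^sub>R ?e) - u x = (LINT s:{0..h}|lborel. u' (x + s *\<^sub>R ?e))"
    and hv: "AE x in lborel. v (x + h *\<^sub>R ?e) - v x = (LINT s:{0..h}|lborel. v' (x + s *\<^sub>R ?e))"
    using u v h by (auto simp: weak_deriv_def)
  show "AE x in lborel. u (x + h *\<^sub>R ?e) * v (x + h *\<^sub>R ?e) - u x * v x =
      (LINT t:{0..h}|lborel. u' (x + t *\<^sub>R ?e) * v (x + t *\<^sub>R ?e) + u (x + t *\<^sub>R ?e) * v' (x + t *\<^sub>R ?e))"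
    using hu hv weak_deriv_AE_line[OF u] weak_deriv_AE_line[OF v] AE_line_set_integrable[OF li(1), of h ?e] AE_line_set_integrable[OF li(2), of h ?e]
  proof eventually_elim
    case (elim x)
    define a where "a = (\<lambda>t. u' (x + t *\<^sub>R ?e))"
    define b where "b = (\<lambda>t. v' (x + t *\<^sub>R ?e))"
    define A where "A = (\<lambda>t. LINT s:{0..t}|lborel. a s)"
    define B where "B = (\<lambda>t. LINT s:{0..t}|lborel. b s)"
    have ae: "AE t in lborel. t \<in> {0..h} \<longrightarrow> u' (x + t *\<^sub>R ?e) * v (x + t *\<^sub>R ?e) + u (x + t *\<^sub>R ?e) * v' (x + t *\<^sub>R ?e)
        = a t * (v x + B t) + (u x + A t) * b t"
      using elim(3,4)
    proof eventually_elim
      case (elim t)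
      show ?case
      proof
        assume "t \<in> {0..h}"
        with elim have "u (x + t *\<^sub>R ?e) - u x = A t" "v (x + t *\<^sub>R ?e) - v x = B t"
          by (auto simp: A_def B_def a_def b_def)
        then have "u (x + t *\<^sub>R ?e) = u x + A t" "v (x + t *\<^sub>R ?e) = v x + B t"
          by (auto simp: algebra_simps)
        then show "u' (x + t *\<^sub>R ?e) * v (x + t *\<^sub>R ?e) + u (x + t *\<^sub>R ?e) * v' (x + t *\<^sub>R ?e)
          = a t * (v x + B t) + (u x + A t) * b t"
          by (simp add: a_def b_def)
      qed
    qed
    have [measurable]: "a \<in> borel_measurable borel" "b \<in> borel_measurable borel"
      unfolding a_def b_def by measurable
    have [measurable]: "A \<in> borel_measurable borel" "B \<in> borel_measurable borel"
    proof -
      have "(\<lambda>t. LINT s|lborel. (if 0 \<le> s \<and> s \<le> t then 1 else 0) *\<^sub>R f s) \<in> borel_measurable lborel"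
        if [measurable]: "f \<in> borel_measurable borel" for f :: "real \<Rightarrow> complex"
        by measurable
      moreover have "(\<lambda>t. LINT s|lborel. (if 0 \<le> s \<and> s \<le> t then 1 else 0) *\<^sub>R f s) = (\<lambda>t. LINT s:{0..t}|lborel. f s)"
        for f :: "real \<Rightarrow> complex"
        unfolding set_lebesgue_integral_def by (intro ext Bochner_Integration.integral_cong) (auto simp: indicator_def)
      ultimately show "A \<in> borel_measurable borel" "B \<in> borel_measurable borel"
        unfolding A_def B_def by simp_all
    qed
    have "(LINT t:{0..h}|lborel. u' (x + t *\<^sub>R ?e) * v (x + t *\<^sub>R ?e) + u (x + t *\<^sub>R ?e) * v' (x + t *\<^sub>R ?e))
        = (LINT t:{0..h}|lborel. a t * (v x + B t) + (u x + A t) * b t)"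
      unfolding set_lebesgue_integral_def
      by (rule integral_cong_AE, measurable) (use ae in \<open>auto elim!: eventually_mono simp: indicator_def\<close>)
    also have "\<dots> = (u x + A h) * (v x + B h) - u x * v x"
      unfolding A_def B_def
      by (rule integral_parts_segment) (use elim(5,6) in \<open>auto simp: a_def b_def\<close>)
    also have "u x + A h = u (x + h *\<^sub>R ?e)"
      using elim(1) by (simp add: A_def a_def algebra_simps)
    also have "v x + B h = v (x + h *\<^sub>R ?e)"
      using elim(2) by (simp add: B_def b_def algebra_simps)
    finally show ?case by simp
  qed
qed

lemma weak_deriv_mult_invariant:
  fixes u u' m :: "'n::finite cfun"
  assumes weak_deriv: "weak_deriv i u u'" and m: "m \<in> borel_measurable borel" "\<And>x. norm (m x) \<le> B"
    and inv: "\<And>x t. m (x + t *\<^sub>R axis i 1) = m x"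
  shows "weak_deriv i (\<lambda>x. m x * u x) (\<lambda>x. m x * u' x)"
  unfolding weak_deriv_def
proof (intro conjI allI impI)
  show "locally_integrable (\<lambda>x. m x * u x)" "locally_integrable (\<lambda>x. m x * u' x)"
    using weak_deriv m by (auto simp: weak_deriv_def intro!: locally_integrable_mult_bounded)
  fix h :: real assume "h > 0"
  then have "AE x in lborel. u (x + h *\<^sub>R axis i 1) - u x = (LINT t:{0..h}|lborel. u' (x + t *\<^sub>R axis i 1))"
    using weak_deriv by (auto simp: weak_deriv_def)
  then show "AE x in lborel. m (x + h *\<^sub>R axis i 1) * u (x + h *\<^sub>R axis i 1) - m x * u x
      = (LINT t:{0..h}|lborel. m (x + t *\<^sub>R axis i 1) * u' (x + t *\<^sub>R axis i 1))"
    by eventually_elim (simp add: inv right_diff_distrib[symmetric])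
qed


section \<open>Integrals along lines and truncation\<close>

text \<open>Extended nonnegative values keep these integrals meaningful without any integrability,
  so that they can be iterated and reordered by Tonelli before finiteness is known.\<close>

definition line_nn :: "'n::finite \<Rightarrow> (real ^ 'n \<Rightarrow> ennreal) \<Rightarrow> real ^ 'n \<Rightarrow> ennreal" where
  "line_nn i g x = (\<integral>\<^sup>+t. g (x + t *\<^sub>R axis i 1) \<partial>lborel)"

definition lines_nn :: "'n::finite list \<Rightarrow> (real ^ 'n \<Rightarrow> ennreal) \<Rightarrow> real ^ 'n \<Rightarrow> ennreal" where
  "lines_nn is g = foldr line_nn is g"

definition invariant :: "'n::finite \<Rightarrow> (real ^ 'n \<Rightarrow> 'b) \<Rightarrow> bool" where
  "invariant i g \<longleftrightarrow> (\<forall>x t. g (x + t *\<^sub>R axis i 1) = g x)"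

lemma lines_nn_simps [simp]:
  "lines_nn [] g = g" "lines_nn (i # is) g = line_nn i (lines_nn is g)"
  "lines_nn (is @ js) g = lines_nn is (lines_nn js g)"
  by (simp_all add: lines_nn_def)

lemma line_nn_measurable [measurable]:
  assumes [measurable]: "g \<in> borel_measurable borel"
  shows "line_nn i g \<in> borel_measurable borel"
proof -
  have "(\<lambda>x. \<integral>\<^sup>+t. g (x + t *\<^sub>R axis i 1) \<partial>lborel) \<in> borel_measurable lborel" by measurable
  then show ?thesis by (simp add: line_nn_def[abs_def])
qed

lemma lines_nn_measurable [measurable]:
  "g \<in> borel_measurable borel \<Longrightarrow> lines_nn is g \<in> borel_measurable borel"
  by (induction "is") (auto simp: line_nn_measurable)

lemma line_nn_invariant:
  assumes [measurable]: "g \<in> borel_measurable borel"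
  shows "invariant i (line_nn i g)"
  unfolding invariant_def line_nn_def
proof (intro allI)
  fix x s
  have "(\<integral>\<^sup>+t. g (x + s *\<^sub>R axis i 1 + t *\<^sub>R axis i 1) \<partial>lborel)
      = (\<integral>\<^sup>+t. (\<lambda>t. g (x + t *\<^sub>R axis i 1)) (t + s) \<partial>lborel)"
    by (simp add: algebra_simps)
  also have "\<dots> = (\<integral>\<^sup>+t. g (x + t *\<^sub>R axis i 1) \<partial>lborel)"
    by (rule nn_integral_translate) measurable
  finally show "(\<integral>\<^sup>+t. g (x + s *\<^sub>R axis i 1 + t *\<^sub>R axis i 1) \<partial>lborel) = (\<integral>\<^sup>+t. g (x + t *\<^sub>R axis i 1) \<partial>lborel)" .
qed

lemma line_nn_preserves_invariant:
  assumes "invariant l g"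
  shows "invariant l (line_nn i g)"
proof -
  have "g (x + s *\<^sub>R axis l 1 + t *\<^sub>R axis i 1) = g (x + t *\<^sub>R axis i 1)" for x s t
    using assms[unfolded invariant_def, rule_format, of "x + t *\<^sub>R axis i 1" s] by (simp add: add_ac)
  then show ?thesis by (simp add: invariant_def line_nn_def)
qed

lemma lines_nn_invariant:
  "g \<in> borel_measurable borel \<Longrightarrow> i \<in> set is \<Longrightarrow> invariant i (lines_nn is g)"
  by (induction "is") (auto simp: line_nn_invariant line_nn_preserves_invariant)

lemma line_nn_commute:
  assumes [measurable]: "g \<in> borel_measurable borel"
  shows "line_nn i (line_nn l g) = line_nn l (line_nn i g)"
proof
  fix x
  have "(\<integral>\<^sup>+t. \<integral>\<^sup>+s. g (x + t *\<^sub>R axis i 1 + s *\<^sub>R axis l 1) \<partial>lborel \<partial>lborel)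
      = (\<integral>\<^sup>+s. \<integral>\<^sup>+t. g (x + t *\<^sub>R axis i 1 + s *\<^sub>R axis l 1) \<partial>lborel \<partial>lborel)"
    by (rule lborel_pair.Fubini') measurable
  also have "\<dots> = (\<integral>\<^sup>+s. \<integral>\<^sup>+t. g (x + s *\<^sub>R axis l 1 + t *\<^sub>R axis i 1) \<partial>lborel \<partial>lborel)"
    by (simp add: add.assoc add.commute[of "_ *\<^sub>R axis i 1"])
  finally show "line_nn i (line_nn l g) x = line_nn l (line_nn i g) x"
    by (simp add: line_nn_def)
qed

lemma line_nn_lines_nn_commute:
  "g \<in> borel_measurable borel \<Longrightarrow> line_nn i (lines_nn is g) = lines_nn is (line_nn i g)"
  by (induction "is") (auto simp: line_nn_commute[OF lines_nn_measurable])

lemma lines_nn_cong_set: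
  assumes g: "g \<in> borel_measurable borel"
  shows "distinct is \<Longrightarrow> distinct js \<Longrightarrow> set is = set js \<Longrightarrow> lines_nn is g = lines_nn js g"
proof (induction "is" arbitrary: js)
  case (Cons i "is")
  then obtain a b where ab: "js = a @ i # b" using split_list[of i js] by auto
  have "lines_nn is g = lines_nn (a @ b) g"
    by (rule Cons.IH) (use Cons.prems ab in auto)
  then show ?case
    using ab line_nn_lines_nn_commute[OF lines_nn_measurable[OF g], of i a b] by simp
qed auto

lemma line_nn_mult_invariant:
  assumes [measurable]: "g \<in> borel_measurable borel" and c: "invariant i c"
  shows "line_nn i (\<lambda>x. c x * g x) = (\<lambda>x. c x * line_nn i g x)"
proof
  fix x
  have "line_nn i (\<lambda>x. c x * g x) x = (\<integral>\<^sup>+t. c x * g (x + t *\<^sub>R axis i 1) \<partial>lborel)"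
    using c by (simp add: line_nn_def invariant_def)
  then show "line_nn i (\<lambda>x. c x * g x) x = c x * line_nn i g x"
    by (subst (asm) nn_integral_cmult) (auto simp: line_nn_def)
qed

lemma lines_nn_mult_invariant:
  assumes [measurable]: "g \<in> borel_measurable borel"
  shows "(\<And>i. i \<in> set is \<Longrightarrow> invariant i c) \<Longrightarrow> lines_nn is (\<lambda>x. c x * g x) = (\<lambda>x. c x * lines_nn is g x)"
  by (induction "is") (auto simp: line_nn_mult_invariant[OF lines_nn_measurable[OF assms]])

lemma lines_nn_cmult:
  "g \<in> borel_measurable borel \<Longrightarrow> lines_nn is (\<lambda>x. c * g x) = (\<lambda>x. c * lines_nn is g x)"
  using lines_nn_mult_invariant[of g "is" "\<lambda>_. c"] by (simp add: invariant_def)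

text \<open>Every translate of the inequality holds almost everywhere; exchanging quantifiers,
  almost every line satisfies it at almost every parameter.\<close>

lemma line_nn_mono_AE:
  assumes [measurable]: "g \<in> borel_measurable borel" "h \<in> borel_measurable borel"
    and le: "AE x in lborel. g x \<le> h x"
  shows "AE x in lborel. line_nn i g x \<le> line_nn i h x"
proof -
  have "AE t in lborel. AE x in lborel. g (x + t *\<^sub>R axis i 1) \<le> h (x + t *\<^sub>R axis i 1)"
  proof (rule AE_I2)
    fix t show "AE x in lborel. g (x + t *\<^sub>R axis i 1) \<le> h (x + t *\<^sub>R axis i 1)"
      by (rule AE_translate[OF le])
  qed
  moreover have "{z \<in> space (lborel \<Otimes>\<^sub>M lborel). g (fst z + snd z *\<^sub>R axis i 1) \<le> h (fst z + snd z *\<^sub>R axis i 1)} \<in> sets (lborel \<Otimes>\<^sub>M lborel)"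
    by (intro borel_measurable_le) measurable
  ultimately have "AE x in lborel. AE t in lborel. g (x + t *\<^sub>R axis i 1) \<le> h (x + t *\<^sub>R axis i 1)"
    by (simp only: lborel_pair.AE_commute)
  then show ?thesis
    unfolding line_nn_def by eventually_elim (rule nn_integral_mono_AE)
qed

lemma lines_nn_mono_AE:
  assumes "g \<in> borel_measurable borel" "h \<in> borel_measurable borel" "AE x in lborel. g x \<le> h x"
  shows "AE x in lborel. lines_nn is g x \<le> lines_nn is h x"
proof (induction "is")
  case (Cons i "is")
  then show ?case
    using line_nn_mono_AE[OF lines_nn_measurable[OF assms(1)] lines_nn_measurable[OF assms(2)]] by simp
qed (simp add: assms(3))

text \<open>A line integral is constant along its own direction, so it can be integrated only over a
  slab. After Tonelli and a translation, each point is counted for exactly those parameters that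
  bring it into the slab, an interval of length 2L.\<close>

lemma nn_integral_line_nn:
  fixes g h :: "real ^ 'n::finite \<Rightarrow> ennreal"
  assumes [measurable]: "g \<in> borel_measurable borel" "h \<in> borel_measurable borel"
    and h: "invariant i h" and L: "L > 0"
  shows "(\<integral>\<^sup>+x. line_nn i g x * (h x * indicator {-L..L} (x $ i)) \<partial>lborel) = ennreal (2 * L) * (\<integral>\<^sup>+x. g x * h x \<partial>lborel)"
proof -
  let ?e = "axis i 1 :: real ^ 'n"
  have [measurable]: "(\<lambda>x::real ^ 'n. x $ i) \<in> borel_measurable borel"
    by (intro borel_measurable_continuous_onI continuous_intros)
  have h': "h (x - t *\<^sub>R ?e) = h x" for x t
    using h[unfolded invariant_def, rule_format, of "x - t *\<^sub>R ?e" t] by simp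
  have "(\<integral>\<^sup>+x. line_nn i g x * (h x * indicator {-L..L} (x $ i)) \<partial>lborel)
      = (\<integral>\<^sup>+x. (\<integral>\<^sup>+t. g (x + t *\<^sub>R ?e) * (h x * indicator {-L..L} (x $ i)) \<partial>lborel) \<partial>lborel)"
    unfolding line_nn_def by (subst nn_integral_multc) auto
  also have "\<dots> = (\<integral>\<^sup>+t. (\<integral>\<^sup>+x. g (x + t *\<^sub>R ?e) * (h x * indicator {-L..L} (x $ i)) \<partial>lborel) \<partial>lborel)"
    by (rule lborel_pair.Fubini') measurable
  also have "\<dots> = (\<integral>\<^sup>+t. (\<integral>\<^sup>+x. g x * (h x * indicator {-L..L} (x $ i - t)) \<partial>lborel) \<partial>lborel)"
  proof (rule nn_integral_cong)
    fix t
    show "(\<integral>\<^sup>+x. g (x + t *\<^sub>R ?e) * (h x * indicator {-L..L} (x $ i)) \<partial>lborel) = (\<integral>\<^sup>+x. g x * (h x * indicator {-L..L} (x $ i - t)) \<partial>lborel)"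
      using nn_integral_translate[of "\<lambda>x. g x * (h (x - t *\<^sub>R ?e) * indicator {-L..L} ((x - t *\<^sub>R ?e) $ i))" "t *\<^sub>R ?e"]
      by (simp add: h')
  qed
  also have "\<dots> = (\<integral>\<^sup>+x. (\<integral>\<^sup>+t. g x * (h x * indicator {-L..L} (x $ i - t)) \<partial>lborel) \<partial>lborel)"
    by (rule lborel_pair.Fubini') measurable
  also have "\<dots> = (\<integral>\<^sup>+x. ennreal (2 * L) * (g x * h x) \<partial>lborel)"
  proof (rule nn_integral_cong)
    fix x :: "real ^ 'n"
    have "(\<integral>\<^sup>+t. g x * (h x * indicator {-L..L} (x $ i - t)) \<partial>lborel)
        = (\<integral>\<^sup>+t. (g x * h x) * indicator {x $ i - L..x $ i + L} t \<partial>lborel)"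
      by (intro nn_integral_cong) (auto simp: indicator_def mult.assoc)
    also have "\<dots> = (g x * h x) * ennreal (2 * L)"
      using L by (subst nn_integral_cmult_indicator) auto
    finally show "(\<integral>\<^sup>+t. g x * (h x * indicator {-L..L} (x $ i - t)) \<partial>lborel) = ennreal (2 * L) * (g x * h x)"
      by (simp add: mult.commute)
  qed
  also have "\<dots> = ennreal (2 * L) * (\<integral>\<^sup>+x. g x * h x \<partial>lborel)"
    by (rule nn_integral_cmult) measurable
  finally show ?thesis .
qed

lemma nn_integral_lines_nn:
  fixes g h :: "real ^ 'n::finite \<Rightarrow> ennreal"
  assumes g [measurable]: "g \<in> borel_measurable borel" and L: "L > 0"
  shows "distinct is \<Longrightarrow> h \<in> borel_measurable borel \<Longrightarrow> (\<And>i. i \<in> set is \<Longrightarrow> invariant i h) \<Longrightarrow>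
    (\<integral>\<^sup>+x. lines_nn is g x * (h x * (\<Prod>i\<in>set is. indicator {-L..L} (x $ i))) \<partial>lborel)
    = ennreal (2 * L) ^ length is * (\<integral>\<^sup>+x. g x * h x \<partial>lborel)"
proof (induction "is")
  case (Cons i "is")
  note [measurable] = Cons.prems(2)
  have [measurable]: "(\<lambda>x::real ^ 'n. x $ i) \<in> borel_measurable borel" for i
    by (intro borel_measurable_continuous_onI continuous_intros)
  \<comment> \<open>The slab indicators of the remaining directions join the weight; they are
    invariant in direction \<open>i\<close> because the list is distinct.\<close>
  let ?h = "\<lambda>x. h x * (\<Prod>i\<in>set is. indicator {-L..L} (x $ i)) :: ennreal"
  have "invariant i ?h"
    using Cons.prems(1,3) unfolding invariant_def
    by (auto intro!: arg_cong2[of _ _ _ _ "(*)"] prod.cong simp: axis_def)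
  then have "(\<integral>\<^sup>+x. line_nn i (lines_nn is g) x * (?h x * indicator {-L..L} (x $ i)) \<partial>lborel)
      = ennreal (2 * L) * (\<integral>\<^sup>+x. lines_nn is g x * ?h x \<partial>lborel)"
    by (intro nn_integral_line_nn L) measurable
  also have "(\<integral>\<^sup>+x. lines_nn is g x * ?h x \<partial>lborel) = ennreal (2 * L) ^ length is * (\<integral>\<^sup>+x. g x * h x \<partial>lborel)"
    by (rule Cons.IH) (use Cons.prems in auto)
  finally show ?case
    using Cons.prems(1) by (simp add: mult_ac)
qed auto

text \<open>One-dimensional Sobolev embedding on a line: |u(x)| is at most |u| at any other point of
  the line inside the cube plus the integral of |u'| between them, and this is averaged over the
  chord. The condition L \<ge> 1/2 makes the chord length 2L at least 1, so that the average of |u|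
  is bounded by its integral and no constant appears.\<close>

lemma weak_deriv_pointwise_bound:
  fixes u u' :: "'n::finite cfun"
  assumes weak_deriv: "weak_deriv i u u'" and L: "L \<ge> 1/2"
  defines "B \<equiv> cbox (\<chi> i. - L) (\<chi> i. L) :: (real ^ 'n) set"
  shows "AE x in lborel. ennreal (norm (u x)) * indicator B x
    \<le> line_nn i (\<lambda>x. ennreal (norm (u x)) * indicator B x + ennreal (norm (u' x)) * indicator B x) x"
proof -
  let ?e = "axis i 1 :: real ^ 'n"
  have [measurable]: "u \<in> borel_measurable borel" "u' \<in> borel_measurable borel"
    using weak_deriv by (auto simp: weak_deriv_def intro: locally_integrable_measurable)
  have [measurable]: "B \<in> sets borel" by (simp add: B_def)
  let ?U = "\<lambda>x. ennreal (norm (u x)) * indicator B x"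
  let ?V = "\<lambda>x. ennreal (norm (u' x)) * indicator B x"
  from weak_deriv_AE_line[OF weak_deriv] show ?thesis
  proof eventually_elim
    case (elim x)
    show ?case
    proof (cases "x \<in> B")
      case x: True
      \<comment> \<open>The parameters for which the line through \<open>x\<close> stays in the
        cube: an interval of length 2L that contains 0.\<close>
      let ?I = "{-L - x $ i..L - x $ i}"
      have xi: "-L \<le> x $ i" "x $ i \<le> L" using x by (auto simp: B_def mem_box_cart)
      have in_B: "x + t *\<^sub>R ?e \<in> B" if "t \<in> ?I" for t
        using that x unfolding B_def mem_box_cart by (auto simp: axis_def)
      have inI: "t \<in> ?I" if "x + t *\<^sub>R ?e \<in> B" for t
        using that[unfolded B_def mem_box_cart, rule_format, of i] by (auto simp: axis_def)
      have bd: "AE t in lborel. ennreal (norm (u x)) * indicator ?I t \<le> ?U (x + t *\<^sub>R ?e) + line_nn i ?V x * indicator ?I t"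
        using elim
      proof eventually_elim
        case (elim t)
        show ?case
        proof (cases "t \<in> ?I")
          case t: True
          let ?y = "x + min t 0 *\<^sub>R ?e"
          have seg: "?y + s *\<^sub>R ?e \<in> B" if "s \<in> {0..\<bar>t\<bar>}" for s
          proof -
            have "min t 0 + s \<in> ?I" using that t xi by (auto simp: min_def abs_if split: if_splits)
            from in_B[OF this] show ?thesis by (simp add: algebra_simps)
          qed
          have "ennreal (norm (u (x + max t 0 *\<^sub>R ?e) - u ?y))
              = ennreal (norm (LINT s|lborel. indicat_real {0..\<bar>t\<bar>} s *\<^sub>R u' (?y + s *\<^sub>R ?e)))"
            unfolding elim set_lebesgue_integral_def ..
          also have "\<dots> \<le> (\<integral>\<^sup>+s. ennreal (norm (indicat_real {0..\<bar>t\<bar>} s *\<^sub>R u' (?y + s *\<^sub>R ?e))) \<partial>lborel)"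
          proof (cases "integrable lborel (\<lambda>s. indicat_real {0..\<bar>t\<bar>} s *\<^sub>R u' (?y + s *\<^sub>R ?e))")
            case True
            then show ?thesis by (rule integral_norm_bound_ennreal)
          qed (simp add: not_integrable_integral_eq)
          also have "\<dots> \<le> line_nn i ?V ?y"
            unfolding line_nn_def by (intro nn_integral_mono) (use seg in \<open>auto simp: indicator_def\<close>)
          also have "\<dots> = line_nn i ?V x"
            using line_nn_invariant[of ?V i] by (simp add: invariant_def)
          finally have d: "ennreal (norm (u (x + max t 0 *\<^sub>R ?e) - u ?y)) \<le> line_nn i ?V x" .
          have "norm (u x) \<le> norm (u (x + t *\<^sub>R ?e)) + norm (u (x + max t 0 *\<^sub>R ?e) - u ?y)"
            by (cases "t \<ge> 0") (simp_all add: max_def min_def, (norm)+)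
          then have "ennreal (norm (u x)) \<le> ennreal (norm (u (x + t *\<^sub>R ?e))) + ennreal (norm (u (x + max t 0 *\<^sub>R ?e) - u ?y))"
            by (simp add: ennreal_plus[symmetric] ennreal_leI del: ennreal_plus)
          also have "\<dots> \<le> ennreal (norm (u (x + t *\<^sub>R ?e))) + line_nn i ?V x"
            using d by (rule add_left_mono)
          finally show ?thesis using t in_B[OF t] by simp
        qed simp
      qed
      have len: "ennreal (L - x $ i - (-L - x $ i)) = ennreal (2 * L)" by simp
      have "ennreal (norm (u x)) * ennreal (2 * L) = (\<integral>\<^sup>+t. ennreal (norm (u x)) * indicator ?I t \<partial>lborel)"
        using L by (subst nn_integral_cmult_indicator) auto
      also have "\<dots> \<le> (\<integral>\<^sup>+t. ?U (x + t *\<^sub>R ?e) + line_nn i ?V x * indicator ?I t \<partial>lborel)"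
        using bd by (rule nn_integral_mono_AE)
      also have "\<dots> = line_nn i ?U x + line_nn i ?V x * ennreal (2 * L)"
        using L by (subst nn_integral_add) (auto simp: line_nn_def[of i ?U] nn_integral_cmult_indicator)
      also have "\<dots> \<le> (line_nn i ?U x + line_nn i ?V x) * ennreal (2 * L)"
      proof -
        have "line_nn i ?U x * 1 \<le> line_nn i ?U x * ennreal (2 * L)"
          using L by (intro mult_left_mono) (auto simp: ennreal_1[symmetric] simp del: ennreal_1 intro!: ennreal_leI)
        then show ?thesis by (simp add: distrib_right add_right_mono)
      qed
      finally have "ennreal (norm (u x)) \<le> line_nn i ?U x + line_nn i ?V x"
        using L by (subst (asm) (1 2) mult.commute, subst (asm) ennreal_mult_le_mult_iff) (auto simp: ennreal_eq_0_iff)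
      also have "\<dots> = line_nn i (\<lambda>x. ?U x + ?V x) x"
        unfolding line_nn_def by (rule nn_integral_add[symmetric]) measurable
      finally show ?thesis using x by simp
    qed simp
  qed
qed

section \<open>Index lists of Leibniz expansions and bounds for their members\<close>

definition raise :: "'n::finite \<Rightarrow> nat \<Rightarrow> (nat ^ 'n) list \<Rightarrow> (nat ^ 'n) list" where
  "raise i l \<beta>s = \<beta>s[l := \<beta>s ! l + axis i 1]"

lemma length_raise [simp]: "length (raise i l \<beta>s) = length \<beta>s"
  by (simp add: raise_def)

lemma sum_list_raise:
  fixes \<beta>s :: "(nat ^ 'n::finite) list"
  assumes "l < length \<beta>s"
  shows "sum_list (raise i l \<beta>s) = sum_list \<beta>s + axis i 1"
  using assms unfolding raise_def
proof (induction \<beta>s arbitrary: l)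
  case (Cons \<beta> \<beta>s)
  then show ?case by (cases l) (simp_all add: add_ac)
qed simp

lemma finite_vec_le: "finite {\<beta> :: nat ^ 'n::finite. \<beta> \<le> \<alpha>}"
proof (rule finite_subset)
  show "{\<beta>. \<beta> \<le> \<alpha>} \<subseteq> vec_lambda ` (\<Pi>\<^sub>E i\<in>UNIV. {..\<alpha> $ i})"
  proof
    fix \<beta> :: "nat ^ 'n" assume "\<beta> \<in> {\<beta>. \<beta> \<le> \<alpha>}"
    then show "\<beta> \<in> vec_lambda ` (\<Pi>\<^sub>E i\<in>UNIV. {..\<alpha> $ i})"
      by (intro image_eqI[of _ _ "vec_nth \<beta>"]) (auto simp: less_eq_vec_def)
  qed
qed (auto intro!: finite_PiE)

lemma member_le_sum_list_vec:
  fixes \<beta>s :: "(nat ^ 'n::finite) list"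
  shows "\<beta> \<in> set \<beta>s \<Longrightarrow> \<beta> \<le> sum_list \<beta>s"
  by (induction \<beta>s) (auto simp: less_eq_vec_def intro: trans_le_add2)

lemma finite_mi_lists: "finite {\<beta>s. length \<beta>s = m \<and> sum_list \<beta>s \<le> (\<alpha> :: nat ^ 'n::finite)}"
proof (rule finite_subset)
  show "{\<beta>s. length \<beta>s = m \<and> sum_list \<beta>s \<le> \<alpha>} \<subseteq> {\<beta>s. set \<beta>s \<subseteq> {\<beta>. \<beta> \<le> \<alpha>} \<and> length \<beta>s = m}"
    using member_le_sum_list_vec order_trans by blast
qed (rule finite_lists_length_eq[OF finite_vec_le])

text \<open>An entry \<open>\<beta>s ! l\<close> records the derivative that has fallen on the \<open>l\<close>-th factor of a product.\<close>
definition leibniz_family :: "nat \<Rightarrow> nat ^ 'n::finite \<Rightarrow> ((nat ^ 'n) list \<Rightarrow> 'n cfun) \<Rightarrow> bool" where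
  "leibniz_family m \<alpha> X \<longleftrightarrow>
     (\<forall>\<beta>s. length \<beta>s = m \<and> sum_list \<beta>s \<le> \<alpha> \<longrightarrow> locally_integrable (X \<beta>s)) \<and>
     (\<forall>\<beta>s i. length \<beta>s = m \<and> sum_list \<beta>s + axis i 1 \<le> \<alpha> \<longrightarrow>
        weak_deriv i (X \<beta>s) (\<lambda>x. \<Sum>l<m. X (raise i l \<beta>s) x))"

text \<open>The members of the family that can still be differentiated in every direction of \<open>T\<close>.\<close>
definition mixed_mass ::
  "nat \<Rightarrow> nat ^ 'n::finite \<Rightarrow> ((nat ^ 'n) list \<Rightarrow> 'n cfun) \<Rightarrow> (real ^ 'n) set \<Rightarrow> 'n set \<Rightarrow> real ^ 'n \<Rightarrow> ennreal" where
  "mixed_mass m \<alpha> X B T x =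
     (\<Sum>\<beta>s | length \<beta>s = m \<and> sum_list \<beta>s \<le> \<alpha> \<and> (\<forall>i\<in>T. sum_list \<beta>s $ i < \<alpha> $ i).
        ennreal (norm (X \<beta>s x)) * indicator B x)"

lemma finite_mixed_class:
  "finite {\<beta>s. length \<beta>s = m \<and> sum_list \<beta>s \<le> (\<alpha> :: nat ^ 'n::finite) \<and> (\<forall>i\<in>T. sum_list \<beta>s $ i < \<alpha> $ i)}"
  by (rule finite_subset[OF _ finite_mi_lists[of m \<alpha>]]) auto

lemma mixed_mass_measurable [measurable]:
  assumes X: "leibniz_family m \<alpha> X" and [measurable]: "B \<in> sets borel"
  shows "mixed_mass m \<alpha> X B T \<in> borel_measurable borel"
  unfolding mixed_mass_def[abs_def]
proof (rule borel_measurable_sum)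
  fix \<beta>s assume "\<beta>s \<in> {\<beta>s. length \<beta>s = m \<and> sum_list \<beta>s \<le> \<alpha> \<and> (\<forall>i\<in>T. sum_list \<beta>s $ i < \<alpha> $ i)}"
  then have [measurable]: "X \<beta>s \<in> borel_measurable borel"
    using X by (auto simp: leibniz_family_def intro: locally_integrable_measurable)
  show "(\<lambda>x. ennreal (norm (X \<beta>s x)) * indicator B x) \<in> borel_measurable borel" by measurable
qed

lemma le_mixed_mass:
  assumes "length \<beta>s = m" "sum_list \<beta>s \<le> \<alpha>" "\<forall>i\<in>T. sum_list \<beta>s $ i < \<alpha> $ i"
  shows "ennreal (norm (X \<beta>s x)) * indicator B x \<le> mixed_mass m \<alpha> X B T x"
  unfolding mixed_mass_def
  by (rule member_le_sum[where f = "\<lambda>\<beta>s. ennreal (norm (X \<beta>s x)) * indicator B x"])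
     (use assms finite_mixed_class in auto)

text \<open>A member with room in direction \<open>i\<close> is bounded along that direction by its
  own mass and that of its \<open>m\<close> raised versions, whence the factor \<open>Suc m\<close>.
  Raising in direction \<open>i\<close> uses up nothing in the directions of \<open>T\<close>, since
  i \<notin> T, so all these terms belong to the class for \<open>T\<close>.\<close>

lemma mixed_mass_insert_le:
  fixes X :: "(nat ^ 'n::finite) list \<Rightarrow> 'n cfun"
  assumes X: "leibniz_family m \<alpha> X" and L: "L \<ge> 1/2" and i: "i \<notin> T"
  defines "B \<equiv> cbox (\<chi> i. - L) (\<chi> i. L) :: (real ^ 'n) set"
  shows "\<exists>c::nat. AE x in lborel. mixed_mass m \<alpha> X B (insert i T) x \<le> of_nat c * line_nn i (mixed_mass m \<alpha> X B T) x"
proof -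
  let ?G = "mixed_mass m \<alpha> X B T"
  let ?C = "{\<beta>s. length \<beta>s = m \<and> sum_list \<beta>s \<le> \<alpha> \<and> (\<forall>l\<in>insert i T. sum_list \<beta>s $ l < \<alpha> $ l)}"
  have [measurable]: "B \<in> sets borel" by (simp add: B_def)
  have [measurable]: "?G \<in> borel_measurable borel" by (rule mixed_mass_measurable[OF X]) measurable
  have one: "AE x in lborel. ennreal (norm (X \<beta>s x)) * indicator B x \<le> of_nat (Suc m) * line_nn i ?G x"
    if "\<beta>s \<in> ?C" for \<beta>s
  proof -
    have raise_le: "sum_list \<beta>s + axis i 1 \<le> \<alpha>"
      using that by (auto simp: less_eq_vec_def axis_def Suc_le_eq)
    have len: "length \<beta>s = m" using that by simp
    have "weak_deriv i (X \<beta>s) (\<lambda>x. \<Sum>l<m. X (raise i l \<beta>s) x)"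
      using X len raise_le by (auto simp: leibniz_family_def)
    from weak_deriv_pointwise_bound[OF this L, folded B_def] show ?thesis
    proof eventually_elim
      case (elim x)
      have "ennreal (norm (X \<beta>s y)) * indicator B y + ennreal (norm (\<Sum>l<m. X (raise i l \<beta>s) y)) * indicator B y
        \<le> of_nat (Suc m) * ?G y" for y
      proof -
        have r: "ennreal (norm (X (raise i l \<beta>s) y)) * indicator B y \<le> ?G y" if "l < m" for l
          by (rule le_mixed_mass)
             (use that \<open>\<beta>s \<in> ?C\<close> raise_le i in \<open>auto simp: sum_list_raise axis_def\<close>)
        have "ennreal (norm (\<Sum>l<m. X (raise i l \<beta>s) y)) * indicator B y
            \<le> ennreal (\<Sum>l<m. norm (X (raise i l \<beta>s) y)) * indicator B y"
          by (intro mult_right_mono ennreal_leI norm_sum) auto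
        also have "\<dots> = (\<Sum>l<m. ennreal (norm (X (raise i l \<beta>s) y)) * indicator B y)"
          by (subst sum_distrib_right[symmetric], subst sum_ennreal) auto
        also have "\<dots> \<le> (\<Sum>l<m. ?G y)" by (intro sum_mono r) auto
        finally have "ennreal (norm (\<Sum>l<m. X (raise i l \<beta>s) y)) * indicator B y \<le> of_nat m * ?G y" by simp
        moreover have "ennreal (norm (X \<beta>s y)) * indicator B y \<le> ?G y"
          by (rule le_mixed_mass) (use \<open>\<beta>s \<in> ?C\<close> in auto)
        ultimately show ?thesis
          using add_mono by (fastforce simp: distrib_right)
      qed
      then have "line_nn i (\<lambda>y. ennreal (norm (X \<beta>s y)) * indicator B y + ennreal (norm (\<Sum>l<m. X (raise i l \<beta>s) y)) * indicator B y) x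
          \<le> line_nn i (\<lambda>y. of_nat (Suc m) * ?G y) x"
        unfolding line_nn_def by (intro nn_integral_mono)
      also have "\<dots> = of_nat (Suc m) * line_nn i ?G x"
        unfolding line_nn_def by (rule nn_integral_cmult) measurable
      finally show ?case using elim by (rule order_trans[rotated])
    qed
  qed
  have fin: "finite ?C" by (rule finite_mixed_class)
  have "AE x in lborel. \<forall>\<beta>s\<in>?C. ennreal (norm (X \<beta>s x)) * indicator B x \<le> of_nat (Suc m) * line_nn i ?G x"
    unfolding AE_ball_countable[OF countable_finite[OF fin]] using one by blast
  then have "AE x in lborel. mixed_mass m \<alpha> X B (insert i T) x \<le> of_nat (card ?C * Suc m) * line_nn i ?G x"
  proof eventually_elim
    case (elim x)
    then have "mixed_mass m \<alpha> X B (insert i T) x \<le> (\<Sum>\<beta>s\<in>?C. of_nat (Suc m) * line_nn i ?G x)"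
      unfolding mixed_mass_def by (intro sum_mono) blast
    also have "\<dots> = of_nat (card ?C * Suc m) * line_nn i ?G x"
      by (simp only: sum_constant of_nat_mult mult.assoc)
    finally show ?case .
  qed
  then show ?thesis by blast
qed

text \<open>Each direction is spent once, trading room for one more derivative against an integral
  along it. The empty set leaves the total mass of all orders up to \<alpha>, which is locally
  integrable.\<close>

lemma mixed_mass_le_lines:
  fixes X :: "(nat ^ 'n::finite) list \<Rightarrow> 'n cfun"
  assumes X: "leibniz_family m \<alpha> X" and L: "L \<ge> 1/2"
  defines "B \<equiv> cbox (\<chi> i. - L) (\<chi> i. L) :: (real ^ 'n) set"
  shows "distinct is \<Longrightarrow> \<exists>c::nat. AE x in lborel. mixed_mass m \<alpha> X B (set is) x \<le> of_nat c * lines_nn is (mixed_mass m \<alpha> X B {}) x"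
proof (induction "is")
  case Nil
  then show ?case by (intro exI[of _ 1]) simp
next
  case (Cons i "is")
  have [measurable]: "B \<in> sets borel" by (simp add: B_def)
  have M [measurable]: "mixed_mass m \<alpha> X B T \<in> borel_measurable borel" for T by (rule mixed_mass_measurable[OF X]) measurable
  obtain c where c: "AE x in lborel. mixed_mass m \<alpha> X B (set is) x \<le> of_nat c * lines_nn is (mixed_mass m \<alpha> X B {}) x"
    using Cons by auto
  obtain d where d: "AE x in lborel. mixed_mass m \<alpha> X B (insert i (set is)) x \<le> of_nat d * line_nn i (mixed_mass m \<alpha> X B (set is)) x"
    using mixed_mass_insert_le[OF X L, of i "set is"] Cons.prems unfolding B_def by auto
  have "AE x in lborel. line_nn i (mixed_mass m \<alpha> X B (set is)) x \<le> line_nn i (\<lambda>x. of_nat c * lines_nn is (mixed_mass m \<alpha> X B {}) x) x"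
    by (rule line_nn_mono_AE[OF _ _ c]) measurable
  with d have "AE x in lborel. mixed_mass m \<alpha> X B (set (i # is)) x \<le> of_nat (d * c) * lines_nn (i # is) (mixed_mass m \<alpha> X B {}) x"
  proof eventually_elim
    case (elim x)
    have "line_nn i (\<lambda>x. of_nat c * lines_nn is (mixed_mass m \<alpha> X B {}) x) x = of_nat c * line_nn i (lines_nn is (mixed_mass m \<alpha> X B {})) x"
      unfolding line_nn_def by (rule nn_integral_cmult) measurable
    with elim(2) have "of_nat d * line_nn i (mixed_mass m \<alpha> X B (set is)) x \<le> of_nat d * (of_nat c * line_nn i (lines_nn is (mixed_mass m \<alpha> X B {})) x)"
      by (intro mult_left_mono) auto
    with elim(1) show ?case by (auto simp: mult.assoc)
  qed
  then show ?case by blast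
qed

lemma nn_integral_mixed_mass_finite:
  fixes X :: "(nat ^ 'n::finite) list \<Rightarrow> 'n cfun"
  assumes X: "leibniz_family m \<alpha> X" and B: "compact B"
  shows "(\<integral>\<^sup>+x. mixed_mass m \<alpha> X B T x \<partial>lborel) < \<infinity>"
proof -
  have [measurable]: "B \<in> sets borel" using B by (auto dest: compact_imp_closed)
  let ?C = "{\<beta>s. length \<beta>s = m \<and> sum_list \<beta>s \<le> \<alpha> \<and> (\<forall>i\<in>T. sum_list \<beta>s $ i < \<alpha> $ i)}"
  have li: "locally_integrable (X \<beta>s)" if "\<beta>s \<in> ?C" for \<beta>s
    using that X by (auto simp: leibniz_family_def)
  have "(\<integral>\<^sup>+x. mixed_mass m \<alpha> X B T x \<partial>lborel) = (\<Sum>\<beta>s\<in>?C. \<integral>\<^sup>+x. ennreal (norm (X \<beta>s x)) * indicator B x \<partial>lborel)"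
    unfolding mixed_mass_def
  proof (rule nn_integral_sum)
    fix \<beta>s assume "\<beta>s \<in> ?C"
    note [measurable] = locally_integrable_measurable[OF li[OF this]]
    show "(\<lambda>x. ennreal (norm (X \<beta>s x)) * indicator B x) \<in> borel_measurable lborel" by measurable
  qed
  also have "\<dots> < \<infinity>"
  proof -
    have "(\<integral>\<^sup>+x. ennreal (norm (X \<beta>s x)) * indicator B x \<partial>lborel) < \<infinity>" if "\<beta>s \<in> ?C" for \<beta>s
    proof -
      have "integrable lborel (\<lambda>x. indicat_real B x *\<^sub>R X \<beta>s x)"
        using li[OF that] B by (auto simp: locally_integrable_def set_integrable_def)
      then have "(\<integral>\<^sup>+x. ennreal (norm (indicat_real B x *\<^sub>R X \<beta>s x)) \<partial>lborel) < \<infinity>"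
        by (simp add: integrable_iff_bounded)
      also have "(\<integral>\<^sup>+x. ennreal (norm (indicat_real B x *\<^sub>R X \<beta>s x)) \<partial>lborel) = (\<integral>\<^sup>+x. ennreal (norm (X \<beta>s x)) * indicator B x \<partial>lborel)"
        by (intro nn_integral_cong) (auto simp: indicator_def)
      finally show ?thesis .
    qed
    then show ?thesis
      unfolding infinity_ennreal_def ennreal_sum_less_top[OF finite_mixed_class] by blast
  qed
  finally show ?thesis .
qed


text \<open>Each direction is charged to just one of the two factors. The bound for a factor is
  invariant in the directions charged to it, so it can be pulled out of the integrals that complete
  the bound of the other factor; this yields a product of two full iterated integrals.\<close>

lemma lines_nn_product_le:
  fixes X Y :: "(nat ^ 'n::finite) list \<Rightarrow> 'n cfun"
  assumes X: "leibniz_family m \<alpha> X" and Y: "leibniz_family m' \<alpha> Y" and L: "L \<ge> 1/2"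
    and len: "length \<beta>s = m" "length \<gamma>s = m'" and le: "sum_list \<beta>s + sum_list \<gamma>s \<le> \<alpha>"
    and S: "distinct S" "set S = {i. \<alpha> $ i > 0}"
  defines "B \<equiv> cbox (\<chi> i. - L) (\<chi> i. L) :: (real ^ 'n) set"
  shows "\<exists>c::nat. AE x in lborel.
    lines_nn S (\<lambda>x. ennreal (norm (X \<beta>s x)) * indicator B x * (ennreal (norm (Y \<gamma>s x)) * indicator B x)) x
    \<le> of_nat c * (lines_nn S (mixed_mass m \<alpha> X B {}) x * lines_nn S (mixed_mass m' \<alpha> Y B {}) x)"
proof -
  have [measurable]: "B \<in> sets borel" by (simp add: B_def)
  have comp: "sum_list \<beta>s $ i + sum_list \<gamma>s $ i \<le> \<alpha> $ i" for i
    using le by (auto simp: less_eq_vec_def)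
  have le1: "sum_list \<beta>s \<le> \<alpha>" and le2: "sum_list \<gamma>s \<le> \<alpha>"
    using comp by (auto simp: less_eq_vec_def intro: add_leD1 add_leD2)
  let ?g = "mixed_mass m \<alpha> X B {}" and ?h = "mixed_mass m' \<alpha> Y B {}"
  have g [measurable]: "?g \<in> borel_measurable borel" by (rule mixed_mass_measurable[OF X]) measurable
  have h [measurable]: "?h \<in> borel_measurable borel" by (rule mixed_mass_measurable[OF Y]) measurable
  have [measurable]: "X \<beta>s \<in> borel_measurable borel" "Y \<gamma>s \<in> borel_measurable borel"
    using X Y len le1 le2 by (auto simp: leibniz_family_def intro: locally_integrable_measurable)
  \<comment> \<open>Each direction of \<open>S\<close> leaves room for a further derivative of one of the two factors,
    which bounds that factor by an integral along that direction.\<close>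
  define S1 where "S1 = filter (\<lambda>i. sum_list \<beta>s $ i < \<alpha> $ i) S"
  define S2 where "S2 = filter (\<lambda>i. \<not> sum_list \<beta>s $ i < \<alpha> $ i) S"
  have dist: "distinct S1" "distinct S2" "distinct (S1 @ S2)" "distinct (S2 @ S1)"
    using S by (auto simp: S1_def S2_def)
  have sets: "set (S1 @ S2) = set S" "set (S2 @ S1) = set S" by (auto simp: S1_def S2_def)
  obtain c1 where c1: "AE x in lborel. mixed_mass m \<alpha> X B (set S1) x \<le> of_nat c1 * lines_nn S1 ?g x"
    using mixed_mass_le_lines[OF X L dist(1)] unfolding B_def by blast
  obtain c2 where c2: "AE x in lborel. mixed_mass m' \<alpha> Y B (set S2) x \<le> of_nat c2 * lines_nn S2 ?h x"
    using mixed_mass_le_lines[OF Y L dist(2)] unfolding B_def by blast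
  have X_le: "ennreal (norm (X \<beta>s x)) * indicator B x \<le> mixed_mass m \<alpha> X B (set S1) x" for x
    by (rule le_mixed_mass) (use len le1 in \<open>auto simp: S1_def\<close>)
  \<comment> \<open>In such a direction the order of \<open>\<beta>s\<close> already exhausts
    \<alpha>, so \<open>\<gamma>s\<close> has order 0 there, while \<alpha> is positive on
    \<open>S\<close>.\<close>
  have "sum_list \<gamma>s $ i < \<alpha> $ i" if "i \<in> set S2" for i
    using that S(2) comp[of i] by (auto simp: S2_def)
  then have Y_le: "ennreal (norm (Y \<gamma>s x)) * indicator B x \<le> mixed_mass m' \<alpha> Y B (set S2) x" for x
    by (intro le_mixed_mass) (use len le2 in auto)
  from c1 c2 have "AE x in lborel. ennreal (norm (X \<beta>s x)) * indicator B x * (ennreal (norm (Y \<gamma>s x)) * indicator B x)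
    \<le> of_nat (c1 * c2) * (lines_nn S1 ?g x * lines_nn S2 ?h x)"
  proof eventually_elim
    case (elim x)
    have "ennreal (norm (X \<beta>s x)) * indicator B x * (ennreal (norm (Y \<gamma>s x)) * indicator B x)
      \<le> (of_nat c1 * lines_nn S1 ?g x) * (of_nat c2 * lines_nn S2 ?h x)"
      by (rule mult_mono[OF order_trans[OF X_le elim(1)] order_trans[OF Y_le elim(2)]]) auto
    then show ?case by (simp add: mult_ac)
  qed
  then have "AE x in lborel.
    lines_nn S (\<lambda>x. ennreal (norm (X \<beta>s x)) * indicator B x * (ennreal (norm (Y \<gamma>s x)) * indicator B x)) x
    \<le> lines_nn S (\<lambda>x. of_nat (c1 * c2) * (lines_nn S1 ?g x * lines_nn S2 ?h x)) x"
    by (intro lines_nn_mono_AE) measurable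
  also have "lines_nn S (\<lambda>x. of_nat (c1 * c2) * (lines_nn S1 ?g x * lines_nn S2 ?h x))
      = (\<lambda>x. of_nat (c1 * c2) * lines_nn S (\<lambda>x. lines_nn S1 ?g x * lines_nn S2 ?h x) x)"
    by (rule lines_nn_cmult) measurable
  \<comment> \<open>Integrate first over \<open>S2\<close>, where the bound for \<open>Y\<close> is
    constant and that for \<open>X\<close> is completed, then over \<open>S1\<close>, where the
    completed bound for \<open>X\<close> is constant.\<close>
  also have "lines_nn S (\<lambda>x. lines_nn S1 ?g x * lines_nn S2 ?h x) = (\<lambda>x. lines_nn S ?g x * lines_nn S ?h x)"
  proof -
    have "lines_nn S (\<lambda>x. lines_nn S1 ?g x * lines_nn S2 ?h x) = lines_nn (S1 @ S2) (\<lambda>x. lines_nn S1 ?g x * lines_nn S2 ?h x)"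
      by (rule lines_nn_cong_set) (use S dist sets in auto)
    also have "\<dots> = lines_nn S1 (lines_nn S2 (\<lambda>x. lines_nn S2 ?h x * lines_nn S1 ?g x))"
      by (simp add: mult.commute)
    also have "lines_nn S2 (\<lambda>x. lines_nn S2 ?h x * lines_nn S1 ?g x) = (\<lambda>x. lines_nn S2 ?h x * lines_nn S2 (lines_nn S1 ?g) x)"
      by (rule lines_nn_mult_invariant) (use lines_nn_invariant[OF h] in auto)
    also have "\<dots> = (\<lambda>x. lines_nn S ?g x * lines_nn S2 ?h x)"
      using lines_nn_cong_set[OF g dist(4) S(1) sets(2)] by (simp add: mult.commute)
    also have "lines_nn S1 \<dots> = (\<lambda>x. lines_nn S ?g x * lines_nn S1 (lines_nn S2 ?h) x)"
      by (rule lines_nn_mult_invariant) (use lines_nn_invariant[OF g] sets in \<open>auto simp: S1_def\<close>)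
    also have "lines_nn S1 (lines_nn S2 ?h) = lines_nn S ?h"
      using lines_nn_cong_set[OF h dist(3) S(1) sets(1)] by simp
    finally show ?thesis .
  qed
  finally show ?thesis by blast
qed

text \<open>\<open>R N\<close> is cut out by \<open>G\<close> and \<open>H\<close>, the iterated
  line integrals of the total masses, which are constant in every direction with \<alpha> $ i > 0.
  On \<open>R N\<close> the iterated integral of each product is at most c N^2; integrating this
  over the cube and undoing the line integrals by the slab identity turns it into integrability of
  the product itself.\<close>

lemma truncation:
  fixes X Y :: "(nat ^ 'n::finite) list \<Rightarrow> 'n cfun"
  assumes X: "leibniz_family m \<alpha> X" and Y: "leibniz_family m' \<alpha> Y" and L: "L \<ge> 1/2"
  defines "B \<equiv> cbox (\<chi> i. - L) (\<chi> i. L) :: (real ^ 'n) set"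
  obtains R :: "nat \<Rightarrow> (real ^ 'n) set" where
    "\<And>N. R N \<in> sets borel"
    "\<And>N i x t. \<alpha> $ i > 0 \<Longrightarrow> x + t *\<^sub>R axis i 1 \<in> R N \<longleftrightarrow> x \<in> R N"
    "\<And>N \<beta>s \<gamma>s. length \<beta>s = m \<Longrightarrow> length \<gamma>s = m' \<Longrightarrow> sum_list \<beta>s + sum_list \<gamma>s \<le> \<alpha> \<Longrightarrow>
       set_integrable lborel (B \<inter> R N) (\<lambda>x. X \<beta>s x * Y \<gamma>s x)"
    "AE x in lborel. x \<in> B \<longrightarrow> (\<forall>\<^sub>F N in sequentially. x \<in> R N)"
proof -
  have B: "compact B" by (simp add: B_def)
  have [measurable]: "B \<in> sets borel" by (simp add: B_def)
  obtain S where S: "distinct S" "set S = {i. \<alpha> $ i > 0}"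
    using finite_distinct_list[of "{i. \<alpha> $ i > 0}"] by auto
  let ?g = "mixed_mass m \<alpha> X B {}" and ?h = "mixed_mass m' \<alpha> Y B {}"
  have g [measurable]: "?g \<in> borel_measurable borel" by (rule mixed_mass_measurable[OF X]) measurable
  have h [measurable]: "?h \<in> borel_measurable borel" by (rule mixed_mass_measurable[OF Y]) measurable
  define G where "G = lines_nn S ?g"
  define H where "H = lines_nn S ?h"
  have [measurable]: "G \<in> borel_measurable borel" "H \<in> borel_measurable borel"
    unfolding G_def H_def by measurable
  have inv: "invariant i G" "invariant i H" if "i \<in> set S" for i
    using lines_nn_invariant[OF g that] lines_nn_invariant[OF h that] by (auto simp: G_def H_def)
  define R where "R N = {x. G x \<le> of_nat N \<and> H x \<le> of_nat N}" for N :: nat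
  have [measurable]: "R N \<in> sets borel" for N
    unfolding R_def by measurable
  have [measurable]: "(\<lambda>x::real ^ 'n. x $ i) \<in> borel_measurable borel" for i
    by (intro borel_measurable_continuous_onI continuous_intros)
  \<comment> \<open>The indicator of the cube is factored by coordinates: those in \<open>S\<close>
    are the slabs consumed by the line integrals at the price of 2L each, the others are kept as an
    invariant weight.\<close>
  define p :: "'n set \<Rightarrow> real ^ 'n \<Rightarrow> ennreal" where "p A x = (\<Prod>i\<in>A. indicator {-L..L} (x $ i))" for A x
  have [measurable]: "(p A :: real ^ 'n \<Rightarrow> ennreal) \<in> borel_measurable borel" for A
    unfolding p_def[abs_def] by measurable
  have p_UNIV: "p UNIV x = (indicator B x :: ennreal)" for x
  proof (cases "x \<in> B")
    case True
    then show ?thesis by (auto simp: p_def B_def mem_box_cart)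
  next
    case False
    then obtain i where "\<not> (- L \<le> x $ i \<and> x $ i \<le> L)" by (auto simp: B_def mem_box_cart)
    then show ?thesis using False unfolding p_def by (subst prod_zero) (auto intro!: exI[of _ i])
  qed
  have p_split: "p (- set S) x * p (set S) x = (indicator B x :: ennreal)" for x
    unfolding p_UNIV[symmetric] p_def by (subst prod.union_disjoint[symmetric]) (auto intro!: prod.cong)
  have p_inv: "invariant i (p (- set S) :: real ^ 'n \<Rightarrow> ennreal)" if "i \<in> set S" for i
    using that unfolding invariant_def p_def by (auto intro!: prod.cong simp: axis_def)
  have p_B: "indicator B x * p (- set S) x = (indicator B x :: ennreal)" for x
    by (cases "x \<in> B") (auto simp: p_def B_def mem_box_cart)
  have L0: "L > 0" using L by simp
  have pw: "ennreal (2 * L) ^ length S = ennreal ((2 * L) ^ length S)" using L0 by (simp add: ennreal_power)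
  have slab: "(\<integral>\<^sup>+x. lines_nn S k x * (f x * indicator B x) \<partial>lborel)
      = ennreal (2 * L) ^ length S * (\<integral>\<^sup>+x. k x * (f x * p (- set S) x) \<partial>lborel)"
    if [measurable]: "k \<in> borel_measurable borel" "f \<in> borel_measurable borel" and "\<And>i. i \<in> set S \<Longrightarrow> invariant i f"
    for k f :: "real ^ 'n \<Rightarrow> ennreal"
  proof -
    have "(\<integral>\<^sup>+x. lines_nn S k x * ((f x * p (- set S) x) * (\<Prod>i\<in>set S. indicator {-L..L} (x $ i))) \<partial>lborel)
      = ennreal (2 * L) ^ length S * (\<integral>\<^sup>+x. k x * (f x * p (- set S) x) \<partial>lborel)"
      by (rule nn_integral_lines_nn[OF that(1) L0 S(1)])
         (use that(3) p_inv in \<open>auto simp: invariant_def\<close>)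
    then show ?thesis unfolding p_def[of "set S", symmetric] by (simp add: mult.assoc p_split)
  qed
  have p_le: "p A x \<le> (1::ennreal)" for A x
    unfolding p_def by (rule prod_le_1) (auto simp: indicator_def)
  \<comment> \<open>By the slab identity with weight 1, iterated line integrals of an integrable
    function have finite integral over the cube and hence are finite almost everywhere in it; so
    almost every point lies in \<open>R N\<close> for large \<open>N\<close>.\<close>
  have fin: "AE x in lborel. x \<in> B \<longrightarrow> lines_nn S k x < \<infinity>"
    if [measurable]: "k \<in> borel_measurable borel" and k: "(\<integral>\<^sup>+x. k x \<partial>lborel) < \<infinity>" for k
  proof -
    have "(\<integral>\<^sup>+x. k x * (1 * p (- set S) x) \<partial>lborel) \<le> (\<integral>\<^sup>+x. k x \<partial>lborel)"
      by (rule nn_integral_mono) (use mult_left_mono[OF p_le] in force)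
    with k have "ennreal (2 * L) ^ length S * (\<integral>\<^sup>+x. k x * (1 * p (- set S) x) \<partial>lborel) < \<infinity>"
      by (auto simp: pw ennreal_mult_less_top)
    then have "(\<integral>\<^sup>+x. lines_nn S k x * indicator B x \<partial>lborel) < \<infinity>"
      using slab[of k "\<lambda>_. 1"] by (simp add: invariant_def)
    then have "AE x in lborel. lines_nn S k x * indicator B x \<noteq> \<infinity>"
      by (intro nn_integral_PInf_AE) auto
    then show ?thesis by eventually_elim (auto simp: less_top)
  qed
  show thesis
  proof (rule that[of R])
    show "R N \<in> sets borel" for N by measurable
    show "x + t *\<^sub>R axis i 1 \<in> R N \<longleftrightarrow> x \<in> R N" if "\<alpha> $ i > 0" for N i x t
      using inv[of i] that S(2) by (auto simp: R_def invariant_def)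
    show "AE x in lborel. x \<in> B \<longrightarrow> (\<forall>\<^sub>F N in sequentially. x \<in> R N)"
      using fin[OF g nn_integral_mixed_mass_finite[OF X B]] fin[OF h nn_integral_mixed_mass_finite[OF Y B]]
    proof eventually_elim
      case (elim x)
      show ?case
      proof
        assume "x \<in> B"
        then have "G x < \<infinity>" "H x < \<infinity>" using elim by (auto simp: G_def H_def)
        then obtain n1 n2 :: nat where "G x \<le> of_nat n1" "H x \<le> of_nat n2"
          by (metis ennreal_Ex_less_of_nat infinity_ennreal_def less_imp_le)
        then have "x \<in> R N" if "N \<ge> max n1 n2" for N
          using that unfolding R_def by (auto intro: order_trans)
        then show "\<forall>\<^sub>F N in sequentially. x \<in> R N"
          unfolding eventually_sequentially by blast
      qed
    qed
  next
    fix N and \<beta>s \<gamma>s :: "(nat ^ 'n) list"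
    assume len: "length \<beta>s = m" "length \<gamma>s = m'" and le: "sum_list \<beta>s + sum_list \<gamma>s \<le> \<alpha>"
    have le1: "sum_list \<beta>s \<le> \<alpha>" and le2: "sum_list \<gamma>s \<le> \<alpha>"
      using le by (auto simp: less_eq_vec_def intro: add_leD1 add_leD2)
    have [measurable]: "X \<beta>s \<in> borel_measurable borel" "Y \<gamma>s \<in> borel_measurable borel"
      using X Y len le1 le2 by (auto simp: leibniz_family_def intro: locally_integrable_measurable)
    let ?k = "\<lambda>x. ennreal (norm (X \<beta>s x)) * indicator B x * (ennreal (norm (Y \<gamma>s x)) * indicator B x)"
    obtain c where c: "AE x in lborel. lines_nn S ?k x \<le> of_nat c * (G x * H x)"
      using lines_nn_product_le[OF X Y L len le S] unfolding B_def G_def H_def by blast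
    have inv_R: "invariant i (indicator (R N) :: real ^ 'n \<Rightarrow> ennreal)" if "i \<in> set S" for i
      using inv[OF that] by (auto simp: invariant_def R_def indicator_def)
    have "ennreal (2 * L) ^ length S * (\<integral>\<^sup>+x. ?k x * (indicator (R N) x * p (- set S) x) \<partial>lborel)
        = (\<integral>\<^sup>+x. lines_nn S ?k x * (indicator (R N) x * indicator B x) \<partial>lborel)"
      by (rule slab[symmetric]) (use inv_R in auto)
    also have "\<dots> \<le> (\<integral>\<^sup>+x. (of_nat c * (of_nat N * of_nat N)) * indicator B x \<partial>lborel)"
    proof (rule nn_integral_mono_AE)
      show "AE x in lborel. lines_nn S ?k x * (indicator (R N) x * indicator B x) \<le> (of_nat c * (of_nat N * of_nat N)) * indicator B x"
        using c
      proof eventually_elim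
        case (elim x)
        show ?case
        proof (cases "x \<in> R N")
          case True
          then have "of_nat c * (G x * H x) \<le> of_nat c * (of_nat N * of_nat N)"
            by (intro mult_left_mono mult_mono) (auto simp: R_def)
          with elim True show ?thesis by (auto simp: indicator_def)
        qed simp
      qed
    qed
    also have "\<dots> = of_nat c * (of_nat N * of_nat N) * emeasure lborel B"
      by (rule nn_integral_cmult_indicator) simp
    also have "\<dots> < \<infinity>"
      using emeasure_compact_finite[OF B] by (auto simp: ennreal_mult_less_top of_nat_less_top)
    finally have "(\<integral>\<^sup>+x. ?k x * (indicator (R N) x * p (- set S) x) \<partial>lborel) < \<infinity>"
      using L0 by (auto simp: pw ennreal_mult_less_top)
    also have "(\<integral>\<^sup>+x. ?k x * (indicator (R N) x * p (- set S) x) \<partial>lborel)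
      = (\<integral>\<^sup>+x. ennreal (norm (indicat_real (B \<inter> R N) x *\<^sub>R (X \<beta>s x * Y \<gamma>s x))) \<partial>lborel)"
    proof (rule nn_integral_cong)
      fix x
      show "?k x * (indicator (R N) x * p (- set S) x) = ennreal (norm (indicat_real (B \<inter> R N) x *\<^sub>R (X \<beta>s x * Y \<gamma>s x)))"
        using p_B[of x] by (cases "x \<in> B"; cases "x \<in> R N") (auto simp: norm_mult ennreal_mult)
    qed
    finally show "set_integrable lborel (B \<inter> R N) (\<lambda>x. X \<beta>s x * Y \<gamma>s x)"
      unfolding set_integrable_def by (intro integrableI_bounded) measurable
  qed
qed


section \<open>Multinomial iteration of the Leibniz rule\<close>

definition multinom :: "(nat ^ 'n::finite) list \<Rightarrow> complex" where
  "multinom \<beta>s = of_nat (mi_fact (sum_list \<beta>s)) / of_nat (\<Prod>\<beta>\<leftarrow>\<beta>s. mi_fact \<beta>)"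

lemma mi_fact_nonzero [simp]: "mi_fact \<beta> \<noteq> 0"
  by (simp add: mi_fact_def)

lemma prod_list_mi_fact_nonzero: "(\<Prod>\<beta>\<leftarrow>\<beta>s. mi_fact \<beta>) \<noteq> 0"
  by (induction \<beta>s) auto

lemma mi_fact_add_axis: "mi_fact (\<beta> + axis i 1) = mi_fact \<beta> * Suc (\<beta> $ i)"
proof -
  have "mi_fact (\<beta> + axis i 1) = fact (Suc (\<beta> $ i)) * (\<Prod>l\<in>UNIV - {i}. fact ((\<beta> + axis i 1) $ l))"
    unfolding mi_fact_def by (subst prod.remove[of UNIV i]) auto
  also have "(\<Prod>l\<in>UNIV - {i}. fact ((\<beta> + axis i 1) $ l)) = (\<Prod>l\<in>UNIV - {i}. fact (\<beta> $ l) :: nat)"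
    by (intro prod.cong) (auto simp: axis_def)
  also have "fact (Suc (\<beta> $ i)) * \<dots> = (fact (\<beta> $ i) * \<dots>) * Suc (\<beta> $ i)"
    by (simp add: algebra_simps)
  also have "fact (\<beta> $ i) * (\<Prod>l\<in>UNIV - {i}. fact (\<beta> $ l)) = mi_fact \<beta>"
    unfolding mi_fact_def by (rule prod.remove[symmetric]) auto
  finally show ?thesis .
qed

lemma prod_list_mi_fact_raise:
  "l < length \<beta>s \<Longrightarrow> (\<Prod>\<beta>\<leftarrow>raise i l \<beta>s. mi_fact \<beta>) = (\<Prod>\<beta>\<leftarrow>\<beta>s. mi_fact \<beta>) * Suc (\<beta>s ! l $ i)"
  unfolding raise_def
proof (induction \<beta>s arbitrary: l)
  case (Cons \<beta> \<beta>s)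
  then show ?case by (cases l) (simp_all add: mi_fact_add_axis algebra_simps del: One_nat_def)
qed simp

lemma raise_nth: "l < length \<beta>s \<Longrightarrow> raise i l \<beta>s ! l = \<beta>s ! l + axis i 1"
  by (simp add: raise_def)

text \<open>Raising multiplies the factorial of the sum by the new i-th component of the sum, and
  the product of factorials by the new i-th component of the l-th entry. Writing the ratio in terms
  of the raised list prepares the reindexing by that list.\<close>

lemma multinom_raise:
  assumes "l < length \<beta>s"
  shows "multinom \<beta>s = multinom (raise i l \<beta>s) * of_nat (raise i l \<beta>s ! l $ i) / of_nat (sum_list (raise i l \<beta>s) $ i)"
proof -
  define P where "P = (\<Prod>\<beta>\<leftarrow>\<beta>s. mi_fact \<beta>)"
  have P: "P \<noteq> 0" unfolding P_def by (rule prod_list_mi_fact_nonzero)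
  have r: "raise i l \<beta>s ! l $ i = Suc (\<beta>s ! l $ i)" using assms by (simp add: raise_def)
  have s: "sum_list (raise i l \<beta>s) $ i = Suc (sum_list \<beta>s $ i)" using assms by (simp add: sum_list_raise)
  have "multinom (raise i l \<beta>s) = of_nat (mi_fact (sum_list \<beta>s) * Suc (sum_list \<beta>s $ i)) / of_nat (P * Suc (\<beta>s ! l $ i))"
    unfolding multinom_def prod_list_mi_fact_raise[OF assms] sum_list_raise[OF assms] mi_fact_add_axis P_def ..
  moreover have "multinom \<beta>s = of_nat (mi_fact (sum_list \<beta>s)) / of_nat P"
    by (simp add: multinom_def P_def)
  moreover have "(a / p) = (a * c) / (p * b) * b / c" if "p \<noteq> 0" "b \<noteq> 0" "c \<noteq> 0" for a b c p :: complex
    using that by (simp add: field_simps)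
  ultimately show ?thesis
    unfolding r s using P by (simp only: of_nat_mult of_nat_eq_0_iff nat.simps simp_thms not_False_eq_True)
qed

lemma sum_list_nth_component:
  fixes \<beta>s :: "(nat ^ 'n::finite) list"
  shows "(\<Sum>l<length \<beta>s. \<beta>s ! l $ i) = sum_list \<beta>s $ i"
  by (induction \<beta>s) (simp_all add: lessThan_Suc_eq_insert_0 sum.insert sum.reindex)

lemma sum_list_eq_0_iff_replicate:
  fixes \<beta>s :: "(nat ^ 'n::finite) list"
  shows "length \<beta>s = m \<and> sum_list \<beta>s = 0 \<longleftrightarrow> \<beta>s = replicate m 0"
proof -
  have "sum_list \<beta>s = 0 \<longleftrightarrow> (\<forall>\<beta>\<in>set \<beta>s. \<beta> = 0)"
    by (induction \<beta>s) (auto simp: vec_eq_iff)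
  then show ?thesis
    by (auto intro: replicate_eqI)
qed

lemma finite_mi_lists_eq: "finite {\<beta>s. length \<beta>s = m \<and> sum_list \<beta>s = (\<alpha> :: nat ^ 'n::finite)}"
  by (rule finite_subset[OF _ finite_mi_lists[of m \<alpha>]]) auto

text \<open>Pascal's rule for multinomial coefficients. Reindexed by the raised list, each list of
  sum \<gamma> + e_i is reached from every position with a positive i-th component, with weight that
  component divided by the i-th component of the sum; these weights add up to 1.\<close>

lemma sum_raise_multinom:
  fixes A :: "(nat ^ 'n::finite) list \<Rightarrow> complex"
  shows "(\<Sum>\<beta>s | length \<beta>s = m \<and> sum_list \<beta>s = \<gamma>. multinom \<beta>s * (\<Sum>l<m. A (raise i l \<beta>s)))
    = (\<Sum>\<beta>s | length \<beta>s = m \<and> sum_list \<beta>s = \<gamma> + axis i 1. multinom \<beta>s * A \<beta>s)"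
proof -
  let ?T = "\<lambda>\<gamma>. {\<beta>s :: (nat ^ 'n) list. length \<beta>s = m \<and> sum_list \<beta>s = \<gamma>}"
  let ?g = "\<gamma> + axis i 1"
  define lower where "lower l \<beta>s = \<beta>s[l := \<beta>s ! l - axis i 1]" for l and \<beta>s :: "(nat ^ 'n) list"
  let ?S2 = "{p \<in> ?T ?g \<times> {..<m}. fst p ! snd p $ i > 0}"
  have lr: "lower l (raise i l \<beta>s) = \<beta>s" if "l < length \<beta>s" for l \<beta>s
    using that by (simp add: lower_def raise_def)
  have rl: "raise i l (lower l \<beta>s) = \<beta>s" if "l < length \<beta>s" "\<beta>s ! l $ i > 0" for l \<beta>s
  proof -
    have "\<beta>s ! l - axis i 1 + axis i 1 = \<beta>s ! l"
      using that(2) by (auto simp: vec_eq_iff axis_def)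
    then show ?thesis using that(1) by (simp add: lower_def raise_def)
  qed
  have len: "length (lower l \<beta>s) = length \<beta>s" for l \<beta>s by (simp add: lower_def)
  have "(\<Sum>\<beta>s\<in>?T \<gamma>. multinom \<beta>s * (\<Sum>l<m. A (raise i l \<beta>s)))
      = (\<Sum>p\<in>?T \<gamma> \<times> {..<m}. multinom (fst p) * A (raise i (snd p) (fst p)))"
    by (simp add: sum_distrib_left sum.cartesian_product case_prod_beta)
  also have "\<dots> = (\<Sum>p\<in>?S2. multinom (fst p) * of_nat (fst p ! snd p $ i) / of_nat (?g $ i) * A (fst p))"
  proof (rule sum.reindex_bij_witness[of _ "\<lambda>p. (lower (snd p) (fst p), snd p)" "\<lambda>p. (raise i (snd p) (fst p), snd p)"], goal_cases)
    case (1 p) then show ?case by (auto simp: lr)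
  next
    case (2 p) then show ?case by (auto simp: sum_list_raise raise_nth)
  next
    case (3 p) then show ?case by (auto simp: rl)
  next
    case (4 p)
    then have "sum_list (lower (snd p) (fst p)) + axis i 1 = ?g"
      using rl[of "snd p" "fst p"] sum_list_raise[of "snd p" "lower (snd p) (fst p)" i] by (auto simp: len)
    with 4 show ?case by (auto simp: len)
  next
    case (5 p)
    then have "snd p < length (fst p)" "sum_list (raise i (snd p) (fst p)) = ?g"
      by (auto simp: sum_list_raise)
    then show ?case using multinom_raise[of "snd p" "fst p" i] by simp
  qed
  \<comment> \<open>Pairs whose entry has i-th component 0 do not arise from raising, but their
    weight is 0, so the index set can be completed to a product.\<close>
  also have "\<dots> = (\<Sum>p\<in>?T ?g \<times> {..<m}. multinom (fst p) * of_nat (fst p ! snd p $ i) / of_nat (?g $ i) * A (fst p))"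
    by (rule sum.mono_neutral_left) (auto intro: finite_mi_lists_eq)
  also have "\<dots> = (\<Sum>\<beta>s\<in>?T ?g. \<Sum>l<m. multinom \<beta>s * of_nat (\<beta>s ! l $ i) / of_nat (?g $ i) * A \<beta>s)"
    by (simp add: sum.cartesian_product case_prod_beta)
  also have "\<dots> = (\<Sum>\<beta>s\<in>?T ?g. multinom \<beta>s * A \<beta>s)"
  proof (rule sum.cong[OF refl])
    fix \<beta>s assume \<beta>s: "\<beta>s \<in> ?T ?g"
    have "(\<Sum>l<m. multinom \<beta>s * of_nat (\<beta>s ! l $ i) / of_nat (?g $ i) * A \<beta>s)
        = (\<Sum>l<m. of_nat (\<beta>s ! l $ i)) * (multinom \<beta>s / of_nat (?g $ i) * A \<beta>s)"
      unfolding sum_distrib_right by (intro sum.cong) auto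
    also have "(\<Sum>l<m. of_nat (\<beta>s ! l $ i)) = (of_nat (?g $ i) :: complex)"
      using sum_list_nth_component[of \<beta>s i] \<beta>s by (auto simp: of_nat_sum[symmetric] simp del: of_nat_sum)
    also have "of_nat (?g $ i) * (multinom \<beta>s / of_nat (?g $ i) * A \<beta>s) = multinom \<beta>s * A \<beta>s"
    proof -
      have "(of_nat (?g $ i) :: complex) \<noteq> 0" by (simp del: of_nat_Suc add: axis_def)
      then show ?thesis by simp
    qed
    finally show "(\<Sum>l<m. multinom \<beta>s * of_nat (\<beta>s ! l $ i) / of_nat (?g $ i) * A \<beta>s) = multinom \<beta>s * A \<beta>s" .
  qed
  finally show ?thesis .
qed

text \<open>Induction on the order of \<gamma> \<le> \<alpha>, splitting off any direction with a
  positive component. The intermediate sums run through lists of every order below \<alpha>, which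
  is why the single step is demanded for all of them.\<close>

lemma multinomial_iterate:
  fixes A :: "(nat ^ 'n::finite) list \<Rightarrow> complex" and z :: "'n \<Rightarrow> complex"
  assumes step: "\<And>\<beta>s i. length \<beta>s = m \<Longrightarrow> sum_list \<beta>s + axis i 1 \<le> \<alpha> \<Longrightarrow> z i * A \<beta>s = (\<Sum>l<m. A (raise i l \<beta>s))"
  shows "(\<Prod>i\<in>UNIV. z i ^ (\<alpha> $ i)) * A (replicate m 0)
    = (\<Sum>\<beta>s | length \<beta>s = m \<and> sum_list \<beta>s = \<alpha>. multinom \<beta>s * A \<beta>s)"
proof -
  have "\<gamma> \<le> \<alpha> \<Longrightarrow> (\<Prod>i\<in>UNIV. z i ^ (\<gamma> $ i)) * A (replicate m 0)
    = (\<Sum>\<beta>s | length \<beta>s = m \<and> sum_list \<beta>s = \<gamma>. multinom \<beta>s * A \<beta>s)" for \<gamma>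
  proof (induction "mi_abs \<gamma>" arbitrary: \<gamma>)
    case 0
    then have "\<gamma> = 0" by (auto simp: mi_abs_def vec_eq_iff)
    moreover have "multinom (replicate m (0 :: nat ^ 'n)) = 1"
    proof -
      have "mi_fact (0 :: nat ^ 'n) = 1" by (simp add: mi_fact_def)
      moreover have "sum_list (replicate m (0 :: nat ^ 'n)) = 0" using sum_list_eq_0_iff_replicate by blast
      ultimately show ?thesis by (simp add: multinom_def map_replicate prod_list_replicate)
    qed
    ultimately show ?case by (simp add: sum_list_eq_0_iff_replicate)
  next
    case (Suc d)
    have "\<exists>i. \<gamma> $ i > 0"
    proof (rule ccontr)
      assume "\<not> (\<exists>i. \<gamma> $ i > 0)"
      then have "mi_abs \<gamma> = 0" by (simp add: mi_abs_def)
      with Suc.hyps(2) show False by simp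
    qed
    then obtain i where i: "\<gamma> $ i > 0" by blast
    define \<gamma>' where "\<gamma>' = \<gamma> - axis i 1"
    have \<gamma>: "\<gamma> = \<gamma>' + axis i 1" using i by (auto simp: \<gamma>'_def vec_eq_iff axis_def)
    have "mi_abs \<gamma> = mi_abs \<gamma>' + 1"
      unfolding \<gamma> mi_abs_def by (simp add: sum.distrib axis_def)
    then have d: "d = mi_abs \<gamma>'" using Suc.hyps(2) by simp
    have le: "\<gamma>' \<le> \<alpha>" using Suc.prems unfolding \<gamma> by (auto simp: less_eq_vec_def intro: add_leD1)
    have "(\<Prod>l\<in>UNIV. z l ^ (\<gamma> $ l)) = z i * (\<Prod>l\<in>UNIV. z l ^ (\<gamma>' $ l))"
      unfolding \<gamma> by (simp add: power_add prod.distrib axis_def if_distrib[of "\<lambda>k. z _ ^ k"] cong: if_cong)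
    then have "(\<Prod>l\<in>UNIV. z l ^ (\<gamma> $ l)) * A (replicate m 0)
        = z i * (\<Sum>\<beta>s | length \<beta>s = m \<and> sum_list \<beta>s = \<gamma>'. multinom \<beta>s * A \<beta>s)"
      using Suc.hyps(1)[OF d le] by (simp add: mult.assoc)
    also have "\<dots> = (\<Sum>\<beta>s | length \<beta>s = m \<and> sum_list \<beta>s = \<gamma>'. multinom \<beta>s * (\<Sum>l<m. A (raise i l \<beta>s)))"
      unfolding sum_distrib_left
    proof (rule sum.cong[OF refl])
      fix \<beta>s assume "\<beta>s \<in> {\<beta>s. length \<beta>s = m \<and> sum_list \<beta>s = \<gamma>'}"
      then have "z i * A \<beta>s = (\<Sum>l<m. A (raise i l \<beta>s))"
        using Suc.prems \<gamma> by (intro step) auto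
      then show "z i * (multinom \<beta>s * A \<beta>s) = (\<Sum>l<m. multinom \<beta>s * A (raise i l \<beta>s))"
        unfolding sum_distrib_left[symmetric] by (metis mult.left_commute)
    qed
    also have "\<dots> = (\<Sum>\<beta>s | length \<beta>s = m \<and> sum_list \<beta>s = \<gamma>. multinom \<beta>s * A \<beta>s)"
      unfolding \<gamma> by (rule sum_raise_multinom)
    finally show ?case .
  qed
  then show ?thesis by blast
qed

text \<open>Raising the head entry differentiates \<open>F\<close>, raising a later entry
  differentiates the tail, so this is the product rule for two factors. The bounded factor
  \<open>m\<close>, constant in direction \<open>i\<close>, is attached to \<open>F\<close>; it
  serves as truncation or is taken to be 1.\<close>

lemma weak_deriv_leibniz_product:
  fixes F :: "nat ^ 'n::finite \<Rightarrow> 'n cfun" and U :: "(nat ^ 'n) list \<Rightarrow> 'n cfun" and m :: "'n cfun"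
  assumes F: "leibniz_family 1 \<alpha> (\<lambda>\<beta>s. F (hd \<beta>s))" and U: "leibniz_family k \<alpha> U"
    and m: "m \<in> borel_measurable borel" "\<And>x. norm (m x) \<le> 1" "\<And>x t. m (x + t *\<^sub>R axis i 1) = m x"
    and len: "length \<beta>s = Suc k" and le: "sum_list \<beta>s + axis i 1 \<le> \<alpha>"
    and li: "\<And>\<gamma>s. length \<gamma>s = Suc k \<Longrightarrow> sum_list \<gamma>s \<le> \<alpha> \<Longrightarrow> locally_integrable (\<lambda>x. m x * (F (hd \<gamma>s) x * U (tl \<gamma>s) x))"
  shows "weak_deriv i (\<lambda>x. m x * (F (hd \<beta>s) x * U (tl \<beta>s) x))
    (\<lambda>x. \<Sum>l<Suc k. m x * (F (hd (raise i l \<beta>s)) x * U (tl (raise i l \<beta>s)) x))"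
proof -
  obtain \<beta> \<gamma>s where \<beta>s: "\<beta>s = \<beta> # \<gamma>s" "length \<gamma>s = k" using len by (cases \<beta>s) auto
  have le1: "\<beta> + axis i 1 \<le> \<alpha>" and le2: "sum_list \<gamma>s + axis i 1 \<le> \<alpha>" and le3: "sum_list \<beta>s \<le> \<alpha>"
    using le unfolding \<beta>s(1) less_eq_vec_def by (auto intro: order_trans[rotated])
  have "weak_deriv i (F \<beta>) (\<lambda>x. \<Sum>l<1. F (hd (raise i l [\<beta>])) x)"
    using F[unfolded leibniz_family_def, THEN conjunct2, rule_format, of "[\<beta>]" i] le1 by simp
  then have wF: "weak_deriv i (F \<beta>) (F (\<beta> + axis i 1))" by (simp add: raise_def)
  have wU: "weak_deriv i (U \<gamma>s) (\<lambda>x. \<Sum>l<k. U (raise i l \<gamma>s) x)"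
    using U \<beta>s(2) le2 by (auto simp: leibniz_family_def)
  have eq: "(m x * F (\<beta> + axis i 1) x) * U \<gamma>s x + (m x * F \<beta> x) * (\<Sum>l<k. U (raise i l \<gamma>s) x)
      = (\<Sum>l<Suc k. m x * (F (hd (raise i l \<beta>s)) x * U (tl (raise i l \<beta>s)) x))" for x
    unfolding sum.lessThan_Suc_shift \<beta>s(1) by (simp add: raise_def sum_distrib_left mult.assoc)
  have "weak_deriv i (\<lambda>x. (m x * F \<beta> x) * U \<gamma>s x)
      (\<lambda>x. (m x * F (\<beta> + axis i 1) x) * U \<gamma>s x + (m x * F \<beta> x) * (\<Sum>l<k. U (raise i l \<gamma>s) x))"
  proof (rule weak_deriv_mult[OF weak_deriv_mult_invariant[OF wF m(1,2,3)] wU])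
    show "locally_integrable (\<lambda>x. m x * F \<beta> x * U \<gamma>s x)"
      using li[OF len le3] by (simp add: \<beta>s(1) mult.assoc)
    show "locally_integrable (\<lambda>x. m x * F (\<beta> + axis i 1) x * U \<gamma>s x + m x * F \<beta> x * (\<Sum>l<k. U (raise i l \<gamma>s) x))"
      unfolding eq
    proof (rule locally_integrable_sum)
      fix l assume "l \<in> {..<Suc k}"
      then show "locally_integrable (\<lambda>x. m x * (F (hd (raise i l \<beta>s)) x * U (tl (raise i l \<beta>s)) x))"
        using len le by (intro li) (auto simp: sum_list_raise)
    qed
  qed
  then show ?thesis unfolding eq by (simp add: \<beta>s(1) mult.assoc)
qed

text \<open>Every product contains a factor \<open>F (hd \<beta>s)\<close> that vanishes off the
  cube, so integrability over the cube within \<open>R N\<close> is integrability over all of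
  \<open>R N\<close>, and the Fourier identity applies to the truncated products without boundary
  terms.\<close>

lemma fourier_leibniz_product:
  fixes F :: "nat ^ 'n::finite \<Rightarrow> 'n cfun" and U :: "(nat ^ 'n) list \<Rightarrow> 'n cfun"
  assumes F: "leibniz_family 1 \<alpha> (\<lambda>\<beta>s. F (hd \<beta>s))" and U: "leibniz_family k \<alpha> U"
    and K: "compact K" and supp: "\<And>\<beta>. \<beta> \<le> \<alpha> \<Longrightarrow> AE x in lborel. x \<notin> K \<longrightarrow> F \<beta> x = 0"
    and int: "\<And>\<beta>s. length \<beta>s = Suc k \<Longrightarrow> sum_list \<beta>s = \<alpha> \<Longrightarrow> integrable lborel (\<lambda>x. F (hd \<beta>s) x * U (tl \<beta>s) x)"
    and int0: "integrable lborel (\<lambda>x. F 0 x * U (replicate k 0) x)"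
  shows "(\<Prod>i\<in>UNIV. (\<i> * \<xi> $ i) ^ (\<alpha> $ i)) * (LINT x|lborel. cis (- (\<xi> \<bullet> x)) * (F 0 x * U (replicate k 0) x))
    = (\<Sum>\<beta>s | length \<beta>s = Suc k \<and> sum_list \<beta>s = \<alpha>.
        multinom \<beta>s * (LINT x|lborel. cis (- (\<xi> \<bullet> x)) * (F (hd \<beta>s) x * U (tl \<beta>s) x)))"
proof -
  obtain L0 where L0: "L0 > 0" "K \<subseteq> cbox (\<chi> i. - L0) (\<chi> i. L0)" using compact_subset_symmetric_cbox[OF K] by blast
  \<comment> \<open>The lower bound 1/2 is the one under which the pointwise bound along chords has
    constant 1.\<close>
  define L where "L = max L0 (1/2)"
  have L: "L \<ge> 1/2" by (simp add: L_def)
  define B where "B = (cbox (\<chi> i. - L) (\<chi> i. L) :: (real ^ 'n) set)"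
  have "x \<in> B" if "x \<in> cbox (\<chi> i. - L0) (\<chi> i. L0)" for x
    using that unfolding B_def mem_box_cart L_def
    by (auto intro: order_trans[of "- max L0 (1/2)" "- L0"] order_trans[of _ L0])
  with L0(2) have "K \<subseteq> B" by blast
  then have suppB: "AE x in lborel. x \<notin> B \<longrightarrow> F \<beta> x = 0" if "\<beta> \<le> \<alpha>" for \<beta>
    using supp[OF that] by eventually_elim (use \<open>K \<subseteq> B\<close> in auto)
  have [measurable]: "B \<in> sets borel" by (simp add: B_def)
  obtain R where R: "\<And>N. R N \<in> sets borel"
    "\<And>N i x t. \<alpha> $ i > 0 \<Longrightarrow> x + t *\<^sub>R axis i 1 \<in> R N \<longleftrightarrow> x \<in> R N"
    "\<And>N \<beta>s \<gamma>s. length \<beta>s = 1 \<Longrightarrow> length \<gamma>s = k \<Longrightarrow> sum_list \<beta>s + sum_list \<gamma>s \<le> \<alpha> \<Longrightarrow>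
       set_integrable lborel (B \<inter> R N) (\<lambda>x. F (hd \<beta>s) x * U \<gamma>s x)"
    "AE x in lborel. x \<in> B \<longrightarrow> (\<forall>\<^sub>F N in sequentially. x \<in> R N)"
    using truncation[OF F U L] unfolding B_def by blast
  note [measurable] = R(1)
  define W where "W \<beta>s x = F (hd \<beta>s) x * U (tl \<beta>s) x" for \<beta>s x
  define V where "V N \<beta>s x = indicator (R N) x * W \<beta>s x" for N \<beta>s x
  have hd_le: "hd \<beta>s \<le> \<alpha>" "sum_list (tl \<beta>s) \<le> \<alpha>" "hd \<beta>s + sum_list (tl \<beta>s) = sum_list \<beta>s"
    if "length \<beta>s = Suc k" "sum_list \<beta>s \<le> \<alpha>" for \<beta>s
    using that by (cases \<beta>s; auto simp: less_eq_vec_def intro: add_leD1 add_leD2)+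
  have W_meas [measurable]: "W \<beta>s \<in> borel_measurable borel" if "length \<beta>s = Suc k" "sum_list \<beta>s \<le> \<alpha>" for \<beta>s
  proof -
    have "locally_integrable (F (hd \<beta>s))"
      using F[unfolded leibniz_family_def, THEN conjunct1, rule_format, of "[hd \<beta>s]"] hd_le(1)[OF that] by simp
    moreover have "locally_integrable (U (tl \<beta>s))" using U hd_le(2)[OF that] that(1) unfolding leibniz_family_def by simp
    ultimately show ?thesis
      using locally_integrable_measurable unfolding W_def by (auto intro!: borel_measurable_times)
  qed
  have V_int: "integrable lborel (V N \<beta>s)" if \<beta>s: "length \<beta>s = Suc k" "sum_list \<beta>s \<le> \<alpha>" for N \<beta>s
  proof -
    note [measurable] = W_meas[OF \<beta>s]
    have "set_integrable lborel (B \<inter> R N) (\<lambda>x. F (hd [hd \<beta>s]) x * U (tl \<beta>s) x)"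
      by (rule R(3)) (use \<beta>s hd_le[OF \<beta>s] in auto)
    then have "integrable lborel (\<lambda>x. indicat_real (B \<inter> R N) x *\<^sub>R W \<beta>s x)"
      by (simp add: set_integrable_def W_def)
    then show ?thesis
    proof (rule integrable_cong_AE_imp)
      show "V N \<beta>s \<in> borel_measurable lborel" unfolding V_def by measurable
      show "AE x in lborel. indicat_real (B \<inter> R N) x *\<^sub>R W \<beta>s x = V N \<beta>s x"
        using suppB[OF hd_le(1)[OF \<beta>s]] by eventually_elim (auto simp: V_def W_def indicator_def)
    qed
  qed
  define A where "A N \<beta>s = (LINT x|lborel. cis (- (\<xi> \<bullet> x)) * V N \<beta>s x)" for N \<beta>s
  have cV: "integrable lborel (\<lambda>x. cis (- (\<xi> \<bullet> x)) * f x)" if "integrable lborel f" for f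
    using integrable_mult_bounded[OF that, of "\<lambda>x. cis (- (\<xi> \<bullet> x))" 1]
    by (simp add: mult.commute borel_measurable_continuous_onI continuous_intros)
  have step: "(\<i> * \<xi> $ i) * A N \<beta>s = (\<Sum>l<Suc k. A N (raise i l \<beta>s))"
    if len: "length \<beta>s = Suc k" and le: "sum_list \<beta>s + axis i 1 \<le> \<alpha>" for N \<beta>s i
  proof -
    have pos: "\<alpha> $ i > 0" using le[unfolded less_eq_vec_def, rule_format, of i] by simp
    have le': "sum_list \<beta>s \<le> \<alpha>" using le by (auto simp: less_eq_vec_def intro: add_leD1)
    have r: "length (raise i l \<beta>s) = Suc k" "sum_list (raise i l \<beta>s) \<le> \<alpha>" if "l < Suc k" for l
      using that len le by (auto simp: sum_list_raise)
    have "weak_deriv i (\<lambda>x. indicator (R N) x * (F (hd \<beta>s) x * U (tl \<beta>s) x))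
      (\<lambda>x. \<Sum>l<Suc k. indicator (R N) x * (F (hd (raise i l \<beta>s)) x * U (tl (raise i l \<beta>s)) x))"
    proof (rule weak_deriv_leibniz_product[OF F U _ _ _ len le])
      show "locally_integrable (\<lambda>x. indicator (R N) x * (F (hd \<gamma>s) x * U (tl \<gamma>s) x))"
        if "length \<gamma>s = Suc k" "sum_list \<gamma>s \<le> \<alpha>" for \<gamma>s
        using integrable_imp_locally_integrable[OF V_int[OF that, of N]] by (simp add: V_def[abs_def] W_def)
      show "indicator (R N) (x + t *\<^sub>R axis i 1) = (indicator (R N) x :: complex)" for x t
        using R(2)[OF pos] by (simp add: indicator_def)
      show "norm (indicator (R N) x :: complex) \<le> 1" for x by (simp add: indicator_def)
    qed measurable
    then have weak_deriv: "weak_deriv i (V N \<beta>s) (\<lambda>x. \<Sum>l<Suc k. V N (raise i l \<beta>s) x)"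
      by (simp add: V_def[abs_def] W_def)
    have iV: "integrable lborel (\<lambda>x. \<Sum>l<Suc k. V N (raise i l \<beta>s) x)"
      by (intro Bochner_Integration.integrable_sum V_int r) simp_all
    \<comment> \<open>The character is taken at frequency -\<xi>, which turns the factor -\<i>
      \<xi>_i of the general formula into +\<i> \<xi>_i.\<close>
    have "(LINT x|lborel. cis ((- \<xi>) \<bullet> x) * (\<Sum>l<Suc k. V N (raise i l \<beta>s) x))
        = - \<i> * ((- \<xi>) $ i) * (LINT x|lborel. cis ((- \<xi>) \<bullet> x) * V N \<beta>s x)"
      by (rule integral_cis_weak_deriv[OF weak_deriv V_int[OF len le'] iV])
    moreover have "(LINT x|lborel. cis ((- \<xi>) \<bullet> x) * (\<Sum>l<Suc k. V N (raise i l \<beta>s) x)) = (\<Sum>l<Suc k. A N (raise i l \<beta>s))"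
    proof -
      have "(LINT x|lborel. cis ((- \<xi>) \<bullet> x) * (\<Sum>l<Suc k. V N (raise i l \<beta>s) x))
          = (LINT x|lborel. (\<Sum>l<Suc k. cis (- (\<xi> \<bullet> x)) * V N (raise i l \<beta>s) x))"
        by (simp only: sum_distrib_left inner_minus_left)
      also have "\<dots> = (\<Sum>l<Suc k. A N (raise i l \<beta>s))"
        unfolding A_def by (rule Bochner_Integration.integral_sum) (use r V_int cV in auto)
      finally show ?thesis .
    qed
    ultimately show ?thesis by (simp add: A_def)
  qed
  have lim: "(\<lambda>N. A N \<beta>s) \<longlonglongrightarrow> (LINT x|lborel. cis (- (\<xi> \<bullet> x)) * W \<beta>s x)"
    if \<beta>s: "length \<beta>s = Suc k" "sum_list \<beta>s \<le> \<alpha>" and i: "integrable lborel (W \<beta>s)" for \<beta>s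
    unfolding A_def
  proof (rule integral_dominated_convergence[where w = "\<lambda>x. norm (W \<beta>s x)"])
    note [measurable] = W_meas[OF \<beta>s]
    have [measurable]: "(\<lambda>x. cis (- (\<xi> \<bullet> x))) \<in> borel_measurable borel"
      by (intro borel_measurable_continuous_onI continuous_intros)
    show "(\<lambda>x. cis (- (\<xi> \<bullet> x)) * W \<beta>s x) \<in> borel_measurable lborel" by measurable
    show "(\<lambda>x. cis (- (\<xi> \<bullet> x)) * V N \<beta>s x) \<in> borel_measurable lborel" for N
      unfolding V_def by measurable
    show "integrable lborel (\<lambda>x. norm (W \<beta>s x))" using i by simp
    show "AE x in lborel. norm (cis (- (\<xi> \<bullet> x)) * V N \<beta>s x) \<le> norm (W \<beta>s x)" for N
      by (auto simp: V_def norm_mult indicator_def)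
    show "AE x in lborel. (\<lambda>N. cis (- (\<xi> \<bullet> x)) * V N \<beta>s x) \<longlonglongrightarrow> cis (- (\<xi> \<bullet> x)) * W \<beta>s x"
      using R(4) suppB[OF hd_le(1)[OF \<beta>s]]
    proof eventually_elim
      case (elim x)
      show ?case
      proof (cases "x \<in> B")
        case True
        then have "\<forall>\<^sub>F N in sequentially. x \<in> R N" using elim by simp
        then have "\<forall>\<^sub>F N in sequentially. cis (- (\<xi> \<bullet> x)) * V N \<beta>s x = cis (- (\<xi> \<bullet> x)) * W \<beta>s x"
          by eventually_elim (simp add: V_def)
        then show ?thesis by (rule tendsto_eventually)
      next
        case False
        then have "W \<beta>s x = 0" using elim by (simp add: W_def)
        then show ?thesis by (simp add: V_def)
      qed
    qed
  qed
  \<comment> \<open>The intermediate orders have dropped out: only the zero list and lists of sum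
    \<alpha> remain. Their untruncated products are integrable, so dominated convergence can now
    remove \<open>N\<close>.\<close>
  have fin: "(\<Prod>i\<in>UNIV. (\<i> * \<xi> $ i) ^ (\<alpha> $ i)) * A N (replicate (Suc k) 0)
      = (\<Sum>\<beta>s | length \<beta>s = Suc k \<and> sum_list \<beta>s = \<alpha>. multinom \<beta>s * A N \<beta>s)" for N
    by (rule multinomial_iterate) (rule step)
  have s0: "sum_list (replicate (Suc k) (0 :: nat ^ 'n)) = 0" using sum_list_eq_0_iff_replicate by blast
  have "(\<lambda>N. (\<Prod>i\<in>UNIV. (\<i> * \<xi> $ i) ^ (\<alpha> $ i)) * A N (replicate (Suc k) 0)) \<longlonglongrightarrow>
     (\<Prod>i\<in>UNIV. (\<i> * \<xi> $ i) ^ (\<alpha> $ i)) * (LINT x|lborel. cis (- (\<xi> \<bullet> x)) * W (replicate (Suc k) 0) x)"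
    by (intro tendsto_mult tendsto_const lim) (use int0 s0 in \<open>auto simp: W_def[abs_def] less_eq_vec_def\<close>)
  moreover have "(\<lambda>N. \<Sum>\<beta>s | length \<beta>s = Suc k \<and> sum_list \<beta>s = \<alpha>. multinom \<beta>s * A N \<beta>s) \<longlonglongrightarrow>
     (\<Sum>\<beta>s | length \<beta>s = Suc k \<and> sum_list \<beta>s = \<alpha>. multinom \<beta>s * (LINT x|lborel. cis (- (\<xi> \<bullet> x)) * W \<beta>s x))"
    by (intro tendsto_sum tendsto_mult tendsto_const lim) (use int in \<open>auto simp: W_def[abs_def]\<close>)
  ultimately have "(\<Prod>i\<in>UNIV. (\<i> * \<xi> $ i) ^ (\<alpha> $ i)) * (LINT x|lborel. cis (- (\<xi> \<bullet> x)) * W (replicate (Suc k) 0) x)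
     = (\<Sum>\<beta>s | length \<beta>s = Suc k \<and> sum_list \<beta>s = \<alpha>. multinom \<beta>s * (LINT x|lborel. cis (- (\<xi> \<bullet> x)) * W \<beta>s x))"
    unfolding fin by (rule LIMSEQ_unique)
  then show ?thesis by (simp add: W_def)
qed


section \<open>Derivatives of regular distributions\<close>

lemma represents_fun_of: "regular T \<Longrightarrow> represents (fun_of T) T"
  unfolding regular_def fun_of_def by (rule someI_ex[of "\<lambda>u. represents u T"])

lemma represents_tensor:
  fixes T :: "'n::{finite,linorder} dist"
  assumes "represents u T" "test a b g"
  shows "T (tensor g) = (LINT x|lborel. u x * tensor g x)"
  using assms smooth_tensor[of g, OF test_smooth1[OF assms(2)]] compact_supp_tensor[OF assms(2)]
  by (auto simp: represents_def dist_of_def)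

text \<open>Only the i-th factor is averaged, so the segment average of a tensor is again a tensor,
  and differentiating that one factor returns the finite difference. The companions
  \<open>g'\<close> (average) and \<open>g''\<close> (difference) recur whenever a weak derivative
  is verified by testing.\<close>

lemma test_average:
  fixes g :: "'n::finite \<Rightarrow> real \<Rightarrow> complex" and i :: 'n
  assumes g: "test a b g" and h: "h \<ge> 0"
  defines "g' \<equiv> g(i := \<lambda>t. LINT s:{0..h}|lborel. g i (t - s))"
  shows "test a (b + h *\<^sub>R axis i 1) g'"
    "tensor g' x = (LINT t:{0..h}|lborel. tensor g (x - t *\<^sub>R axis i 1))"
    "tensor (g'(i := vderiv (g' i))) x = tensor g x - tensor g (x - h *\<^sub>R axis i 1)"
proof -
  have gi: "test1 (a $ i) (b $ i) (g i)" using g by (auto simp: test_def)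
  show "test a (b + h *\<^sub>R axis i 1) g'"
    unfolding test_def
  proof
    fix l
    show "test1 (a $ l) ((b + h *\<^sub>R axis i 1) $ l) (g' l)"
      using test1_average(1)[OF gi h] g h by (cases "l = i") (auto simp: g'_def test_def axis_def)
  qed
  have shift: "tensor g (x - t *\<^sub>R axis i 1) = g i (x $ i - t) * (\<Prod>l\<in>UNIV - {i}. g l (x $ l))" for t
    using tensor_shift[of g x "- t" i] by simp
  show "tensor g' x = (LINT t:{0..h}|lborel. tensor g (x - t *\<^sub>R axis i 1))"
    unfolding shift g'_def tensor_update by simp
  have "tensor g x = tensor g (x - 0 *\<^sub>R axis i 1)" by simp
  then have g0: "tensor g x = g i (x $ i) * (\<Prod>l\<in>UNIV - {i}. g l (x $ l))" unfolding shift by simp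
  have "g'(i := vderiv (g' i)) = g(i := \<lambda>t. g i t - g i (t - h))"
    using test1_average(2)[OF gi h] by (simp add: g'_def)
  then show "tensor (g'(i := vderiv (g' i))) x = tensor g x - tensor g (x - h *\<^sub>R axis i 1)"
    by (simp only: tensor_update shift g0 left_diff_distrib)
qed

lemma mi_abs_add_axis: "mi_abs (\<beta> + axis i 1) = Suc (mi_abs \<beta>)"
  unfolding mi_abs_def by (simp add: sum.distrib axis_def)

text \<open>Test with the averaged bump: one derivative in direction \<open>i\<close> passes from
  the multi-index to the test function at the price of a sign, and there it turns the average into
  the finite difference.\<close>

lemma weak_deriv_fun_of_D_dist:
  fixes q :: "'n::{finite,linorder} dist"
  assumes r: "regular (D_dist \<beta> q)" "regular (D_dist (\<beta> + axis i 1) q)"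
  shows "weak_deriv i (fun_of (D_dist \<beta> q)) (fun_of (D_dist (\<beta> + axis i 1) q))"
proof -
  let ?u = "fun_of (D_dist \<beta> q)" and ?u' = "fun_of (D_dist (\<beta> + axis i 1) q)"
  note rep = r[THEN represents_fun_of]
  have li: "locally_integrable ?u" "locally_integrable ?u'"
    using rep by (auto simp: represents_def)
  show ?thesis
  proof (rule weak_derivI_bump[OF li])
    fix a b :: "(real, 'n) vec" and c h :: real assume c: "c > 0" and h: "h > 0"
    let ?g = "bump c a b"
    define g' where "g' = ?g(i := \<lambda>t. LINT s:{0..h}|lborel. ?g i (t - s))"
    define g'' where "g'' = g'(i := vderiv (g' i))"
    note t = test_bump[OF c, of a b]
    note avg = test_average[OF t less_imp_le[OF h], of i, folded g'_def, folded g''_def]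
    have t'': "test a (b + h *\<^sub>R axis i 1) g''"
      unfolding test_def
    proof
      fix l
      have "test1 (a $ l) ((b + h *\<^sub>R axis i 1) $ l) (g' l)" using avg(1) by (simp add: test_def)
      then show "test1 (a $ l) ((b + h *\<^sub>R axis i 1) $ l) (g'' l)"
        by (cases "l = i") (simp_all add: g''_def test1_vderiv)
    qed
    have "(\<lambda>l. (vderiv ^^ ((\<beta> + axis i 1) $ l)) (g' l)) = (\<lambda>l. (vderiv ^^ (\<beta> $ l)) (g'' l))"
    proof
      fix l
      show "(vderiv ^^ ((\<beta> + axis i 1) $ l)) (g' l) = (vderiv ^^ (\<beta> $ l)) (g'' l)"
        by (cases "l = i") (simp_all add: g''_def axis_def funpow_swap1)
    qed
    then have "D (\<beta> + axis i 1) (tensor g') = D \<beta> (tensor g'')"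
      using D_tensor[of g', OF test_smooth1[OF avg(1)], of "\<beta> + axis i 1"] D_tensor[of g'', OF test_smooth1[OF t''], of \<beta>]
      by simp
    then have "(LINT x|lborel. ?u' x * tensor g' x) = - (LINT x|lborel. ?u x * tensor g'' x)"
      unfolding represents_tensor[OF rep(1) t'', symmetric] represents_tensor[OF rep(2) avg(1), symmetric]
      by (simp add: D_dist_def mi_abs_add_axis del: One_nat_def)
    also have "\<dots> = (LINT x|lborel. ?u x * (tensor ?g (x - h *\<^sub>R axis i 1) - tensor ?g x))"
      unfolding avg(3) by (simp only: integral_minus[symmetric] minus_mult_right minus_diff_eq)
    finally show "(LINT x|lborel. ?u x * (tensor ?g (x - h *\<^sub>R axis i 1) - tensor ?g x))
        = (LINT x|lborel. ?u' x * (LINT t:{0..h}|lborel. tensor ?g (x - t *\<^sub>R axis i 1)))"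
      unfolding avg(2) by simp
  qed
qed

text \<open>A bump on a box disjoint from \<open>K\<close> keeps its derivatives supported in that
  box, where \<open>q\<close> gives 0; the vanishing criterion on the complement of \<open>K\<close>
  does the rest.\<close>

lemma fun_of_D_dist_vanishes:
  fixes q :: "'n::{finite,linorder} dist"
  assumes r: "regular (D_dist \<beta> q)" and K: "compact K"
    and q: "\<And>\<phi>. schwartz \<phi> \<Longrightarrow> supp \<phi> \<inter> K = {} \<Longrightarrow> q \<phi> = 0"
  shows "AE x in lborel. x \<notin> K \<longrightarrow> fun_of (D_dist \<beta> q) x = 0"
proof -
  note rep = represents_fun_of[OF r]
  have li: "locally_integrable (fun_of (D_dist \<beta> q))" using rep by (auto simp: represents_def)
  have "AE x in lborel. x \<in> - K \<longrightarrow> fun_of (D_dist \<beta> q) x = 0"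
  proof (rule integral_bump_zero_imp_AE_zero[OF li])
    show "open (- K)" using K by (auto dest: compact_imp_closed)
    fix a b :: "(real, 'n) vec" and c :: real assume c: "c > 0" and ab: "cbox a b \<subseteq> - K"
    note t = test_bump[OF c, of a b]
    note t' = test_D[OF t, of \<beta>]
    have "q (D \<beta> (tensor (bump c a b))) = 0"
      unfolding D_tensor[of "bump c a b", OF test_smooth1[OF t]]
      by (rule q[OF schwartz_tensor[OF t']]) (use supp_tensor_subset[OF t'] ab in blast)
    then show "(LINT x|lborel. fun_of (D_dist \<beta> q) x * tensor (bump c a b) x) = 0"
      unfolding represents_tensor[OF rep t, symmetric] by (simp add: D_dist_def)
  qed
  then show ?thesis by simp
qed

lemma leibniz_family_fun_of:
  fixes q :: "'n::{finite,linorder} dist"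
  assumes r: "\<And>\<beta>. \<beta> \<le> \<alpha> \<Longrightarrow> regular (D_dist \<beta> q)"
  shows "leibniz_family 1 \<alpha> (\<lambda>\<beta>s. fun_of (D_dist (hd \<beta>s) q))"
  unfolding leibniz_family_def
proof (intro conjI allI impI)
  fix \<beta>s :: "(nat, 'n) vec list"
  assume "length \<beta>s = 1 \<and> sum_list \<beta>s \<le> \<alpha>"
  then have "hd \<beta>s \<le> \<alpha>" by (cases \<beta>s) auto
  from represents_fun_of[OF r[OF this]] show "locally_integrable (fun_of (D_dist (hd \<beta>s) q))"
    by (simp add: represents_def)
next
  fix \<beta>s :: "(nat, 'n) vec list" and i
  assume "length \<beta>s = 1 \<and> sum_list \<beta>s + axis i 1 \<le> \<alpha>"
  then obtain \<beta> where \<beta>: "\<beta>s = [\<beta>]" "\<beta> + axis i 1 \<le> \<alpha>" by (cases \<beta>s) auto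
  then have "\<beta> \<le> \<alpha>" by (auto simp: less_eq_vec_def intro: add_leD1)
  with \<beta> show "weak_deriv i (fun_of (D_dist (hd \<beta>s) q)) (\<lambda>x. \<Sum>l<1. fun_of (D_dist (hd (raise i l \<beta>s)) q) x)"
    using weak_deriv_fun_of_D_dist[OF r r, of \<beta> i] by (simp add: raise_def)
qed


section \<open>Fourier transform of rapidly decreasing functions\<close>

definition rapidly_decreasing :: "'n::finite cfun \<Rightarrow> bool" where
  "rapidly_decreasing g \<longleftrightarrow> continuous_on UNIV g \<and> (\<forall>N. \<exists>C. \<forall>x. (1 + norm x) ^ N * norm (g x) \<le> C)"

lemma nn_integral_inverse_1_plus_square: "(\<integral>\<^sup>+t. ennreal (1 / (1 + t\<^sup>2)) \<partial>lborel) < \<infinity>"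
proof -
  have half: "(\<integral>\<^sup>+t. ennreal (1 / (1 + t\<^sup>2)) * indicator {0::real..} t \<partial>lborel) = ennreal (pi / 2 - arctan 0)"
    by (rule nn_integral_FTC_atLeast)
       (auto intro!: tendsto_arctan_at_top derivative_eq_intros simp: inverse_eq_divide add_nonneg_pos power2_eq_square)
  have "(\<integral>\<^sup>+t. ennreal (1 / (1 + t\<^sup>2)) * indicator {..0::real} t \<partial>lborel)
      = (\<integral>\<^sup>+t. ennreal (1 / (1 + t\<^sup>2)) * indicator {0::real..} t \<partial>lborel)"
    by (subst nn_integral_real_affine[where c = "-1" and t = 0]) (auto intro!: nn_integral_cong simp: indicator_def)
  with half have fin: "(\<integral>\<^sup>+t. ennreal (1 / (1 + t\<^sup>2)) * indicator {..0::real} t \<partial>lborel)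
      + (\<integral>\<^sup>+t. ennreal (1 / (1 + t\<^sup>2)) * indicator {0::real..} t \<partial>lborel) < \<infinity>" by simp
  have "(\<integral>\<^sup>+t. ennreal (1 / (1 + t\<^sup>2)) \<partial>lborel)
      \<le> (\<integral>\<^sup>+t. ennreal (1 / (1 + t\<^sup>2)) * indicator {..0::real} t + ennreal (1 / (1 + t\<^sup>2)) * indicator {0..} t \<partial>lborel)"
    by (rule nn_integral_mono) (auto simp: indicator_def)
  also have "\<dots> = (\<integral>\<^sup>+t. ennreal (1 / (1 + t\<^sup>2)) * indicator {..0::real} t \<partial>lborel)
      + (\<integral>\<^sup>+t. ennreal (1 / (1 + t\<^sup>2)) * indicator {0::real..} t \<partial>lborel)"
    by (rule nn_integral_add) auto
  finally show ?thesis using fin by (rule le_less_trans)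
qed

text \<open>As (1 + |x|)^2 dominates 1 + (x \<bullet> b)^2 for every coordinate, twice the dimension
  is an exponent that provides one such factor per coordinate. The majorant is then a product of
  finite one-dimensional arctangent integrals.\<close>

lemma integrable_decay:
  "integrable lborel (\<lambda>x::'a::euclidean_space. 1 / (1 + norm x) ^ (2 * DIM('a)))"
proof (rule integrableI_bounded)
  have pos: "0 < 1 + norm x" for x :: 'a by (simp add: add_pos_nonneg)
  have "(\<integral>\<^sup>+x. ennreal (norm (1 / (1 + norm (x::'a)) ^ (2 * DIM('a)))) \<partial>lborel)
      \<le> (\<integral>\<^sup>+x. (\<Prod>b\<in>Basis. ennreal (1 / (1 + ((x::'a) \<bullet> b)\<^sup>2))) \<partial>lborel)"
  proof (rule nn_integral_mono)
    fix x :: 'a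
    have "(\<Prod>b\<in>(Basis::'a set). 1 / (1 + norm x)\<^sup>2) \<le> (\<Prod>b\<in>Basis. 1 / (1 + (x \<bullet> b)\<^sup>2))"
    proof (rule prod_mono, intro conjI)
      fix b :: 'a assume b: "b \<in> Basis"
      have "\<bar>x \<bullet> b\<bar>\<^sup>2 \<le> (norm x)\<^sup>2" using Basis_le_norm[OF b] by (intro power_mono) auto
      moreover have "(1 + norm x)\<^sup>2 = 1 + 2 * norm x + (norm x)\<^sup>2" by (simp add: power2_sum)
      ultimately have "1 + (x \<bullet> b)\<^sup>2 \<le> (1 + norm x)\<^sup>2"
        using norm_ge_zero[of x] power2_abs[of "x \<bullet> b"] by linarith
      then show "1 / (1 + norm x)\<^sup>2 \<le> 1 / (1 + (x \<bullet> b)\<^sup>2)"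
        by (intro divide_left_mono mult_pos_pos zero_less_power pos add_pos_nonneg) auto
    qed simp
    then have "1 / (1 + norm x) ^ (2 * DIM('a)) \<le> (\<Prod>b\<in>Basis. 1 / (1 + (x \<bullet> b)\<^sup>2))"
      by (simp add: power_mult power_one_over)
    then show "ennreal (norm (1 / (1 + norm x) ^ (2 * DIM('a)))) \<le> (\<Prod>b\<in>Basis. ennreal (1 / (1 + (x \<bullet> b)\<^sup>2)))"
      using pos[of x] by (subst prod_ennreal) (auto intro!: ennreal_leI simp: less_imp_le)
  qed
  also have "\<dots> = (\<Prod>b\<in>(Basis::'a set). \<integral>\<^sup>+t. ennreal (1 / (1 + t\<^sup>2)) \<partial>lborel)"
    by (rule nn_integral_lborel_prod) auto
  also have "\<dots> < \<infinity>"
    using nn_integral_inverse_1_plus_square by (auto simp: ennreal_prod_eq_top less_top power_less_top_ennreal)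
  finally show "(\<integral>\<^sup>+x. ennreal (norm (1 / (1 + norm (x::'a)) ^ (2 * DIM('a)))) \<partial>lborel) < \<infinity>" .
qed (auto intro!: borel_measurable_continuous_onI continuous_intros simp: add_nonneg_eq_0_iff)

lemma rapidly_decreasing_integrable:
  fixes g :: "'n::finite cfun"
  assumes "rapidly_decreasing g"
  shows "integrable lborel g"
proof -
  let ?N = "2 * DIM(real ^ 'n)"
  obtain C where C: "\<And>x. (1 + norm x) ^ ?N * norm (g x) \<le> C"
    using assms unfolding rapidly_decreasing_def by blast
  show ?thesis
  proof (rule Bochner_Integration.integrable_bound)
    show "integrable lborel (\<lambda>x::real ^ 'n. C * (1 / (1 + norm x) ^ ?N))"
      by (rule integrable_mult_right[OF integrable_decay])
    show "g \<in> borel_measurable lborel"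
      using assms by (auto simp: rapidly_decreasing_def intro: borel_measurable_continuous_onI)
    show "AE x in lborel. norm (g x) \<le> norm (C * (1 / (1 + norm x) ^ ?N))"
    proof (rule AE_I2)
      fix x :: "real ^ 'n"
      have pos: "0 < (1 + norm x) ^ ?N" by (intro zero_less_power) (simp add: add_pos_nonneg)
      have "a = (p * a) * (1 / p)" if "p > 0" for a p :: real using that by simp
      from this[OF pos] have "norm (g x) = ((1 + norm x) ^ ?N * norm (g x)) * (1 / (1 + norm x) ^ ?N)" .
      also have "\<dots> \<le> C * (1 / (1 + norm x) ^ ?N)" by (rule mult_right_mono[OF C]) (use pos in simp)
      finally show "norm (g x) \<le> norm (C * (1 / (1 + norm x) ^ ?N))"
        by (rule order_trans) (simp only: real_norm_def abs_ge_self)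
    qed
  qed
qed

lemma rapidly_decreasing_add:
  assumes "rapidly_decreasing f" "rapidly_decreasing g"
  shows "rapidly_decreasing (\<lambda>x. f x + g x)"
  unfolding rapidly_decreasing_def
proof (intro conjI allI)
  show "continuous_on UNIV (\<lambda>x. f x + g x)" using assms by (auto simp: rapidly_decreasing_def intro: continuous_on_add)
  fix N
  obtain A B where "\<And>x. (1 + norm x) ^ N * norm (f x) \<le> A" "\<And>x. (1 + norm x) ^ N * norm (g x) \<le> B"
    using assms unfolding rapidly_decreasing_def by meson
  then have AB: "(1 + norm x) ^ N * norm (f x) + (1 + norm x) ^ N * norm (g x) \<le> A + B" for x
    by (rule add_mono)
  have "(1 + norm x) ^ N * norm (f x + g x) \<le> (1 + norm x) ^ N * norm (f x) + (1 + norm x) ^ N * norm (g x)" for x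
    unfolding distrib_left[symmetric] by (intro mult_left_mono norm_triangle_ineq) auto
  then have "(1 + norm x) ^ N * norm (f x + g x) \<le> A + B" for x using AB order_trans by blast
  then show "\<exists>C. \<forall>x. (1 + norm x) ^ N * norm (f x + g x) \<le> C" by blast
qed

lemma rapidly_decreasing_mult:
  assumes g: "rapidly_decreasing g" and p: "continuous_on UNIV p" "\<And>x. norm (p x) \<le> 1 + norm x"
  shows "rapidly_decreasing (\<lambda>x. p x * g x)"
  unfolding rapidly_decreasing_def
proof (intro conjI allI)
  show "continuous_on UNIV (\<lambda>x. p x * g x)" using assms by (auto simp: rapidly_decreasing_def intro: continuous_on_mult)
  fix N
  obtain A where A: "\<And>x. (1 + norm x) ^ Suc N * norm (g x) \<le> A"
    using g unfolding rapidly_decreasing_def by blast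
  have "(1 + norm x) ^ N * norm (p x * g x) \<le> A" for x
  proof -
    have "(1 + norm x) ^ N * norm (p x * g x) \<le> (1 + norm x) ^ N * ((1 + norm x) * norm (g x))"
      unfolding norm_mult by (intro mult_left_mono mult_right_mono p) auto
    also have "\<dots> \<le> A" using A[of x] by (simp add: mult_ac)
    finally show ?thesis .
  qed
  then show "\<exists>C. \<forall>x. (1 + norm x) ^ N * norm (p x * g x) \<le> C" by blast
qed

lemma rapidly_decreasing_cmult:
  assumes "rapidly_decreasing g"
  shows "rapidly_decreasing (\<lambda>x. c * g x)"
  unfolding rapidly_decreasing_def
proof (intro conjI allI)
  show "continuous_on UNIV (\<lambda>x. c * g x)" using assms by (auto simp: rapidly_decreasing_def intro: continuous_on_mult)
  fix N
  obtain A where A: "\<And>x. (1 + norm x) ^ N * norm (g x) \<le> A"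
    using assms unfolding rapidly_decreasing_def by blast
  have "norm c * ((1 + norm x) ^ N * norm (g x)) \<le> norm c * A" for x
    by (rule mult_left_mono[OF A]) simp
  then have "(1 + norm x) ^ N * norm (c * g x) \<le> norm c * A" for x
    by (simp add: norm_mult mult_ac)
  then show "\<exists>C. \<forall>x. (1 + norm x) ^ N * norm (c * g x) \<le> C" by blast
qed

lemma rapidly_decreasing_mult_coord:
  assumes "rapidly_decreasing g"
  shows "rapidly_decreasing (\<lambda>x. \<i> * of_real (x $ l) * g x)"
  by (rule rapidly_decreasing_mult[OF assms])
     (auto intro!: continuous_intros simp: norm_mult intro: order_trans[OF component_le_norm_cart])

section \<open>Differentiability of the inverse Fourier transform\<close>

lemma norm_cis_minus_linear: "norm (cis a - 1 - \<i> * of_real a) \<le> a\<^sup>2"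
proof -
  have "norm (exp (\<i> * of_real a) - (\<Sum>k\<le>1. (\<i> * of_real a) ^ k / fact k))
      \<le> exp \<bar>Re (\<i> * of_real a)\<bar> * norm (\<i> * of_real a) ^ Suc 1 / fact 1"
    by (rule Taylor_exp)
  then show ?thesis by (simp add: cis_conv_exp norm_mult power2_eq_square diff_diff_eq)
qed

lemma norm_integral_le:
  fixes f :: "'a \<Rightarrow> complex"
  assumes "integrable M f" "integrable M w" "\<And>x. norm (f x) \<le> w x"
  shows "norm (integral\<^sup>L M f) \<le> integral\<^sup>L M w"
  by (rule order_trans[OF integral_norm_bound integral_mono]) (use assms in auto)

text \<open>The remainder |cis a - 1 - \<i> a| \<le> a^2 is uniform in the frequency, so after
  integration the linearisation error is at most |y - x|^2 times the second absolute moment of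
  \<open>g\<close>. This gives the total derivative directly.\<close>

lemma has_derivative_inv_fourier:
  fixes g :: "'n::finite cfun"
  assumes g: "rapidly_decreasing g"
  shows "(inv_fourier g has_derivative (\<lambda>h. (LINT \<xi>|lborel. \<i> * of_real (h \<bullet> \<xi>) * (cis (x \<bullet> \<xi>) * g \<xi>)) / (2 * pi) ^ CARD('n))) (at x)"
proof -
  define c :: complex where "c = (2 * pi) ^ CARD('n)"
  have rd: "rapidly_decreasing (\<lambda>\<xi>. cis (y \<bullet> \<xi>) * g \<xi>)" for y :: "real ^ 'n"
    by (rule rapidly_decreasing_mult[OF g]) (auto intro!: continuous_intros)
  have int0: "integrable lborel (\<lambda>\<xi>. cis (y \<bullet> \<xi>) * g \<xi>)" for y
    by (rule rapidly_decreasing_integrable[OF rd])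
  have int1: "integrable lborel (\<lambda>\<xi>. \<i> * of_real (h \<bullet> \<xi>) * (cis (y \<bullet> \<xi>) * g \<xi>))" for h y :: "real ^ 'n"
  proof -
    have "h \<bullet> \<xi> = (\<Sum>l\<in>UNIV. h $ l * \<xi> $ l)" for \<xi> by (simp add: inner_vec_def)
    then have "(\<lambda>\<xi>. \<i> * of_real (h \<bullet> \<xi>) * (cis (y \<bullet> \<xi>) * g \<xi>))
        = (\<lambda>\<xi>. \<Sum>l\<in>UNIV. of_real (h $ l) * (\<i> * of_real (\<xi> $ l) * (cis (y \<bullet> \<xi>) * g \<xi>)))"
      by (simp add: sum_distrib_left sum_distrib_right mult_ac)
    then show ?thesis
      by (auto intro!: Bochner_Integration.integrable_sum integrable_mult_right
          rapidly_decreasing_integrable[OF rapidly_decreasing_mult_coord[OF rd]])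
  qed
  have int2: "integrable lborel (\<lambda>\<xi>. (norm \<xi>)\<^sup>2 * norm (g \<xi>))"
  proof -
    have "rapidly_decreasing (\<lambda>\<xi>. of_real (norm \<xi>) * (of_real (norm \<xi>) * g \<xi>))"
      by (intro rapidly_decreasing_mult g) (auto intro!: continuous_intros)
    from integrable_norm[OF rapidly_decreasing_integrable[OF this]] show ?thesis
      by (simp add: norm_mult power2_eq_square mult.assoc)
  qed
  define C where "C = (LINT \<xi>|lborel. (norm \<xi>)\<^sup>2 * norm (g \<xi>))"
  define A where "A y = (LINT \<xi>|lborel. cis (y \<bullet> \<xi>) * g \<xi>)" for y
  define A' where "A' h = (LINT \<xi>|lborel. \<i> * of_real (h \<bullet> \<xi>) * (cis (x \<bullet> \<xi>) * g \<xi>))" for h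
  have rem: "norm (A y - A x - A' (y - x)) \<le> (norm (y - x))\<^sup>2 * C" for y
  proof -
    have "A y - A x - A' (y - x) = (LINT \<xi>|lborel. (cis ((y - x) \<bullet> \<xi>) - 1 - \<i> * of_real ((y - x) \<bullet> \<xi>)) * (cis (x \<bullet> \<xi>) * g \<xi>))"
    proof -
      have "A y - A x - A' (y - x) = (LINT \<xi>|lborel. cis (y \<bullet> \<xi>) * g \<xi> - cis (x \<bullet> \<xi>) * g \<xi> - \<i> * of_real ((y - x) \<bullet> \<xi>) * (cis (x \<bullet> \<xi>) * g \<xi>))"
        unfolding A_def A'_def using int0 int1 by (subst Bochner_Integration.integral_diff | auto)+
      also have "\<dots> = (LINT \<xi>|lborel. (cis ((y - x) \<bullet> \<xi>) - 1 - \<i> * of_real ((y - x) \<bullet> \<xi>)) * (cis (x \<bullet> \<xi>) * g \<xi>))"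
      proof (rule Bochner_Integration.integral_cong[OF refl])
        fix \<xi>
        have "cis (y \<bullet> \<xi>) = cis ((y - x) \<bullet> \<xi>) * cis (x \<bullet> \<xi>)" by (simp add: cis_mult inner_diff_left)
        then show "cis (y \<bullet> \<xi>) * g \<xi> - cis (x \<bullet> \<xi>) * g \<xi> - \<i> * of_real ((y - x) \<bullet> \<xi>) * (cis (x \<bullet> \<xi>) * g \<xi>)
          = (cis ((y - x) \<bullet> \<xi>) - 1 - \<i> * of_real ((y - x) \<bullet> \<xi>)) * (cis (x \<bullet> \<xi>) * g \<xi>)"
          by (simp only: left_diff_distrib mult_1_left mult.assoc)
      qed
      finally show ?thesis .
    qed
    also have "norm \<dots> \<le> (LINT \<xi>|lborel. (norm (y - x))\<^sup>2 * ((norm \<xi>)\<^sup>2 * norm (g \<xi>)))"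
    proof (rule norm_integral_le)
      show "integrable lborel (\<lambda>\<xi>. (norm (y - x))\<^sup>2 * ((norm \<xi>)\<^sup>2 * norm (g \<xi>)))"
        using int2 by (rule integrable_mult_right)
      have "(cis ((y - x) \<bullet> \<xi>) - 1 - \<i> * of_real ((y - x) \<bullet> \<xi>)) * (cis (x \<bullet> \<xi>) * g \<xi>)
          = cis (y \<bullet> \<xi>) * g \<xi> - cis (x \<bullet> \<xi>) * g \<xi> - \<i> * of_real ((y - x) \<bullet> \<xi>) * (cis (x \<bullet> \<xi>) * g \<xi>)" for \<xi>
      proof -
        have "cis (y \<bullet> \<xi>) = cis ((y - x) \<bullet> \<xi>) * cis (x \<bullet> \<xi>)" by (simp add: cis_mult inner_diff_left)
        then show ?thesis by (simp only: left_diff_distrib mult_1_left mult.assoc)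
      qed
      then show "integrable lborel (\<lambda>\<xi>. (cis ((y - x) \<bullet> \<xi>) - 1 - \<i> * of_real ((y - x) \<bullet> \<xi>)) * (cis (x \<bullet> \<xi>) * g \<xi>))"
        using int0 int1 by simp
      fix \<xi> :: "real ^ 'n"
      have "norm (cis ((y - x) \<bullet> \<xi>) - 1 - \<i> * of_real ((y - x) \<bullet> \<xi>)) \<le> \<bar>(y - x) \<bullet> \<xi>\<bar>\<^sup>2"
        using norm_cis_minus_linear[of "(y - x) \<bullet> \<xi>"] by simp
      also have "\<dots> \<le> (norm (y - x) * norm \<xi>)\<^sup>2"
        by (intro power_mono Cauchy_Schwarz_ineq2) auto
      finally show "norm ((cis ((y - x) \<bullet> \<xi>) - 1 - \<i> * of_real ((y - x) \<bullet> \<xi>)) * (cis (x \<bullet> \<xi>) * g \<xi>))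
          \<le> (norm (y - x))\<^sup>2 * ((norm \<xi>)\<^sup>2 * norm (g \<xi>))"
        by (simp add: norm_mult power_mult_distrib mult.assoc[symmetric] mult_right_mono)
    qed
    also have "\<dots> = (norm (y - x))\<^sup>2 * C" by (simp add: C_def)
    finally show ?thesis .
  qed
  have C0: "C \<ge> 0" unfolding C_def by (intro Bochner_Integration.integral_nonneg) auto
  have lin: "bounded_linear A'"
  proof (rule bounded_linear_intro)
    show "A' (h + k) = A' h + A' k" for h k
      unfolding A'_def using int1 by (subst Bochner_Integration.integral_add[symmetric]) (auto simp: inner_add_left algebra_simps)
    show "A' (r *\<^sub>R h) = r *\<^sub>R A' h" for r h
    proof -
      have "A' (r *\<^sub>R h) = (LINT \<xi>|lborel. of_real r * (\<i> * of_real (h \<bullet> \<xi>) * (cis (x \<bullet> \<xi>) * g \<xi>)))"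
        unfolding A'_def by (intro Bochner_Integration.integral_cong refl) (simp add: mult_ac)
      also have "\<dots> = of_real r * A' h" unfolding A'_def by (rule integral_mult_right_zero)
      finally show ?thesis by (simp only: scaleR_conv_of_real)
    qed
    have int3: "integrable lborel (\<lambda>\<xi>. norm (of_real (norm \<xi>) * g \<xi>))"
      by (intro integrable_norm rapidly_decreasing_integrable rapidly_decreasing_mult g) (auto intro!: continuous_intros)
    show "norm (A' h) \<le> norm h * (LINT \<xi>|lborel. norm (of_real (norm \<xi>) * g \<xi>))" for h
    proof -
      have "norm (A' h) \<le> (LINT \<xi>|lborel. norm h * norm (of_real (norm \<xi>) * g \<xi>))"
        unfolding A'_def
      proof (rule norm_integral_le[OF int1 integrable_mult_right[OF int3]])
        fix \<xi> show "norm (\<i> * of_real (h \<bullet> \<xi>) * (cis (x \<bullet> \<xi>) * g \<xi>)) \<le> norm h * norm (of_real (norm \<xi>) * g \<xi>)"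
          using Cauchy_Schwarz_ineq2[of h \<xi>]
          by (simp add: norm_mult mult.assoc[symmetric] mult_right_mono)
      qed
      then show ?thesis by simp
    qed
  qed
  have "(A has_derivative A') (at x)"
  proof (rule has_derivativeI_sandwich[of 1, OF _ lin])
    show "norm ((A y - A x) - A' (y - x)) / norm (y - x) \<le> norm (y - x) * C" if "y \<noteq> x" for y
      using rem[of y] that by (simp add: divide_le_eq power2_eq_square mult_ac)
    have "((\<lambda>y. norm (y - x) * C) \<longlongrightarrow> norm (x - x) * C) (at x)"
      by (intro tendsto_intros)
    then show "((\<lambda>y. norm (y - x) * C) \<longlongrightarrow> 0) (at x)" by simp
  qed simp
  then have "((\<lambda>y. A y / c) has_derivative (\<lambda>h. A' h / c)) (at x)"
    unfolding divide_inverse by (rule has_derivative_mult_left)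
  then show ?thesis
    unfolding A_def A'_def c_def inv_fourier_def[abs_def] .
qed

lemma partial_deriv_of_has_derivative:
  assumes "(f has_derivative f') (at x)"
  shows "((\<lambda>t. f (x + t *\<^sub>R axis i 1)) has_vector_derivative f' (axis i 1)) (at 0)"
    "partial_deriv i f x = f' (axis i 1)"
proof -
  have "((\<lambda>t. x + t *\<^sub>R axis i 1) has_derivative (\<lambda>t. t *\<^sub>R axis i 1)) (at 0)"
    by (auto intro!: derivative_eq_intros)
  moreover have "(f has_derivative f') (at (x + 0 *\<^sub>R axis i 1))" using assms by simp
  ultimately have "((\<lambda>t. f (x + t *\<^sub>R axis i 1)) has_derivative (\<lambda>t. f' (t *\<^sub>R axis i 1))) (at 0)"
    by (rule has_derivative_compose)
  moreover have "f' (t *\<^sub>R axis i 1) = t *\<^sub>R f' (axis i 1)" for t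
    using assms has_derivative_bounded_linear linear_simps(5) by blast
  ultimately show v: "((\<lambda>t. f (x + t *\<^sub>R axis i 1)) has_vector_derivative f' (axis i 1)) (at 0)"
    by (simp add: has_vector_derivative_def)
  show "partial_deriv i f x = f' (axis i 1)"
    unfolding partial_deriv_def by (rule vector_derivative_at[OF v])
qed

lemma partial_deriv_inv_fourier:
  assumes "rapidly_decreasing g"
  shows "partial_deriv i (inv_fourier g) = inv_fourier (\<lambda>\<xi>. \<i> * of_real (\<xi> $ i) * g \<xi>)"
proof
  fix x
  show "partial_deriv i (inv_fourier g) x = inv_fourier (\<lambda>\<xi>. \<i> * of_real (\<xi> $ i) * g \<xi>) x"
    using partial_deriv_of_has_derivative(2)[OF has_derivative_inv_fourier[OF assms], of i x]
    by (simp add: inv_fourier_def inner_axis' mult_ac)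
qed

text \<open>Restricting to pure derivatives avoids commuting partial derivatives, and they suffice for the
  decay of the Fourier transform.\<close>
definition pure_rd :: "'n::finite cfun \<Rightarrow> bool" where
  "pure_rd g \<longleftrightarrow> (\<forall>i. \<exists>G. G (0::nat) = g \<and> (\<forall>m. rapidly_decreasing (G m) \<and>
     (\<forall>x. ((\<lambda>t. G m (x + t *\<^sub>R axis i 1)) has_vector_derivative G (Suc m) x) (at 0))))"

lemma pure_rd_rapidly_decreasing: "pure_rd g \<Longrightarrow> rapidly_decreasing g"
  unfolding pure_rd_def by metis

lemma pure_rd_mult_coord:
  fixes g :: "'n::finite cfun"
  assumes "pure_rd g"
  shows "pure_rd (\<lambda>x. \<i> * of_real (x $ l) * g x)"
  unfolding pure_rd_def
proof
  fix i
  obtain G where G: "G (0::nat) = g" "\<And>m. rapidly_decreasing (G m)"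
    "\<And>m x. ((\<lambda>t. G m (x + t *\<^sub>R axis i 1)) has_vector_derivative G (Suc m) x) (at 0)"
    using assms unfolding pure_rd_def by metis
  define c where "c = (if l = i then \<i> else 0)"
  \<comment> \<open>Leibniz formula for the m-th pure derivative of a linear function times
    \<open>g\<close>, with \<open>c\<close> the derivative of \<i> x_l in direction
    \<open>i\<close>. At m = 0 the truncated index \<open>m - 1\<close> is harmless because its
    coefficient is 0.\<close>
  define H where "H m x = \<i> * of_real (x $ l) * G m x + (of_nat m * c) * G (m - 1) x" for m x
  have "H 0 = (\<lambda>x. \<i> * of_real (x $ l) * g x)" by (simp add: H_def G(1) fun_eq_iff)
  moreover have "rapidly_decreasing (H m)" for m
    unfolding H_def[abs_def]
    by (intro rapidly_decreasing_add rapidly_decreasing_mult_coord rapidly_decreasing_cmult G)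
  moreover have "((\<lambda>t. H m (x + t *\<^sub>R axis i 1)) has_vector_derivative H (Suc m) x) (at 0)" for m x
  proof -
    have "(\<lambda>t. \<i> * complex_of_real ((x + t *\<^sub>R axis i 1) $ l)) = (\<lambda>t. \<i> * of_real (x $ l) + t *\<^sub>R c)"
    proof
      fix t
      have "(x + t *\<^sub>R axis i 1) $ l = x $ l + (if l = i then t else 0)" by (simp add: axis_def)
      then show "\<i> * complex_of_real ((x + t *\<^sub>R axis i 1) $ l) = \<i> * of_real (x $ l) + t *\<^sub>R c"
        by (simp only: c_def) (simp add: scaleR_conv_of_real algebra_simps)
    qed
    moreover have "((\<lambda>t. \<i> * of_real (x $ l) + t *\<^sub>R c) has_vector_derivative c) (at 0)"
      by (auto intro!: derivative_eq_intros)
    ultimately have "((\<lambda>t. \<i> * of_real ((x + t *\<^sub>R axis i 1) $ l)) has_vector_derivative c) (at 0)"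
      by simp
    from has_vector_derivative_mult[OF this G(3)[of m x]]
    have d1: "((\<lambda>t. \<i> * of_real ((x + t *\<^sub>R axis i 1) $ l) * G m (x + t *\<^sub>R axis i 1)) has_vector_derivative
        (\<i> * of_real (x $ l) * G (Suc m) x + c * G m x)) (at 0)" by simp
    have d2: "((\<lambda>t. of_nat m * c * G (m - 1) (x + t *\<^sub>R axis i 1)) has_vector_derivative of_nat m * c * G m x) (at 0)"
    proof (cases m)
      case (Suc k)
      then show ?thesis using has_vector_derivative_mult_right[OF G(3)[of k x], of "of_nat m * c"] by simp
    qed simp
    show ?thesis
      unfolding H_def using has_vector_derivative_add[OF d1 d2] by (simp add: algebra_simps)
  qed
  ultimately show "\<exists>H. H (0::nat) = (\<lambda>x. \<i> * of_real (x $ l) * g x) \<and> (\<forall>m. rapidly_decreasing (H m) \<and>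
     (\<forall>x. ((\<lambda>t. H m (x + t *\<^sub>R axis i 1)) has_vector_derivative H (Suc m) x) (at 0)))"
    by blast
qed

section \<open>Decay of the inverse Fourier transform\<close>

lemma inv_fourier_partial:
  fixes f f' :: "'n::finite cfun"
  assumes f: "rapidly_decreasing f" "rapidly_decreasing f'"
    and D: "\<And>x. ((\<lambda>t. f (x + t *\<^sub>R axis i 1)) has_vector_derivative f' x) (at 0)"
  shows "inv_fourier f' x = - \<i> * of_real (x $ i) * inv_fourier f x"
proof -
  note int = f[THEN rapidly_decreasing_integrable]
  have "weak_deriv i f f'"
    using f by (intro weak_deriv_of_partial D int[THEN integrable_imp_locally_integrable]) (auto simp: rapidly_decreasing_def)
  from integral_cis_weak_deriv[OF this int, of x] show ?thesis by (simp add: inv_fourier_def)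
qed

text \<open>Up to a unimodular factor, x_i^N times the transform is the transform of the N-th pure
  derivative and hence bounded. For the coordinate of largest modulus, |x| is at most CARD('n)
  |x_i|, so these bounds control the full weight; the 2 in (2n)^N absorbs the 1 in 1 + |x|.\<close>

lemma inv_fourier_rapidly_decreasing:
  fixes g :: "'n::finite cfun"
  assumes "pure_rd g"
  shows "\<exists>C. \<forall>x. (1 + norm x) ^ N * norm (inv_fourier g x) \<le> C"
proof -
  have bound: "\<exists>C. \<forall>x. norm (inv_fourier f x) \<le> C" for f :: "'n cfun"
  proof (intro exI allI)
    fix x
    have "norm (LINT \<xi>|lborel. cis (x \<bullet> \<xi>) * f \<xi>) \<le> (LINT \<xi>|lborel. norm (cis (x \<bullet> \<xi>) * f \<xi>))"
      by (rule integral_norm_bound)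
    then have "norm (LINT \<xi>|lborel. cis (x \<bullet> \<xi>) * f \<xi>) / (2 * pi) ^ CARD('n) \<le> (LINT \<xi>|lborel. norm (f \<xi>)) / (2 * pi) ^ CARD('n)"
      by (intro divide_right_mono) (auto simp: norm_mult)
    then show "norm (inv_fourier f x) \<le> (LINT \<xi>|lborel. norm (f \<xi>)) / (2 * pi) ^ CARD('n)"
      by (simp add: inv_fourier_def norm_divide norm_mult norm_power)
  qed
  have "\<exists>C. \<forall>x. \<bar>x $ i\<bar> ^ N * norm (inv_fourier g x) \<le> C" for i
  proof -
    obtain G where G: "G (0::nat) = g" "\<And>m. rapidly_decreasing (G m)"
      "\<And>m x. ((\<lambda>t. G m (x + t *\<^sub>R axis i 1)) has_vector_derivative G (Suc m) x) (at 0)"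
      using assms unfolding pure_rd_def by metis
    have "inv_fourier (G m) x = (- \<i> * of_real (x $ i)) ^ m * inv_fourier g x" for m x
    proof (induction m)
      case (Suc m)
      then show ?case using inv_fourier_partial[OF G(2) G(2) G(3), of m x] by (simp add: mult_ac)
    qed (simp add: G(1))
    then have "norm (inv_fourier (G N) x) = \<bar>x $ i\<bar> ^ N * norm (inv_fourier g x)" for x
      by (simp add: norm_mult norm_power)
    with bound[of "G N"] show ?thesis by simp
  qed
  then obtain C where C: "\<And>i x. \<bar>x $ i\<bar> ^ N * norm (inv_fourier g x) \<le> C i" by metis
  obtain C0 where C0: "\<And>x. norm (inv_fourier g x) \<le> C0" using bound by blast
  let ?n = "real CARD('n)"
  have "(1 + norm x) ^ N * norm (inv_fourier g x) \<le> (2 * ?n) ^ N * (C0 + (\<Sum>i\<in>UNIV. C i))" for x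
  proof -
    obtain i where i: "\<And>l. \<bar>x $ l\<bar> \<le> \<bar>x $ i\<bar>"
    proof -
      have "Max (range (\<lambda>l. \<bar>x $ l\<bar>)) \<in> range (\<lambda>l. \<bar>x $ l\<bar>)" by (rule Max_in) auto
      then obtain i where i: "Max (range (\<lambda>l. \<bar>x $ l\<bar>)) = \<bar>x $ i\<bar>" by blast
      have "\<bar>x $ l\<bar> \<le> \<bar>x $ i\<bar>" for l unfolding i[symmetric] by (rule Max_ge) auto
      then show thesis by (rule that)
    qed
    have n1: "?n \<ge> 1" by (simp add: Suc_leI)
    have "norm x \<le> (\<Sum>l\<in>UNIV. \<bar>x $ l\<bar>)" by (rule norm_le_l1_cart)
    also have "\<dots> \<le> (\<Sum>l\<in>(UNIV::'n set). \<bar>x $ i\<bar>)" by (rule sum_mono) (rule i)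
    finally have "norm x \<le> ?n * \<bar>x $ i\<bar>" by simp
    moreover have "?n * max 1 \<bar>x $ i\<bar> \<ge> 1 * 1" by (intro mult_mono n1) auto
    moreover have "?n * \<bar>x $ i\<bar> \<le> ?n * max 1 \<bar>x $ i\<bar>" by (intro mult_left_mono) auto
    ultimately have "1 + norm x \<le> 2 * ?n * max 1 \<bar>x $ i\<bar>" by linarith
    then have "(1 + norm x) ^ N \<le> (2 * ?n * max 1 \<bar>x $ i\<bar>) ^ N" by (intro power_mono) auto
    also have "\<dots> = (2 * ?n) ^ N * (max 1 \<bar>x $ i\<bar>) ^ N" by (rule power_mult_distrib)
    also have "(max 1 \<bar>x $ i\<bar>) ^ N \<le> 1 + \<bar>x $ i\<bar> ^ N" by (auto simp: max_def)
    finally have "(1 + norm x) ^ N \<le> (2 * ?n) ^ N * (1 + \<bar>x $ i\<bar> ^ N)" by (simp add: mult_left_mono)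
    then have "(1 + norm x) ^ N * norm (inv_fourier g x) \<le> ((2 * ?n) ^ N * (1 + \<bar>x $ i\<bar> ^ N)) * norm (inv_fourier g x)"
      by (rule mult_right_mono) simp
    also have "\<dots> = (2 * ?n) ^ N * (norm (inv_fourier g x) + \<bar>x $ i\<bar> ^ N * norm (inv_fourier g x))"
      by (simp add: algebra_simps)
    also have "\<dots> \<le> (2 * ?n) ^ N * (C0 + (\<Sum>i\<in>UNIV. C i))"
    proof (intro mult_left_mono add_mono C0)
      have "C l \<ge> 0" for l using C[of x l] by (meson abs_ge_zero mult_nonneg_nonneg norm_ge_zero order_trans zero_le_power)
      then have "C i \<le> (\<Sum>i\<in>UNIV. C i)" by (intro member_le_sum) auto
      then show "\<bar>x $ i\<bar> ^ N * norm (inv_fourier g x) \<le> (\<Sum>i\<in>UNIV. C i)" using C[of x i] by linarith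
    qed simp
    finally show ?thesis .
  qed
  then show ?thesis by blast
qed

text \<open>Each partial derivative multiplies the integrand by a coordinate, and the class
  \<open>pure_rd\<close> is stable under that; so decay of all derivatives reduces to decay of
  transforms of this class.\<close>

lemma partials_inv_fourier:
  assumes "pure_rd g"
  shows "\<exists>g'. pure_rd g' \<and> partials is (inv_fourier g) = inv_fourier g'"
proof (induction "is")
  case Nil
  then show ?case using assms by (auto simp: partials_def)
next
  case (Cons i "is")
  then obtain g' where g': "pure_rd g'" "partials is (inv_fourier g) = inv_fourier g'" by blast
  then have "partials (i # is) (inv_fourier g) = inv_fourier (\<lambda>\<xi>. \<i> * of_real (\<xi> $ i) * g' \<xi>)"
    using partial_deriv_inv_fourier[OF pure_rd_rapidly_decreasing[OF g'(1)], of i] by (simp add: partials_def)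
  with pure_rd_mult_coord[OF g'(1), of i] show ?case by blast
qed

lemma schwartz_inv_fourier_pure_rd:
  fixes g :: "'n::{finite,linorder} cfun"
  assumes "pure_rd g"
  shows "schwartz (inv_fourier g)"
  unfolding schwartz_def smooth_def
proof (intro conjI allI)
  fix "is"
  obtain g' where g': "pure_rd g'" "partials is (inv_fourier g) = inv_fourier g'"
    using partials_inv_fourier[OF assms] by blast
  have "inv_fourier g' differentiable at x" for x
    using has_derivative_inv_fourier[OF pure_rd_rapidly_decreasing[OF g'(1)]] unfolding differentiable_def by blast
  then show "partials is (inv_fourier g) differentiable_on UNIV"
    unfolding g'(2) differentiable_on_def by (auto intro: differentiable_at_withinI)
next
  fix \<alpha> :: "(nat, 'n) vec" and N
  obtain g' where g': "pure_rd g'" "D \<alpha> (inv_fourier g) = inv_fourier g'"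
    using partials_inv_fourier[OF assms] unfolding D_def by blast
  obtain C where C: "\<And>x. (1 + norm x) ^ N * norm (inv_fourier g' x) \<le> C"
    using inv_fourier_rapidly_decreasing[OF g'(1)] by blast
  then show "bounded (range (\<lambda>x. (1 + norm x) ^ N * norm (D \<alpha> (inv_fourier g) x)))"
    unfolding g'(2) by (intro boundedI[of _ C]) auto
qed

section \<open>Schwartz functions and the derivatives applied one at a time\<close>

lemma schwartz_D_rapidly_decreasing:
  fixes \<phi> :: "'n::{finite,linorder} cfun"
  assumes "schwartz \<phi>"
  shows "rapidly_decreasing (D \<alpha> \<phi>)"
  unfolding rapidly_decreasing_def
proof (intro conjI allI)
  have "D \<alpha> \<phi> differentiable_on UNIV" using assms by (auto simp: schwartz_def smooth_def D_def)
  then show "continuous_on UNIV (D \<alpha> \<phi>)" by (rule differentiable_imp_continuous_on)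
  fix N
  have "bounded (range (\<lambda>x. (1 + norm x) ^ N * norm (D \<alpha> \<phi> x)))" using assms by (auto simp: schwartz_def)
  then obtain C where "\<And>x. norm ((1 + norm x) ^ N * norm (D \<alpha> \<phi> x)) \<le> C" by (auto simp: bounded_iff)
  then show "\<exists>C. \<forall>x. (1 + norm x) ^ N * norm (D \<alpha> \<phi> x) \<le> C"
    by (metis abs_le_D1 real_norm_def)
qed

text \<open>\<open>D\<close> applies the directions from the last to the first in the fixed order,
  so every intermediate stage of its evaluation, a suffix preceded by part of one block, is itself
  \<open>D\<close> of some multi-index. Through this the Schwartz bounds cover the intermediate
  stages.\<close>

lemma partials_eq_D:
  fixes \<phi> :: "'n::{finite,linorder} cfun"
  assumes "sorted_list_of_set UNIV = ys @ i # xs"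
  shows "partials (replicate k i @ concat (map (\<lambda>l. replicate (\<alpha> $ l) l) xs)) \<phi>
    = D (\<chi> l. if l = i then k else if l \<in> set xs then \<alpha> $ l else 0) \<phi>"
proof -
  define \<beta> where "\<beta> = ((\<chi> l. if l = i then k else if l \<in> set xs then \<alpha> $ l else 0) :: (nat, 'n) vec)"
  have dist: "distinct (ys @ i # xs)" using assms by (metis distinct_sorted_list_of_set)
  then have "\<forall>l\<in>set ys. \<beta> $ l = 0" "\<forall>l\<in>set xs. \<beta> $ l = \<alpha> $ l" "\<beta> $ i = k" by (auto simp: \<beta>_def)
  then have eqs: "concat (map (\<lambda>l. replicate (\<beta> $ l) l) ys) = []"
    "map (\<lambda>l. replicate (\<beta> $ l) l) xs = map (\<lambda>l. replicate (\<alpha> $ l) l) xs" "\<beta> $ i = k"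
    by auto
  show ?thesis
    unfolding D_def assms \<beta>_def[symmetric] by (simp only: map_append concat_append list.map concat.simps eqs append_Nil)
qed

lemma smooth_partial_has_vector_derivative:
  assumes "smooth \<phi>"
  shows "((\<lambda>t. partials is \<phi> (x + t *\<^sub>R axis i 1)) has_vector_derivative partials (i # is) \<phi> x) (at 0)"
proof -
  have "partials is \<phi> differentiable at x"
    using assms by (auto simp: smooth_def differentiable_on_def)
  then obtain f' where "(partials is \<phi> has_derivative f') (at x)" by (auto simp: differentiable_def)
  from partial_deriv_of_has_derivative[OF this, of i] show ?thesis by (simp add: partials_def)
qed

lemma pure_rd_schwartz:
  fixes \<phi> :: "'n::{finite,linorder} cfun"
  assumes "schwartz \<phi>"
  shows "pure_rd \<phi>"
  unfolding pure_rd_def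
proof
  fix i :: 'n
  obtain ys xs where s: "sorted_list_of_set UNIV = ys @ i # xs"
    using split_list[of i "sorted_list_of_set UNIV"] by auto
  define G where "G m = partials (replicate m i) \<phi>" for m
  have "rapidly_decreasing (G m)" for m
  proof -
    have c: "concat (map (\<lambda>l. replicate ((0 :: (nat, 'n) vec) $ l) l) xs) = []" by simp
    from partials_eq_D[OF s, of m 0 \<phi>] obtain \<beta> where "partials (replicate m i) \<phi> = D \<beta> \<phi>"
      unfolding c append_Nil2 by blast
    then show ?thesis
      using schwartz_D_rapidly_decreasing[OF assms, of \<beta>] by (simp add: G_def)
  qed
  moreover have "((\<lambda>t. G m (x + t *\<^sub>R axis i 1)) has_vector_derivative G (Suc m) x) (at 0)" for m x
    using smooth_partial_has_vector_derivative[of \<phi> "replicate m i" x i] assms by (simp add: G_def schwartz_def)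
  moreover have "G 0 = \<phi>" by (simp add: G_def partials_def)
  ultimately show "\<exists>G. G 0 = \<phi> \<and> (\<forall>m. rapidly_decreasing (G m) \<and>
     (\<forall>x. ((\<lambda>t. G m (x + t *\<^sub>R axis i 1)) has_vector_derivative G (Suc m) x) (at 0)))"
    by blast
qed

lemma schwartz_inv_fourier: "schwartz \<phi> \<Longrightarrow> schwartz (inv_fourier \<phi>)"
  by (intro schwartz_inv_fourier_pure_rd pure_rd_schwartz)

text \<open>The outermost derivative is removed first; what remains is again a derivative of the
  form \<open>D\<close>, hence rapidly decreasing, so the one-derivative rule applies at each
  stage.\<close>

lemma inv_fourier_D:
  fixes \<phi> :: "'n::{finite,linorder} cfun"
  assumes "schwartz \<phi>"
  shows "inv_fourier (D \<alpha> \<phi>) x = (\<Prod>i\<in>UNIV. (- \<i> * of_real (x $ i)) ^ (\<alpha> $ i)) * inv_fourier \<phi> x"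
proof -
  let ?L = "\<lambda>xs. concat (map (\<lambda>l. replicate (\<alpha> $ l) l) xs)"
  have main: "sorted_list_of_set UNIV = ys @ xs \<Longrightarrow>
    inv_fourier (partials (?L xs) \<phi>) x = (\<Prod>i\<in>set xs. (- \<i> * of_real (x $ i)) ^ (\<alpha> $ i)) * inv_fourier \<phi> x" for xs ys
  proof (induction xs arbitrary: ys)
    case Nil
    then show ?case by (simp add: partials_def)
  next
    case (Cons i xs)
    have dist: "distinct (ys @ i # xs)" using Cons.prems by (metis distinct_sorted_list_of_set)
    have "inv_fourier (partials (replicate k i @ ?L xs) \<phi>) x = (- \<i> * of_real (x $ i)) ^ k * inv_fourier (partials (?L xs) \<phi>) x" for k
    proof (induction k)
      case (Suc k)
      have rd: "rapidly_decreasing (partials (replicate k i @ ?L xs) \<phi>)" for k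
        unfolding partials_eq_D[OF Cons.prems] by (rule schwartz_D_rapidly_decreasing[OF assms])
      have "inv_fourier (partials (replicate (Suc k) i @ ?L xs) \<phi>) x = - \<i> * of_real (x $ i) * inv_fourier (partials (replicate k i @ ?L xs) \<phi>) x"
        by (rule inv_fourier_partial[OF rd rd])
           (use smooth_partial_has_vector_derivative[of \<phi> "replicate k i @ ?L xs"] assms in \<open>auto simp: schwartz_def\<close>)
      then show ?case using Suc by (simp add: mult_ac)
    qed simp
    moreover have "inv_fourier (partials (?L xs) \<phi>) x = (\<Prod>i\<in>set xs. (- \<i> * of_real (x $ i)) ^ (\<alpha> $ i)) * inv_fourier \<phi> x"
      by (rule Cons.IH[of "ys @ [i]"]) (use Cons.prems in simp)
    ultimately show ?case using dist by (simp add: mult.assoc)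
  qed
  show ?thesis using main[of "[]" "sorted_list_of_set UNIV"] by (simp add: D_def)
qed


section \<open>Fourier multipliers and the resolvent\<close>

text \<open>The transpose of the multiplier with symbol \<open>M\<close>: since operations on
  distributions are defined by duality, pairing g with \<open>multiplier M \<phi>\<close> is the
  value at \<phi> of the multiplier applied to g.\<close>

definition multiplier :: "'n::finite cfun \<Rightarrow> 'n cfun \<Rightarrow> 'n cfun" where
  "multiplier M \<phi> = fourier (\<lambda>\<xi>. M \<xi> * inv_fourier \<phi> \<xi>)"

text \<open>Spreading the character over the coordinates keeps the modulated test function a tensor
  product, so it remains within the class of test functions in use.\<close>

definition modulated :: "real ^ 'n::finite \<Rightarrow> ('n \<Rightarrow> real \<Rightarrow> complex) \<Rightarrow> 'n \<Rightarrow> real \<Rightarrow> complex" where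
  "modulated \<eta> g l t = cis (- (\<eta> $ l * t)) * g l t"

text \<open>Conjugation by the plane wave on the test side. By transposition it corresponds to the
  operator P of the overview when the symbol is that of the regularised resolvent.\<close>

definition modulated_multiplier :: "real ^ 'n::finite \<Rightarrow> 'n cfun \<Rightarrow> ('n \<Rightarrow> real \<Rightarrow> complex) \<Rightarrow> 'n cfun" where
  "modulated_multiplier \<eta> M g x = cis (\<eta> \<bullet> x) * multiplier M (tensor (modulated \<eta> g)) x"

lemma cis_sum: "finite A \<Longrightarrow> cis (\<Sum>i\<in>A. f i) = (\<Prod>i\<in>A. cis (f i))"
  by (induction A rule: finite_induct) (auto simp: cis_mult[symmetric])

lemma tensor_modulated: "tensor (modulated \<eta> g) x = cis (- (\<eta> \<bullet> x)) * tensor g x"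
proof -
  have "cis (- (\<eta> \<bullet> x)) = (\<Prod>l\<in>UNIV. cis (- (\<eta> $ l * x $ l)))"
    by (simp add: inner_vec_def sum_negf[symmetric] cis_sum)
  then show ?thesis by (simp add: tensor_def modulated_def prod.distrib)
qed

lemma test_modulated: "test a b g \<Longrightarrow> test a b (modulated \<eta> g)"
  unfolding test_def modulated_def[abs_def]
  using test1_mult_cis[of _ _ _ "- \<eta> $ _"] by auto

lemma inner_shift: "\<xi> \<bullet> (y + s *\<^sub>R axis i 1) = \<xi> \<bullet> y + s * \<xi> $ i"
  "\<xi> \<bullet> (y - s *\<^sub>R axis i 1) = \<xi> \<bullet> y - s * \<xi> $ i"
  by (simp_all add: inner_add_right inner_diff_right inner_axis)

lemma continuous_on_inv_fourier_schwartz: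
  fixes \<phi> :: "'n::{finite,linorder} cfun"
  assumes "schwartz \<phi>"
  shows "continuous_on UNIV (inv_fourier \<phi>)" "integrable lborel (inv_fourier \<phi>)"
  using pure_rd_rapidly_decreasing[OF pure_rd_schwartz[OF schwartz_inv_fourier[OF assms]]] rapidly_decreasing_integrable
  by (auto simp: rapidly_decreasing_def)

text \<open>A Fourier multiplier conjugated by a plane wave commutes with translations, hence also with
  averaging over segments and with differences.\<close>
lemma multiplier_translation:
  fixes g :: "'n::{finite,linorder} \<Rightarrow> real \<Rightarrow> complex" and i :: 'n and \<eta> :: "(real, 'n) vec"
  assumes g: "test a b g" and h: "h \<ge> 0"
    and M [measurable]: "M \<in> borel_measurable borel" and C: "\<And>\<xi>. norm (M \<xi>) \<le> C"
  defines "g' \<equiv> g(i := \<lambda>t. LINT s:{0..h}|lborel. g i (t - s))"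
  defines "g'' \<equiv> g'(i := vderiv (g' i))"
  defines "\<Phi> \<equiv> modulated_multiplier \<eta> M"
  shows "\<Phi> g \<in> borel_measurable borel" "\<exists>B. \<forall>x. norm (\<Phi> g x) \<le> B"
    "\<Phi> g'' x = \<Phi> g x - \<Phi> g (x - h *\<^sub>R axis i 1)"
    "\<Phi> g' x = (LINT t:{0..h}|lborel. \<Phi> g (x - t *\<^sub>R axis i 1))"
proof -
  let ?e = "axis i 1 :: (real, 'n) vec"
  note avg = test_average[OF g h, of i, folded g'_def, folded g''_def]
  define G where "G = inv_fourier (tensor (modulated \<eta> g))"
  have sch: "schwartz (tensor (modulated \<eta> g))"
    by (rule schwartz_tensor[OF test_modulated[OF g]])
  have G_int: "integrable lborel G" and G_cont: "continuous_on UNIV G"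
    using continuous_on_inv_fourier_schwartz[OF sch] by (auto simp: G_def)
  have [measurable]: "G \<in> borel_measurable borel" using G_cont by (rule borel_measurable_continuous_onI)
  have MG_int: "integrable lborel (\<lambda>\<xi>. M \<xi> * G \<xi>)"
    using integrable_mult_bounded[OF G_int M C] by (simp add: mult.commute)
  have [measurable]: "(\<lambda>\<xi>. cis (x \<bullet> \<xi> + c)) \<in> borel_measurable borel"
    "(\<lambda>\<xi>. cis (- (x \<bullet> \<xi>))) \<in> borel_measurable borel" "(\<lambda>\<xi>. cis (x \<bullet> \<xi>)) \<in> borel_measurable borel" for x :: "(real, 'n) vec" and c
    by (intro borel_measurable_continuous_onI continuous_intros)+
  have [measurable]: "tensor g \<in> borel_measurable borel"
    by (rule tensor_measurable) (rule test_smooth1[OF g])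
  have \<Phi>_g: "\<Phi> g x = cis (\<eta> \<bullet> x) * (LINT \<xi>|lborel. cis (- (x \<bullet> \<xi>)) * (M \<xi> * G \<xi>))" for x
    by (simp add: \<Phi>_def modulated_multiplier_def multiplier_def fourier_def G_def)
  \<comment> \<open>Translating the output by \<open>s\<close> inserts the phase s (\<xi>_i -
    \<eta>_i): the first part comes from the Fourier kernel, the second compensates the outer plane
    wave.\<close>
  have \<Phi>_shift: "\<Phi> g (x - s *\<^sub>R ?e) = cis (\<eta> \<bullet> x) * (LINT \<xi>|lborel. cis (- (x \<bullet> \<xi>)) * (M \<xi> * (cis (s * (\<xi> $ i - \<eta> $ i)) * G \<xi>)))" for x s
  proof -
    have eq1: "cis (- ((x - s *\<^sub>R ?e) \<bullet> \<xi>)) * (M \<xi> * G \<xi>) = cis (s * \<eta> $ i) * (cis (- (x \<bullet> \<xi>)) * (M \<xi> * (cis (s * (\<xi> $ i - \<eta> $ i)) * G \<xi>)))" for \<xi>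
    proof -
      have "cis (- ((x - s *\<^sub>R ?e) \<bullet> \<xi>)) = cis (s * \<eta> $ i) * cis (- (x \<bullet> \<xi>)) * cis (s * (\<xi> $ i - \<eta> $ i))"
        unfolding cis_mult inner_commute[of _ \<xi>] inner_shift by (simp add: algebra_simps)
      then show ?thesis by simp
    qed
    have "\<Phi> g (x - s *\<^sub>R ?e) = cis (\<eta> \<bullet> x - s * \<eta> $ i) * (cis (s * \<eta> $ i) * (LINT \<xi>|lborel. cis (- (x \<bullet> \<xi>)) * (M \<xi> * (cis (s * (\<xi> $ i - \<eta> $ i)) * G \<xi>))))"
      unfolding \<Phi>_g inner_shift eq1 integral_mult_right_zero ..
    also have "cis (\<eta> \<bullet> x - s * \<eta> $ i) * cis (s * \<eta> $ i) = cis (\<eta> \<bullet> x)" by (simp add: cis_mult)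
    then have "cis (\<eta> \<bullet> x - s * \<eta> $ i) * (cis (s * \<eta> $ i) * z) = cis (\<eta> \<bullet> x) * z" for z by (metis mult.assoc)
    finally show ?thesis .
  qed
  have [measurable]: "(\<lambda>x. LINT \<xi>|lborel. cis (- (x \<bullet> \<xi>)) * (M \<xi> * G \<xi>)) \<in> borel_measurable borel"
  proof -
    have "(\<lambda>(x, \<xi>). cis (- (x \<bullet> \<xi>))) \<in> borel_measurable (borel \<Otimes>\<^sub>M borel :: (((real, 'n) vec) \<times> ((real, 'n) vec)) measure)"
      unfolding borel_prod by (intro borel_measurable_continuous_onI) (auto intro!: continuous_intros simp: case_prod_beta)
    then have [measurable]: "(\<lambda>(x, \<xi>). cis (- (x \<bullet> \<xi>))) \<in> borel_measurable (lborel \<Otimes>\<^sub>M lborel :: (((real, 'n) vec) \<times> ((real, 'n) vec)) measure)"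
      by (simp cong: measurable_cong_sets sets_pair_measure_cong)
    have "(\<lambda>x. LINT \<xi>|lborel. cis (- (x \<bullet> \<xi>)) * (M \<xi> * G \<xi>)) \<in> borel_measurable lborel" by measurable
    then show ?thesis by simp
  qed
  show "\<Phi> g \<in> borel_measurable borel"
    unfolding \<Phi>_g[abs_def] by measurable
  have nb: "norm (\<Phi> g x) \<le> (LINT \<xi>|lborel. norm (M \<xi> * G \<xi>))" for x
  proof -
    have "norm (LINT \<xi>|lborel. cis (- (x \<bullet> \<xi>)) * (M \<xi> * G \<xi>)) \<le> (LINT \<xi>|lborel. norm (cis (- (x \<bullet> \<xi>)) * (M \<xi> * G \<xi>)))"
      by (rule integral_norm_bound)
    then show ?thesis unfolding \<Phi>_g by (simp add: norm_mult)
  qed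
  then show "\<exists>B. \<forall>x. norm (\<Phi> g x) \<le> B" by blast
  have tensor_int: "integrable lborel (tensor g)" by (rule tensor_integrable[OF g])
  \<comment> \<open>Translating the test function before modulation inserts the same phase into its
    inverse transform; the agreement of the two phases is the commutation with translations.\<close>
  have shifted: "(LINT y|lborel. cis (\<xi> \<bullet> y) * (cis (- (\<eta> \<bullet> y)) * tensor g (y - s *\<^sub>R ?e))) / (2 * pi) ^ CARD('n)
      = cis (s * (\<xi> $ i - \<eta> $ i)) * G \<xi>" for \<xi> s
  proof -
    have "(LINT y|lborel. cis (\<xi> \<bullet> y) * (cis (- (\<eta> \<bullet> y)) * tensor g (y - s *\<^sub>R ?e)))
        = (LINT y|lborel. cis (\<xi> \<bullet> (y + s *\<^sub>R ?e)) * (cis (- (\<eta> \<bullet> (y + s *\<^sub>R ?e))) * tensor g y))"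
      using integral_translate[of "\<lambda>y. cis (\<xi> \<bullet> y) * (cis (- (\<eta> \<bullet> y)) * tensor g (y - s *\<^sub>R ?e))" "s *\<^sub>R ?e"] by simp
    also have "\<dots> = (LINT y|lborel. cis (s * (\<xi> $ i - \<eta> $ i)) * (cis (\<xi> \<bullet> y) * (cis (- (\<eta> \<bullet> y)) * tensor g y)))"
    proof (rule Bochner_Integration.integral_cong[OF refl])
      fix y
      have "cis (\<xi> \<bullet> (y + s *\<^sub>R ?e)) * cis (- (\<eta> \<bullet> (y + s *\<^sub>R ?e))) = cis (s * (\<xi> $ i - \<eta> $ i)) * cis (\<xi> \<bullet> y) * cis (- (\<eta> \<bullet> y))"
        unfolding cis_mult inner_shift by (simp add: algebra_simps)
      then show "cis (\<xi> \<bullet> (y + s *\<^sub>R ?e)) * (cis (- (\<eta> \<bullet> (y + s *\<^sub>R ?e))) * tensor g y)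
        = cis (s * (\<xi> $ i - \<eta> $ i)) * (cis (\<xi> \<bullet> y) * (cis (- (\<eta> \<bullet> y)) * tensor g y))"
        by (simp only: mult.assoc[symmetric])
    qed
    also have "\<dots> = cis (s * (\<xi> $ i - \<eta> $ i)) * (LINT y|lborel. cis (\<xi> \<bullet> y) * (cis (- (\<eta> \<bullet> y)) * tensor g y))"
      by simp
    finally show ?thesis by (simp add: G_def inv_fourier_def tensor_modulated)
  qed
  have int_y: "integrable lborel (\<lambda>y. cis (\<xi> \<bullet> y) * (cis (- (\<eta> \<bullet> y)) * tensor g (y - s *\<^sub>R ?e)))" for \<xi> s
  proof -
    have i1: "integrable lborel (\<lambda>y. tensor g (y - s *\<^sub>R ?e))"
      using integrable_translate[OF tensor_int, of "- s *\<^sub>R ?e"] by simp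
    have "integrable lborel (\<lambda>y. tensor g (y - s *\<^sub>R ?e) * (cis (\<xi> \<bullet> y) * cis (- (\<eta> \<bullet> y))))"
      by (rule integrable_mult_bounded[OF i1, of _ 1]) (auto simp: norm_mult)
    then show ?thesis by (simp add: mult_ac)
  qed
  have int_\<xi>: "integrable lborel (\<lambda>\<xi>. cis (- (x \<bullet> \<xi>)) * (M \<xi> * (cis (s * (\<xi> $ i - \<eta> $ i)) * G \<xi>)))" for x s
  proof -
    have [measurable]: "(\<lambda>\<xi>::(real, 'n) vec. cis (s * (\<xi> $ i - \<eta> $ i))) \<in> borel_measurable borel"
      by (intro borel_measurable_continuous_onI continuous_intros)
    have "integrable lborel (\<lambda>\<xi>. (M \<xi> * G \<xi>) * (cis (- (x \<bullet> \<xi>)) * cis (s * (\<xi> $ i - \<eta> $ i))))"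
      by (rule integrable_mult_bounded[OF MG_int, of _ 1]) (auto simp: norm_mult)
    then show ?thesis by (simp add: mult_ac)
  qed
  have "inv_fourier (tensor (modulated \<eta> g'')) \<xi> = G \<xi> - cis (h * (\<xi> $ i - \<eta> $ i)) * G \<xi>" for \<xi>
  proof -
    have "inv_fourier (tensor (modulated \<eta> g'')) \<xi>
        = (LINT y|lborel. cis (\<xi> \<bullet> y) * (cis (- (\<eta> \<bullet> y)) * tensor g (y - 0 *\<^sub>R ?e))
           - cis (\<xi> \<bullet> y) * (cis (- (\<eta> \<bullet> y)) * tensor g (y - h *\<^sub>R ?e))) / (2 * pi) ^ CARD('n)"
      by (simp add: inv_fourier_def tensor_modulated avg(3) right_diff_distrib)
    also have "\<dots> = cis (0 * (\<xi> $ i - \<eta> $ i)) * G \<xi> - cis (h * (\<xi> $ i - \<eta> $ i)) * G \<xi>"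
      by (subst Bochner_Integration.integral_diff[OF int_y int_y]) (simp only: diff_divide_distrib shifted)
    finally show ?thesis by simp
  qed
  then have "\<Phi> g'' x = cis (\<eta> \<bullet> x) * (LINT \<xi>|lborel. cis (- (x \<bullet> \<xi>)) * (M \<xi> * (cis (0 * (\<xi> $ i - \<eta> $ i)) * G \<xi>))
      - cis (- (x \<bullet> \<xi>)) * (M \<xi> * (cis (h * (\<xi> $ i - \<eta> $ i)) * G \<xi>)))"
    by (simp add: \<Phi>_def modulated_multiplier_def multiplier_def fourier_def right_diff_distrib)
  also have "\<dots> = \<Phi> g (x - 0 *\<^sub>R ?e) - \<Phi> g (x - h *\<^sub>R ?e)"
    by (subst Bochner_Integration.integral_diff[OF int_\<xi> int_\<xi>]) (simp only: right_diff_distrib \<Phi>_shift)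
  finally show "\<Phi> g'' x = \<Phi> g x - \<Phi> g (x - h *\<^sub>R ?e)" by simp
  have [measurable]: "(\<lambda>(t, \<xi>::(real, 'n) vec). cis (t * (\<xi> $ i - \<eta> $ i))) \<in> borel_measurable (lborel \<Otimes>\<^sub>M lborel)"
  proof -
    have "(\<lambda>(t, \<xi>::(real, 'n) vec). cis (t * (\<xi> $ i - \<eta> $ i))) \<in> borel_measurable (borel \<Otimes>\<^sub>M borel)"
      unfolding borel_prod by (intro borel_measurable_continuous_onI) (auto intro!: continuous_intros simp: case_prod_beta)
    then show ?thesis by (simp cong: measurable_cong_sets sets_pair_measure_cong)
  qed
  have G': "inv_fourier (tensor (modulated \<eta> g')) \<xi> = (LINT t:{0..h}|lborel. cis (t * (\<xi> $ i - \<eta> $ i)) * G \<xi>)" for \<xi>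
  proof -
    have "inv_fourier (tensor (modulated \<eta> g')) \<xi>
        = (LINT y|lborel. (LINT t:{0..h}|lborel. cis (\<xi> \<bullet> y) * (cis (- (\<eta> \<bullet> y)) * tensor g (y - t *\<^sub>R ?e)))) / (2 * pi) ^ CARD('n)"
      by (simp add: inv_fourier_def tensor_modulated avg(2))
    also have "(LINT y|lborel. (LINT t:{0..h}|lborel. cis (\<xi> \<bullet> y) * (cis (- (\<eta> \<bullet> y)) * tensor g (y - t *\<^sub>R ?e))))
      = (LINT t:{0..h}|lborel. (LINT y|lborel. cis (\<xi> \<bullet> y) * (cis (- (\<eta> \<bullet> y)) * tensor g (y - t *\<^sub>R ?e))))"
    proof (rule fubini_segment(1)[OF _ int_y])
      show "(\<lambda>(t, y). cis (\<xi> \<bullet> y) * (cis (- (\<eta> \<bullet> y)) * tensor g (y - t *\<^sub>R ?e))) \<in> borel_measurable (lborel \<Otimes>\<^sub>M lborel)"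
        by measurable
      show "(LINT y|lborel. norm (cis (\<xi> \<bullet> y) * (cis (- (\<eta> \<bullet> y)) * tensor g (y - t *\<^sub>R ?e)))) \<le> (LINT y|lborel. norm (tensor g y))" for t
        using integral_translate[of "\<lambda>y. norm (tensor g y)" "- t *\<^sub>R ?e"] by (simp add: norm_mult)
    qed
    also have "\<dots> / (2 * pi) ^ CARD('n) = (LINT t:{0..h}|lborel. (LINT y|lborel. cis (\<xi> \<bullet> y) * (cis (- (\<eta> \<bullet> y)) * tensor g (y - t *\<^sub>R ?e))) / (2 * pi) ^ CARD('n))"
      by simp
    also have "\<dots> = (LINT t:{0..h}|lborel. cis (t * (\<xi> $ i - \<eta> $ i)) * G \<xi>)"
      by (simp only: shifted)
    finally show ?thesis .
  qed
  have "\<Phi> g' x = cis (\<eta> \<bullet> x) * (LINT \<xi>|lborel. (LINT t:{0..h}|lborel. cis (- (x \<bullet> \<xi>)) * (M \<xi> * (cis (t * (\<xi> $ i - \<eta> $ i)) * G \<xi>))))"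
    by (simp add: \<Phi>_def modulated_multiplier_def multiplier_def fourier_def G')
  also have "(LINT \<xi>|lborel. (LINT t:{0..h}|lborel. cis (- (x \<bullet> \<xi>)) * (M \<xi> * (cis (t * (\<xi> $ i - \<eta> $ i)) * G \<xi>))))
      = (LINT t:{0..h}|lborel. (LINT \<xi>|lborel. cis (- (x \<bullet> \<xi>)) * (M \<xi> * (cis (t * (\<xi> $ i - \<eta> $ i)) * G \<xi>))))"
  proof (rule fubini_segment(1)[OF _ int_\<xi>])
    show "(\<lambda>(t, \<xi>). cis (- (x \<bullet> \<xi>)) * (M \<xi> * (cis (t * (\<xi> $ i - \<eta> $ i)) * G \<xi>))) \<in> borel_measurable (lborel \<Otimes>\<^sub>M lborel)"
      by measurable
    show "(LINT \<xi>|lborel. norm (cis (- (x \<bullet> \<xi>)) * (M \<xi> * (cis (t * (\<xi> $ i - \<eta> $ i)) * G \<xi>)))) \<le> (LINT \<xi>|lborel. norm (M \<xi> * G \<xi>))" for t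
      by (simp add: norm_mult)
  qed
  also have "cis (\<eta> \<bullet> x) * \<dots> = (LINT t:{0..h}|lborel. \<Phi> g (x - t *\<^sub>R ?e))"
    by (simp add: \<Phi>_shift)
  finally show "\<Phi> g' x = (LINT t:{0..h}|lborel. \<Phi> g (x - t *\<^sub>R ?e))" .
qed

text \<open>For each \<epsilon> > 0 the operator acts on the test side, where it commutes with
  difference and average, so the pairings for \<open>w\<close> and \<open>w'\<close> satisfy an
  exact identity. Since it is exact, the bound \<open>C \<epsilon>\<close> may blow up as \<epsilon>
  \<rightarrow> 0; only the two tested limits are taken. The tests are modulated because the limits
  are known for \<open>r\<close> and \<open>r'\<close> without the plane wave removed.\<close>

lemma weak_deriv_multiplier_limit:
  fixes w w' r r' :: "'n::{finite,linorder} cfun" and M :: "real \<Rightarrow> 'n cfun"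
  assumes weak_deriv: "weak_deriv i w w'" and w: "integrable lborel w" "integrable lborel w'"
    and r: "locally_integrable r" "locally_integrable r'"
    and M: "\<And>\<epsilon>. \<epsilon> > 0 \<Longrightarrow> M \<epsilon> \<in> borel_measurable borel" "\<And>\<epsilon> \<xi>. \<epsilon> > 0 \<Longrightarrow> norm (M \<epsilon> \<xi>) \<le> C \<epsilon>"
    and lim: "\<And>a b g. test a b g \<Longrightarrow> ((\<lambda>\<epsilon>. LINT x|lborel. (cis (\<eta> \<bullet> x) * w x) * multiplier (M \<epsilon>) (tensor g) x)
        \<longlongrightarrow> (LINT x|lborel. r x * tensor g x)) (at_right 0)"
      "\<And>a b g. test a b g \<Longrightarrow> ((\<lambda>\<epsilon>. LINT x|lborel. (cis (\<eta> \<bullet> x) * w' x) * multiplier (M \<epsilon>) (tensor g) x)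
        \<longlongrightarrow> (LINT x|lborel. r' x * tensor g x)) (at_right 0)"
  shows "weak_deriv i (\<lambda>x. cis (- (\<eta> \<bullet> x)) * r x) (\<lambda>x. cis (- (\<eta> \<bullet> x)) * r' x)"
proof (rule weak_derivI_bump)
  have [measurable]: "(\<lambda>x. cis (- (\<eta> \<bullet> x))) \<in> borel_measurable borel"
    by (intro borel_measurable_continuous_onI continuous_intros)
  show "locally_integrable (\<lambda>x. cis (- (\<eta> \<bullet> x)) * r x)" "locally_integrable (\<lambda>x. cis (- (\<eta> \<bullet> x)) * r' x)"
    by (rule locally_integrable_mult_bounded[where B = 1]; simp add: r)+
  fix a b :: "(real, 'n) vec" and c h :: real assume c: "c > 0" and h: "h > 0"
  let ?e = "axis i 1 :: (real, 'n) vec"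
  let ?g = "bump c a b"
  define g' where "g' = ?g(i := \<lambda>t. LINT s:{0..h}|lborel. ?g i (t - s))"
  define g'' where "g'' = g'(i := vderiv (g' i))"
  note t = test_bump[OF c, of a b]
  note avg = test_average[OF t less_imp_le[OF h], of i, folded g'_def, folded g''_def]
  have t'': "test a (b + h *\<^sub>R ?e) g''"
    unfolding test_def
  proof
    fix l
    have "test1 (a $ l) ((b + h *\<^sub>R ?e) $ l) (g' l)" using avg(1) by (simp add: test_def)
    then show "test1 (a $ l) ((b + h *\<^sub>R ?e) $ l) (g'' l)"
      by (cases "l = i") (simp_all add: g''_def test1_vderiv)
  qed
  have eq: "(LINT x|lborel. (cis (\<eta> \<bullet> x) * w x) * multiplier (M \<epsilon>) (tensor (modulated \<eta> g'')) x)
      = - (LINT x|lborel. (cis (\<eta> \<bullet> x) * w' x) * multiplier (M \<epsilon>) (tensor (modulated \<eta> g')) x)" if \<epsilon>: "\<epsilon> > 0" for \<epsilon>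
  proof -
    define \<Phi> where "\<Phi> = modulated_multiplier \<eta> (M \<epsilon>)"
    note tr12 = multiplier_translation(1,2)[OF t less_imp_le[OF h] M(1)[OF \<epsilon>] M(2)[OF \<epsilon>], where \<eta> = \<eta>,
        folded \<Phi>_def]
    note tr34 = multiplier_translation(3,4)[OF t less_imp_le[OF h] M(1)[OF \<epsilon>] M(2)[OF \<epsilon>], where i = i and \<eta> = \<eta>,
        folded g'_def, folded g''_def, folded \<Phi>_def]
    obtain B where B: "\<And>x. norm (\<Phi> ?g x) \<le> B" using tr12(2) by blast
    have "(LINT x|lborel. (cis (\<eta> \<bullet> x) * w x) * multiplier (M \<epsilon>) (tensor (modulated \<eta> g'')) x) = (LINT x|lborel. w x * \<Phi> g'' x)"
      by (simp add: \<Phi>_def modulated_multiplier_def mult_ac)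
    also have "\<dots> = - (LINT x|lborel. w x * (\<Phi> ?g (x - h *\<^sub>R ?e) - \<Phi> ?g x))"
      unfolding tr34(1) integral_minus[symmetric] by (simp add: algebra_simps)
    also have "\<dots> = - (LINT x|lborel. w' x * \<Phi> g' x)"
      unfolding tr34(2) by (simp only: integral_weak_deriv_adjoint[OF weak_deriv w tr12(1) B h])
    also have "\<dots> = - (LINT x|lborel. (cis (\<eta> \<bullet> x) * w' x) * multiplier (M \<epsilon>) (tensor (modulated \<eta> g')) x)"
      by (simp add: \<Phi>_def modulated_multiplier_def mult_ac)
    finally show ?thesis .
  qed
  have "((\<lambda>\<epsilon>. - (LINT x|lborel. (cis (\<eta> \<bullet> x) * w' x) * multiplier (M \<epsilon>) (tensor (modulated \<eta> g')) x))
      \<longlongrightarrow> (LINT x|lborel. r x * tensor (modulated \<eta> g'') x)) (at_right 0)"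
    by (rule Lim_transform_eventually[OF lim(1)[OF test_modulated[OF t'']]])
       (auto intro!: eventually_mono[OF eventually_at_right_less[of 0]] eq)
  moreover have "((\<lambda>\<epsilon>. - (LINT x|lborel. (cis (\<eta> \<bullet> x) * w' x) * multiplier (M \<epsilon>) (tensor (modulated \<eta> g')) x))
      \<longlongrightarrow> - (LINT x|lborel. r' x * tensor (modulated \<eta> g') x)) (at_right 0)"
    by (rule tendsto_minus[OF lim(2)[OF test_modulated[OF avg(1)]]])
  ultimately have lim_eq: "(LINT x|lborel. r x * tensor (modulated \<eta> g'') x) = - (LINT x|lborel. r' x * tensor (modulated \<eta> g') x)"
    by (rule tendsto_unique[rotated]) simp
  have "(LINT x|lborel. cis (- (\<eta> \<bullet> x)) * r x * (tensor ?g (x - h *\<^sub>R ?e) - tensor ?g x))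
      = - (LINT x|lborel. r x * tensor (modulated \<eta> g'') x)"
    unfolding tensor_modulated avg(3) integral_minus[symmetric] by (simp add: algebra_simps)
  also have "\<dots> = (LINT x|lborel. cis (- (\<eta> \<bullet> x)) * r' x * (LINT t:{0..h}|lborel. tensor ?g (x - t *\<^sub>R ?e)))"
    using lim_eq unfolding tensor_modulated avg(2) by (simp add: mult_ac)
  finally show "(LINT x|lborel. cis (- (\<eta> \<bullet> x)) * r x * (tensor ?g (x - h *\<^sub>R ?e) - tensor ?g x))
      = (LINT x|lborel. cis (- (\<eta> \<bullet> x)) * r' x * (LINT t:{0..h}|lborel. tensor ?g (x - t *\<^sub>R ?e)))" .
qed

section \<open>The regularised resolvent and its limit\<close>

definition resolvent_symbol :: "real \<Rightarrow> real \<Rightarrow> 'n::finite cfun" where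
  "resolvent_symbol k \<epsilon> \<xi> = 1 / (complex_of_real (- (norm \<xi>)\<^sup>2 + k\<^sup>2) + \<i> * complex_of_real \<epsilon>)"

lemma resolvent_symbol_measurable: "resolvent_symbol k \<epsilon> \<in> borel_measurable borel"
  unfolding resolvent_symbol_def[abs_def] by measurable

lemma norm_resolvent_symbol_le:
  assumes "\<epsilon> > 0"
  shows "norm (resolvent_symbol k \<epsilon> \<xi>) \<le> 1 / \<epsilon>"
proof -
  let ?d = "complex_of_real (- (norm \<xi>)\<^sup>2 + k\<^sup>2) + \<i> * complex_of_real \<epsilon>"
  have "\<epsilon> = \<bar>Im ?d\<bar>" using assms by simp
  also have "\<dots> \<le> norm ?d" by (rule abs_Im_le_cmod)
  finally show ?thesis
    unfolding resolvent_symbol_def norm_divide norm_one using assms by (intro divide_left_mono mult_pos_pos) auto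
qed

lemma resolvent_eps_dist_of:
  "resolvent_eps k \<epsilon> (dist_of g) \<phi> = (LINT x|lborel. g x * multiplier (resolvent_symbol k \<epsilon>) \<phi> x)"
  by (simp add: resolvent_eps_def inv_fourier_dist_def mult_dist_def fourier_dist_def dist_of_def
      multiplier_def resolvent_symbol_def)

lemma resolvent_tendsto:
  assumes "resolvent_exists k T" "schwartz \<phi>"
  shows "((\<lambda>\<epsilon>. resolvent_eps k \<epsilon> T \<phi>) \<longlongrightarrow> resolvent k T \<phi>) (at_right 0)"
proof -
  obtain l where "((\<lambda>\<epsilon>. resolvent_eps k \<epsilon> T \<phi>) \<longlongrightarrow> l) (at_right 0)"
    using assms by (auto simp: resolvent_exists_def)
  then show ?thesis unfolding resolvent_def by (metis tendsto_Lim trivial_limit_at_right_real)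
qed


section \<open>The Born series\<close>

text \<open>The norm in the wavenumber cancels the normalisation of the direction, leaving -\<xi>/2.
  At \<xi> = 0 both sides are 1, because the direction is then 0 by the division convention.\<close>

lemma plane_wave_eq: "plane_wave (wavenumber \<xi>) (direction \<xi>) y = cis ((- (1/2) *\<^sub>R \<xi>) \<bullet> y)"
proof -
  have "wavenumber \<xi> * (direction \<xi> \<bullet> y) = (- (1/2) *\<^sub>R \<xi>) \<bullet> y"
    by (cases "\<xi> = 0") (simp_all add: wavenumber_def direction_def mult.assoc[symmetric])
  then show ?thesis by (simp add: plane_wave_def)
qed

lemma born_defined_append: "born_defined k e (xs @ ys) \<Longrightarrow> ys \<noteq> [] \<Longrightarrow> born_defined k e ys"
proof (induction xs)
  case (Cons x xs)
  then obtain z zs where "xs @ ys = z # zs" by (cases "xs @ ys") auto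
  with Cons show ?case by auto
qed simp

lemma born_defined_ConsD:
  assumes "born_defined k e (f # fs)" "fs \<noteq> []"
  shows "born_defined k e fs" "fR_defined k f (born k e fs)"
  using assms by (cases fs; simp)+

lemma born_defined_locally_integrable:
  assumes "born_defined k e fs"
  shows "locally_integrable (born k e fs)"
  using assms by (induction k e fs rule: born.induct) (auto simp: fR_defined_def)

lemma leibniz_family_cong:
  assumes "leibniz_family m \<alpha> X" "\<And>\<beta>s. length \<beta>s = m \<Longrightarrow> X \<beta>s = Y \<beta>s"
  shows "leibniz_family m \<alpha> Y"
proof -
  have "(\<lambda>x. \<Sum>l<m. Y (raise i l \<beta>s) x) = (\<lambda>x. \<Sum>l<m. X (raise i l \<beta>s) x)" if "length \<beta>s = m" for \<beta>s i
    using assms(2)[of "raise i _ \<beta>s"] that by simp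
  then show ?thesis using assms unfolding leibniz_family_def by (metis (no_types, lifting))
qed

text \<open>One fixed frequency: \<eta> is -\<xi>/2 and \<open>F \<beta>\<close> the function
  representing the \<beta>-th derivative of the potential. The assumption \<open>born\<close> covers
  just the lists of sum exactly \<alpha>; all that is used about shorter lists is derived from
  it.\<close>

locale born_series =
  fixes k :: real and \<eta> :: "(real, 'n::{finite,linorder}) vec" and e :: "'n cfun"
    and \<alpha> :: "(nat, 'n) vec" and F :: "(nat, 'n) vec \<Rightarrow> 'n cfun" and j :: nat and K :: "((real, 'n) vec) set"
  assumes e: "\<And>x. e x = cis (\<eta> \<bullet> x)"
    and F: "leibniz_family 1 \<alpha> (\<lambda>\<beta>s. F (hd \<beta>s))"
    and K: "compact K" and supp: "\<And>\<beta>. \<beta> \<le> \<alpha> \<Longrightarrow> AE x in lborel. x \<notin> K \<longrightarrow> F \<beta> x = 0"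
    and born: "\<And>\<beta>s. length \<beta>s = j \<Longrightarrow> sum_list \<beta>s = \<alpha> \<Longrightarrow> born_defined k e (map F \<beta>s)"
begin

definition R :: "((nat, 'n) vec) list \<Rightarrow> 'n cfun" where
  "R \<beta>s = fun_of (resolvent k (dist_of (born k e (map F \<beta>s))))"

text \<open>This is P applied to \<open>W \<beta>s\<close>: removing the plane wave both before and
  after the resolvent turns the Born product into alternating multiplication by \<open>F\<close> and
  application of P.\<close>

definition U :: "((nat, 'n) vec) list \<Rightarrow> 'n cfun" where
  "U \<beta>s x = cis (- (\<eta> \<bullet> x)) * R \<beta>s x"

definition W :: "((nat, 'n) vec) list \<Rightarrow> 'n cfun" where
  "W \<beta>s x = cis (- (\<eta> \<bullet> x)) * born k e (map F \<beta>s) x"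

lemma cis_cancel: "cis (\<eta> \<bullet> x) * (cis (- (\<eta> \<bullet> x)) * z) = z" "cis (- (\<eta> \<bullet> x)) * (cis (\<eta> \<bullet> x) * z) = z"
  unfolding mult.assoc[symmetric] cis_mult by simp_all

lemma born_eq_W: "born k e (map F \<beta>s) x = cis (\<eta> \<bullet> x) * W \<beta>s x"
  by (simp add: W_def cis_cancel)

lemma W_singleton: "length \<beta>s = 1 \<Longrightarrow> W \<beta>s = F (hd \<beta>s)"
  by (cases \<beta>s) (auto simp: W_def e fun_eq_iff mult.commute[of _ "cis (\<eta> \<bullet> _)"] cis_cancel)

lemma W_Cons: "\<beta>s \<noteq> [] \<Longrightarrow> W (\<beta> # \<beta>s) x = F \<beta> x * U \<beta>s x"
  by (cases \<beta>s) (auto simp: W_def U_def R_def fR_def mult_ac)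

lemma measurable_cis_inner [measurable]: "(\<lambda>x. cis (- (\<zeta> \<bullet> x))) \<in> borel_measurable borel" "(\<lambda>x. cis (\<zeta> \<bullet> x)) \<in> borel_measurable borel"
  by (intro borel_measurable_continuous_onI continuous_intros)+

lemma tail_defined:
  assumes "\<beta>s \<noteq> []" "length \<beta>s < j" "sum_list \<beta>s \<le> \<alpha>"
  shows "born_defined k e (map F \<beta>s)" "resolvent_exists k (dist_of (born k e (map F \<beta>s)))"
    "regular (resolvent k (dist_of (born k e (map F \<beta>s))))"
proof -
  \<comment> \<open>All missing derivatives go to the factor directly in front of the tail, and
    zeros further in front pad the list to length \<open>j\<close>.\<close>
  define \<gamma> where "\<gamma> = \<alpha> - sum_list \<beta>s"
  have \<gamma>: "\<gamma> + sum_list \<beta>s = \<alpha>"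
    using assms(3) by (auto simp: \<gamma>_def vec_eq_iff less_eq_vec_def)
  define zs where "zs = replicate (j - Suc (length \<beta>s)) (0 :: (nat, 'n) vec)"
  have "length (zs @ \<gamma> # \<beta>s) = j" using assms(2) by (simp add: zs_def)
  moreover have "sum_list zs = 0" using sum_list_eq_0_iff_replicate unfolding zs_def by blast
  then have "sum_list (zs @ \<gamma> # \<beta>s) = \<alpha>" using \<gamma> by simp
  ultimately have "born_defined k e (map F (zs @ \<gamma> # \<beta>s))" by (rule born)
  then have "born_defined k e (F \<gamma> # map F \<beta>s)" using born_defined_append[of k e "map F zs"] by simp
  from born_defined_ConsD[OF this] assms(1)
  show "born_defined k e (map F \<beta>s)" "resolvent_exists k (dist_of (born k e (map F \<beta>s)))"
    "regular (resolvent k (dist_of (born k e (map F \<beta>s))))"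
    by (auto simp: fR_defined_def)
qed

text \<open>The outermost factor vanishes off \<open>K\<close>, so local integrability, which
  definedness provides, is already integrability.\<close>

lemma W_integrable:
  assumes "\<beta>s \<noteq> []" "hd \<beta>s \<le> \<alpha>" "born_defined k e (map F \<beta>s)"
  shows "integrable lborel (W \<beta>s)"
proof (rule locally_integrable_vanishing_outside[OF _ K])
  show "locally_integrable (W \<beta>s)"
    unfolding W_def[abs_def]
    by (rule locally_integrable_mult_bounded[OF born_defined_locally_integrable[OF assms(3)], of _ 1]) auto
  have "W \<beta>s x = 0" if "F (hd \<beta>s) x = 0" for x
  proof (cases "length \<beta>s = 1")
    case True
    with that show ?thesis by (simp add: W_singleton)
  next
    case False
    then obtain \<beta> \<gamma>s where "\<beta>s = \<beta> # \<gamma>s" "\<gamma>s \<noteq> []" using assms(1) by (cases \<beta>s) auto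
    with that show ?thesis by (simp add: W_Cons)
  qed
  with supp[OF assms(2)] show "AE x in lborel. x \<notin> K \<longrightarrow> W \<beta>s x = 0"
    by (auto elim!: eventually_mono)
qed

lemma hd_le: "\<beta>s \<noteq> [] \<Longrightarrow> sum_list \<beta>s \<le> \<alpha> \<Longrightarrow> hd \<beta>s \<le> \<alpha>"
  using member_le_sum_list_vec[OF hd_in_set] order_trans by blast

lemma W_integrable_tail:
  assumes "\<beta>s \<noteq> []" "length \<beta>s < j" "sum_list \<beta>s \<le> \<alpha>"
  shows "integrable lborel (W \<beta>s)"
  by (rule W_integrable[OF assms(1) hd_le[OF assms(1,3)] tail_defined(1)[OF assms]])

lemma represents_R:
  assumes "\<beta>s \<noteq> []" "length \<beta>s < j" "sum_list \<beta>s \<le> \<alpha>"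
  shows "represents (R \<beta>s) (resolvent k (dist_of (born k e (map F \<beta>s))))"
  unfolding R_def by (rule represents_fun_of[OF tail_defined(3)[OF assms]])

lemma U_locally_integrable:
  assumes "\<beta>s \<noteq> []" "length \<beta>s < j" "sum_list \<beta>s \<le> \<alpha>"
  shows "locally_integrable (U \<beta>s)"
  unfolding U_def[abs_def]
  using represents_R[OF assms]
  by (intro locally_integrable_mult_bounded[where B = 1]) (auto simp: represents_def)

lemma multiplier_limit:
  assumes "\<beta>s \<noteq> []" "length \<beta>s < j" "sum_list \<beta>s \<le> \<alpha>" and g: "test a b g"
  shows "((\<lambda>\<epsilon>. LINT x|lborel. (cis (\<eta> \<bullet> x) * W \<beta>s x) * multiplier (resolvent_symbol k \<epsilon>) (tensor g) x)
    \<longlongrightarrow> (LINT x|lborel. R \<beta>s x * tensor g x)) (at_right 0)"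
  using resolvent_tendsto[OF tail_defined(2)[OF assms(1-3)] schwartz_tensor[OF g]]
  unfolding resolvent_eps_dist_of represents_tensor[OF represents_R[OF assms(1-3)] g] born_eq_W .

lemma multiplier_tensor:
  assumes g: "test a b g" and \<epsilon>: "\<epsilon> > 0"
  shows "multiplier (resolvent_symbol k \<epsilon>) (tensor g) \<in> borel_measurable borel"
    "\<exists>B. \<forall>x::(real, 'n) vec. norm (multiplier (resolvent_symbol k \<epsilon>) (tensor g) x) \<le> B"
proof -
  have "modulated_multiplier 0 (resolvent_symbol k \<epsilon>) g = multiplier (resolvent_symbol k \<epsilon>) (tensor g)"
    by (auto simp: modulated_multiplier_def modulated_def[abs_def])
  with multiplier_translation(1,2)[OF g order_refl resolvent_symbol_measurable norm_resolvent_symbol_le[OF \<epsilon>], of 0 k]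
  show "multiplier (resolvent_symbol k \<epsilon>) (tensor g) \<in> borel_measurable borel"
    "\<exists>B. \<forall>x::(real, 'n) vec. norm (multiplier (resolvent_symbol k \<epsilon>) (tensor g) x) \<le> B"
    by simp_all
qed

text \<open>The derivative of \<open>W\<close> is the sum of its raised versions; the limit argument
  for multipliers carries this relation through P. As the limits are known for each summand
  separately, both pairings are first split into finite sums.\<close>

lemma leibniz_family_U:
  assumes m: "m > 0" "m < j" and W: "leibniz_family m \<alpha> W"
  shows "leibniz_family m \<alpha> U"
  unfolding leibniz_family_def
proof (intro conjI allI impI)
  fix \<beta>s :: "(nat, 'n) vec list"
  assume "length \<beta>s = m \<and> sum_list \<beta>s \<le> \<alpha>"
  then show "locally_integrable (U \<beta>s)" using m by (intro U_locally_integrable) auto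
next
  fix \<beta>s :: "(nat, 'n) vec list" and i
  assume \<beta>s: "length \<beta>s = m \<and> sum_list \<beta>s + axis i 1 \<le> \<alpha>"
  have b: "\<beta>s \<noteq> []" "length \<beta>s < j" "sum_list \<beta>s \<le> \<alpha>"
    using \<beta>s m by (auto simp: less_eq_vec_def intro: add_leD1)
  have r: "raise i l \<beta>s \<noteq> []" "length (raise i l \<beta>s) < j" "sum_list (raise i l \<beta>s) \<le> \<alpha>" if "l \<in> {..<m}" for l
    using \<beta>s m that length_raise[of i l \<beta>s] by (auto simp: sum_list_raise simp del: length_raise)
  have "weak_deriv i (\<lambda>x. cis (- (\<eta> \<bullet> x)) * R \<beta>s x) (\<lambda>x. cis (- (\<eta> \<bullet> x)) * (\<Sum>l<m. R (raise i l \<beta>s) x))"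
  proof (rule weak_deriv_multiplier_limit[where w = "W \<beta>s" and w' = "\<lambda>x. \<Sum>l<m. W (raise i l \<beta>s) x"
        and M = "resolvent_symbol k" and C = "\<lambda>\<epsilon>. 1 / \<epsilon>"])
    show "weak_deriv i (W \<beta>s) (\<lambda>x. \<Sum>l<m. W (raise i l \<beta>s) x)"
      using W \<beta>s by (auto simp: leibniz_family_def)
    show "integrable lborel (W \<beta>s)" by (rule W_integrable_tail[OF b])
    show "integrable lborel (\<lambda>x. \<Sum>l<m. W (raise i l \<beta>s) x)"
      by (intro Bochner_Integration.integrable_sum W_integrable_tail r)
    show "locally_integrable (R \<beta>s)" using represents_R[OF b] by (simp add: represents_def)
    have R: "locally_integrable (R (raise i l \<beta>s))" if "l \<in> {..<m}" for l
      using represents_R[OF r[OF that]] by (simp add: represents_def)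
    then show "locally_integrable (\<lambda>x. \<Sum>l<m. R (raise i l \<beta>s) x)" by (rule locally_integrable_sum)
    show "resolvent_symbol k \<epsilon> \<in> borel_measurable borel" for \<epsilon> by (rule resolvent_symbol_measurable)
    show "norm (resolvent_symbol k \<epsilon> \<xi>) \<le> 1 / \<epsilon>" if "\<epsilon> > 0" for \<epsilon> and \<xi> :: "(real, 'n) vec"
      by (rule norm_resolvent_symbol_le[OF that])
    fix a b :: "(real, 'n) vec" and g assume g: "test a b g"
    show "((\<lambda>\<epsilon>. LINT x|lborel. (cis (\<eta> \<bullet> x) * W \<beta>s x) * multiplier (resolvent_symbol k \<epsilon>) (tensor g) x)
        \<longlongrightarrow> (LINT x|lborel. R \<beta>s x * tensor g x)) (at_right 0)"
      by (rule multiplier_limit[OF b g])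
    have sum_R: "(\<Sum>l<m. LINT x|lborel. R (raise i l \<beta>s) x * tensor g x) = (LINT x|lborel. (\<Sum>l<m. R (raise i l \<beta>s) x) * tensor g x)"
      unfolding sum_distrib_right
      by (rule Bochner_Integration.integral_sum[symmetric]) (rule integrable_mult_tensor[OF R g])
    have sum_W: "(\<Sum>l<m. LINT x|lborel. (cis (\<eta> \<bullet> x) * W (raise i l \<beta>s) x) * multiplier (resolvent_symbol k \<epsilon>) (tensor g) x)
        = (LINT x|lborel. (cis (\<eta> \<bullet> x) * (\<Sum>l<m. W (raise i l \<beta>s) x)) * multiplier (resolvent_symbol k \<epsilon>) (tensor g) x)"
      if \<epsilon>: "\<epsilon> > 0" for \<epsilon>
      unfolding sum_distrib_left sum_distrib_right
    proof (rule Bochner_Integration.integral_sum[symmetric])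
      fix l assume l: "l \<in> {..<m}"
      obtain B where B: "\<And>x. norm (multiplier (resolvent_symbol k \<epsilon>) (tensor g) x) \<le> B"
        using multiplier_tensor(2)[OF g \<epsilon>] by blast
      note [measurable] = multiplier_tensor(1)[OF g \<epsilon>]
      have "integrable lborel (\<lambda>x. W (raise i l \<beta>s) x * (cis (\<eta> \<bullet> x) * multiplier (resolvent_symbol k \<epsilon>) (tensor g) x))"
        by (rule integrable_mult_bounded[OF W_integrable_tail[OF r[OF l]], of _ B]) (use B in \<open>auto simp: norm_mult\<close>)
      then show "integrable lborel (\<lambda>x. cis (\<eta> \<bullet> x) * W (raise i l \<beta>s) x * multiplier (resolvent_symbol k \<epsilon>) (tensor g) x)"
        by (simp add: mult_ac)
    qed
    have "((\<lambda>\<epsilon>. \<Sum>l<m. LINT x|lborel. (cis (\<eta> \<bullet> x) * W (raise i l \<beta>s) x) * multiplier (resolvent_symbol k \<epsilon>) (tensor g) x)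
        \<longlongrightarrow> (\<Sum>l<m. LINT x|lborel. R (raise i l \<beta>s) x * tensor g x)) (at_right 0)"
      by (intro tendsto_sum multiplier_limit[OF r g])
    then show "((\<lambda>\<epsilon>. LINT x|lborel. (cis (\<eta> \<bullet> x) * (\<Sum>l<m. W (raise i l \<beta>s) x)) * multiplier (resolvent_symbol k \<epsilon>) (tensor g) x)
        \<longlongrightarrow> (LINT x|lborel. (\<Sum>l<m. R (raise i l \<beta>s) x) * tensor g x)) (at_right 0)"
      unfolding sum_R
      by (rule Lim_transform_eventually) (auto intro!: eventually_mono[OF eventually_at_right_less[of 0]] sum_W)
  qed
  then show "weak_deriv i (U \<beta>s) (\<lambda>x. \<Sum>l<m. U (raise i l \<beta>s) x)"
    by (simp add: U_def[abs_def] sum_distrib_left)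
qed

text \<open>The induction alternates the two operations of the Born product: P takes
  \<open>W\<close> of length m to \<open>U\<close>, and multiplication by one more factor takes
  \<open>U\<close> to \<open>W\<close> of length m + 1. It stops below \<open>j\<close>, where every
  list of sum at most \<alpha> is a proper tail and therefore has an integrable product.\<close>

lemma leibniz_family_W: "m < j \<Longrightarrow> m > 0 \<Longrightarrow> leibniz_family m \<alpha> W"
proof (induction m)
  case (Suc m)
  show ?case
  proof (cases "m = 0")
    case True
    then show ?thesis using leibniz_family_cong[OF F, of W] W_singleton by simp
  next
    case False
    then have U: "leibniz_family m \<alpha> U"
      using Suc by (intro leibniz_family_U) auto
    have eq: "F (hd \<beta>s) x * U (tl \<beta>s) x = W \<beta>s x" if "length \<beta>s = Suc m" for \<beta>s x
      using that False W_Cons[of "tl \<beta>s" "hd \<beta>s" x] by (cases \<beta>s) auto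
    have li: "locally_integrable (W \<beta>s)" if "length \<beta>s = Suc m" "sum_list \<beta>s \<le> \<alpha>" for \<beta>s
      using that Suc.prems by (intro integrable_imp_locally_integrable W_integrable_tail) auto
    show ?thesis
      unfolding leibniz_family_def
    proof (intro conjI allI impI)
      fix \<beta>s :: "(nat, 'n) vec list"
      assume "length \<beta>s = Suc m \<and> sum_list \<beta>s \<le> \<alpha>"
      then show "locally_integrable (W \<beta>s)" using li by blast
    next
      fix \<beta>s :: "(nat, 'n) vec list" and i
      assume \<beta>s: "length \<beta>s = Suc m \<and> sum_list \<beta>s + axis i 1 \<le> \<alpha>"
      \<comment> \<open>No truncation is in force at inner levels, so the invariant factor of the
        product rule is the constant 1.\<close>
      have "weak_deriv i (\<lambda>x. 1 * (F (hd \<beta>s) x * U (tl \<beta>s) x))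
          (\<lambda>x. \<Sum>l<Suc m. 1 * (F (hd (raise i l \<beta>s)) x * U (tl (raise i l \<beta>s)) x))"
        by (rule weak_deriv_leibniz_product[OF F U]) (use \<beta>s li eq in auto)
      then show "weak_deriv i (W \<beta>s) (\<lambda>x. \<Sum>l<Suc m. W (raise i l \<beta>s) x)"
        using \<beta>s eq by (simp del: sum.lessThan_Suc)
    qed
  qed
qed simp

text \<open>The outermost level: \<open>F\<close> is multiplied with the family \<open>U\<close> of
  length j - 1, and integrability of the products is supplied for the zero list and for lists of sum
  \<alpha>, as the truncated Leibniz argument requires.\<close>

lemma fourier_born_leibniz:
  assumes j: "j \<ge> 2" and born0: "born_defined k e (map F (replicate j 0))"
  shows "(\<Prod>i\<in>UNIV. (\<i> * \<xi> $ i) ^ (\<alpha> $ i)) * (LINT x|lborel. cis (- (\<xi> \<bullet> x)) * W (replicate j 0) x)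
    = (\<Sum>\<beta>s | length \<beta>s = j \<and> sum_list \<beta>s = \<alpha>. multinom \<beta>s * (LINT x|lborel. cis (- (\<xi> \<bullet> x)) * W \<beta>s x))"
proof -
  obtain m where m: "j = Suc m" "m > 0" using j by (cases j) auto
  have U: "leibniz_family m \<alpha> U"
    using m by (intro leibniz_family_U leibniz_family_W) auto
  have eq: "W \<beta>s = (\<lambda>x. F (hd \<beta>s) x * U (tl \<beta>s) x)" if "length \<beta>s = j" for \<beta>s
    using that m W_Cons[of "tl \<beta>s" "hd \<beta>s"] by (cases \<beta>s) auto
  have zero: "W (replicate j 0) = (\<lambda>x. F 0 x * U (replicate m 0) x)"
    using eq[of "replicate j 0"] m by simp
  have "(\<Prod>i\<in>UNIV. (\<i> * \<xi> $ i) ^ (\<alpha> $ i)) * (LINT x|lborel. cis (- (\<xi> \<bullet> x)) * (F 0 x * U (replicate m 0) x))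
    = (\<Sum>\<beta>s | length \<beta>s = Suc m \<and> sum_list \<beta>s = \<alpha>. multinom \<beta>s * (LINT x|lborel. cis (- (\<xi> \<bullet> x)) * (F (hd \<beta>s) x * U (tl \<beta>s) x)))"
  proof (rule fourier_leibniz_product[OF F U K supp])
    show "integrable lborel (\<lambda>x. F (hd \<beta>s) x * U (tl \<beta>s) x)" if "length \<beta>s = Suc m" "sum_list \<beta>s = \<alpha>" for \<beta>s
    proof -
      have "\<beta>s \<noteq> []" "length \<beta>s = j" "sum_list \<beta>s \<le> \<alpha>" using that m(1) by auto
      then have "integrable lborel (W \<beta>s)" using that(2) by (intro W_integrable hd_le born)
      then show ?thesis using eq[OF \<open>length \<beta>s = j\<close>] by simp
    qed
    show "integrable lborel (\<lambda>x. F 0 x * U (replicate m 0) x)"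
      using W_integrable[OF _ _ born0] m zero by (auto simp: less_eq_vec_def)
  qed
  then show ?thesis using eq zero m(1) by simp
qed

end

section \<open>Assembly over almost every frequency\<close>

lemma map_D_dist_zero:
  fixes q :: "'n::{finite,linorder} dist"
  shows "map (\<lambda>\<beta>. D_dist \<beta> q) (replicate j 0) = replicate j q"
proof -
  have c: "concat (map (\<lambda>i. replicate ((0 :: (nat, 'n) vec) $ i) i) xs) = []" for xs :: "'n list"
    by (induction xs) auto
  have "D_dist 0 q = q"
  proof
    fix \<phi>
    show "D_dist 0 q \<phi> = q \<phi>"
      unfolding D_dist_def D_def c partials_def by (simp add: mi_abs_def)
  qed
  then show ?thesis by simp
qed

theorem theorem6:
  fixes \<alpha> :: "nat ^ 'n::{finite,linorder}" and j :: nat and q :: "'n dist"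
  assumes "j \<ge> 2"
    and "q \<in> sobolev_W2 (real (mi_abs \<alpha>))"
    and "compactly_supported q"
    and "Q_defined (replicate j q)"
    and "\<And>\<beta>s. length \<beta>s = j \<Longrightarrow> sum_list \<beta>s = \<alpha> \<Longrightarrow> Q_defined (map (\<lambda>\<beta>. D_dist \<beta> q) \<beta>s)"
  shows "\<forall>\<phi>. schwartz \<phi> \<longrightarrow>
    D_dist \<alpha> (Q (replicate j q)) \<phi> =
    (\<Sum>\<beta>s | length \<beta>s = j \<and> sum_list \<beta>s = \<alpha>.
       of_nat (mi_fact \<alpha>) / of_nat (\<Prod>\<beta>\<leftarrow>\<beta>s. mi_fact \<beta>) *
       Q (map (\<lambda>\<beta>. D_dist \<beta> q) \<beta>s) \<phi>)"
proof (intro allI impI)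
  fix \<phi> :: "'n cfun" assume \<phi>: "schwartz \<phi>"
  let ?dq = "\<lambda>\<beta>s. map (\<lambda>\<beta>. D_dist \<beta> q) \<beta>s"
  let ?T = "{\<beta>s :: (nat, 'n) vec list. length \<beta>s = j \<and> sum_list \<beta>s = \<alpha>}"
  define F where "F \<beta> = fun_of (D_dist \<beta> q)" for \<beta>
  note q0 = map_D_dist_zero[of q j]
  have defd: "Q_defined (?dq \<beta>s)" if "\<beta>s \<in> insert (replicate j 0) ?T" for \<beta>s
    using that assms(4,5) q0 by auto
  have fin: "finite (insert (replicate j 0) ?T)" using finite_mi_lists_eq by simp
  have reg: "regular (D_dist \<beta> q)" if "\<beta> \<le> \<alpha>" for \<beta>
  proof -
    \<comment> \<open>The list with \<beta> on the first factor and the rest of \<alpha> on the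
      second has sum \<alpha>; this uses j \<ge> 2.\<close>
    define \<gamma> where "\<gamma> = \<alpha> - \<beta>"
    have "\<beta> + \<gamma> = \<alpha>" using that by (auto simp: \<gamma>_def vec_eq_iff less_eq_vec_def)
    moreover have "sum_list (replicate (j - 2) (0 :: (nat, 'n) vec)) = 0" using sum_list_eq_0_iff_replicate by blast
    ultimately have "Q_defined (?dq (\<beta> # \<gamma> # replicate (j - 2) 0))"
      using assms(1) by (intro assms(5)) auto
    then show ?thesis by (auto simp: Q_defined_def)
  qed
  obtain K where K: "compact K" "\<And>\<phi>. schwartz \<phi> \<Longrightarrow> supp \<phi> \<inter> K = {} \<Longrightarrow> q \<phi> = 0"
    using assms(3) unfolding compactly_supported_def by blast
  \<comment> \<open>Finitely many lists are involved, so one null set of exceptional frequencies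
    serves them all.\<close>
  have "AE \<xi> in lborel. \<forall>\<beta>s\<in>insert (replicate j 0) ?T.
      born_defined (wavenumber \<xi>) (plane_wave (wavenumber \<xi>) (direction \<xi>)) (map fun_of (?dq \<beta>s))"
    unfolding AE_ball_countable[OF countable_finite[OF fin]]
    using defd unfolding Q_defined_def by (auto elim!: eventually_mono)
  then have Q_hat: "AE \<xi> in lborel. (\<Prod>i\<in>UNIV. (\<i> * \<xi> $ i) ^ (\<alpha> $ i)) * Q_hat (?dq (replicate j 0)) \<xi>
      = (\<Sum>\<beta>s\<in>?T. multinom \<beta>s * Q_hat (?dq \<beta>s) \<xi>)"
  proof eventually_elim
    case (elim \<xi>)
    let ?k = "wavenumber \<xi>" and ?e = "plane_wave (wavenumber \<xi>) (direction \<xi>)"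
    have map_F: "map fun_of (?dq \<beta>s) = map F \<beta>s" for \<beta>s by (simp add: F_def)
    interpret born_series ?k "- (1/2) *\<^sub>R \<xi>" ?e \<alpha> F j K
    proof
      show "?e x = cis ((- (1/2) *\<^sub>R \<xi>) \<bullet> x)" for x by (rule plane_wave_eq)
      show "leibniz_family 1 \<alpha> (\<lambda>\<beta>s. F (hd \<beta>s))" unfolding F_def by (rule leibniz_family_fun_of[OF reg])
      show "AE x in lborel. x \<notin> K \<longrightarrow> F \<beta> x = 0" if "\<beta> \<le> \<alpha>" for \<beta>
        unfolding F_def by (rule fun_of_D_dist_vanishes[OF reg[OF that] K])
      show "born_defined ?k ?e (map F \<beta>s)" if "length \<beta>s = j" "sum_list \<beta>s = \<alpha>" for \<beta>s
        using elim that unfolding map_F by auto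
    qed (rule K(1))
    have W: "Q_hat (?dq \<beta>s) \<xi> = (LINT x|lborel. cis (- (\<xi> \<bullet> x)) * W \<beta>s x)" for \<beta>s
      unfolding Q_hat_def
    proof (rule Bochner_Integration.integral_cong[OF refl])
      fix y
      have "Q_integrand (?dq \<beta>s) \<xi> y = ?e y * born ?k ?e (map F \<beta>s) y"
        by (simp add: Q_integrand_def Let_def map_F del: map_map)
      also have "\<dots> = (cis ((- (1/2) *\<^sub>R \<xi>) \<bullet> y) * cis ((- (1/2) *\<^sub>R \<xi>) \<bullet> y)) * W \<beta>s y"
        unfolding born_eq_W e by (simp only: mult.assoc)
      \<comment> \<open>The plane wave enters twice, once in the integrand and once in the innermost
        factor; with the wavenumber |\<xi>|/2 the two halves combine to the Fourier character at
        \<xi>.\<close>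
      also have "cis ((- (1/2) *\<^sub>R \<xi>) \<bullet> y) * cis ((- (1/2) *\<^sub>R \<xi>) \<bullet> y) = cis (- (\<xi> \<bullet> y))"
        unfolding cis_mult by simp
      finally show "Q_integrand (?dq \<beta>s) \<xi> y = cis (- (\<xi> \<bullet> y)) * W \<beta>s y" .
    qed
    have "born_defined ?k ?e (map F (replicate j 0))" using elim unfolding map_F by blast
    from fourier_born_leibniz[OF assms(1) this, of \<xi>] show ?case unfolding W .
  qed
  have int: "integrable lborel (\<lambda>\<xi>. Q_hat (?dq \<beta>s) \<xi> * inv_fourier \<phi> \<xi>)" if "\<beta>s \<in> insert (replicate j 0) ?T" for \<beta>s
    using defd[OF that] schwartz_inv_fourier[OF \<phi>] by (simp add: Q_defined_def)
  have Q: "Q (?dq \<beta>s) \<psi> = (LINT \<xi>|lborel. Q_hat (?dq \<beta>s) \<xi> * inv_fourier \<psi> \<xi>)" for \<beta>s \<psi>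
    by (simp add: Q_def inv_fourier_dist_def dist_of_def)
  \<comment> \<open>The sign of the distributional derivative cancels the signs that arise when the
    derivative falls on the inverse Fourier transform of the test function.\<close>
  have sign: "(-1) ^ mi_abs \<alpha> * (\<Prod>i\<in>UNIV. (- \<i> * complex_of_real (\<xi> $ i)) ^ (\<alpha> $ i)) = (\<Prod>i\<in>UNIV. (\<i> * \<xi> $ i) ^ (\<alpha> $ i))" for \<xi> :: "(real, 'n) vec"
    unfolding mi_abs_def power_sum prod.distrib[symmetric] power_mult_distrib[symmetric] by simp
  have "D_dist \<alpha> (Q (replicate j q)) \<phi> = (-1) ^ mi_abs \<alpha> * (LINT \<xi>|lborel. Q_hat (?dq (replicate j 0)) \<xi> *
      ((\<Prod>i\<in>UNIV. (- \<i> * complex_of_real (\<xi> $ i)) ^ (\<alpha> $ i)) * inv_fourier \<phi> \<xi>))"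
    unfolding D_dist_def q0[symmetric] Q inv_fourier_D[OF \<phi>] ..
  also have "\<dots> = (LINT \<xi>|lborel. (\<Prod>i\<in>UNIV. (\<i> * \<xi> $ i) ^ (\<alpha> $ i)) * Q_hat (?dq (replicate j 0)) \<xi> * inv_fourier \<phi> \<xi>)"
    unfolding sign[symmetric] integral_mult_right_zero[symmetric]
    by (intro Bochner_Integration.integral_cong refl) (simp only: mult_ac)
  also have "\<dots> = (LINT \<xi>|lborel. (\<Sum>\<beta>s\<in>?T. multinom \<beta>s * (Q_hat (?dq \<beta>s) \<xi> * inv_fourier \<phi> \<xi>)))"
  proof (rule integral_cong_AE)
    have [measurable]: "(\<lambda>\<xi>::(real, 'n) vec. \<Prod>i\<in>UNIV. (\<i> * \<xi> $ i) ^ (\<alpha> $ i)) \<in> borel_measurable borel"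
      by (intro borel_measurable_continuous_onI continuous_intros)
    \<comment> \<open>Measurability of \<open>Q_hat\<close> is available only through the
      integrability of its product with a Schwartz function, so the two are kept together and the
      polynomial is treated separately.\<close>
    have [measurable]: "(\<lambda>\<xi>. Q_hat (?dq (replicate j 0)) \<xi> * inv_fourier \<phi> \<xi>) \<in> borel_measurable lborel"
      by (rule borel_measurable_integrable[OF int]) simp
    have "(\<lambda>\<xi>. (\<Prod>i\<in>UNIV. (\<i> * \<xi> $ i) ^ (\<alpha> $ i)) * (Q_hat (?dq (replicate j 0)) \<xi> * inv_fourier \<phi> \<xi>)) \<in> borel_measurable lborel"
      by measurable
    then show "(\<lambda>\<xi>. (\<Prod>i\<in>UNIV. (\<i> * \<xi> $ i) ^ (\<alpha> $ i)) * Q_hat (?dq (replicate j 0)) \<xi> * inv_fourier \<phi> \<xi>) \<in> borel_measurable lborel"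
      by (simp only: mult.assoc)
    show "(\<lambda>\<xi>. \<Sum>\<beta>s\<in>?T. multinom \<beta>s * (Q_hat (?dq \<beta>s) \<xi> * inv_fourier \<phi> \<xi>)) \<in> borel_measurable lborel"
      by (intro borel_measurable_integrable Bochner_Integration.integrable_sum integrable_mult_right int) simp
    show "AE \<xi> in lborel. (\<Prod>i\<in>UNIV. (\<i> * \<xi> $ i) ^ (\<alpha> $ i)) * Q_hat (?dq (replicate j 0)) \<xi> * inv_fourier \<phi> \<xi>
        = (\<Sum>\<beta>s\<in>?T. multinom \<beta>s * (Q_hat (?dq \<beta>s) \<xi> * inv_fourier \<phi> \<xi>))"
      using Q_hat by eventually_elim (simp only: sum_distrib_right mult.assoc)
  qed
  also have "\<dots> = (\<Sum>\<beta>s\<in>?T. multinom \<beta>s * Q (?dq \<beta>s) \<phi>)"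
    unfolding Q integral_mult_right_zero[symmetric]
    by (intro Bochner_Integration.integral_sum integrable_mult_right int) simp
  also have "\<dots> = (\<Sum>\<beta>s\<in>?T. of_nat (mi_fact \<alpha>) / of_nat (\<Prod>\<beta>\<leftarrow>\<beta>s. mi_fact \<beta>) * Q (?dq \<beta>s) \<phi>)"
    by (intro sum.cong) (auto simp: multinom_def)
  finally show "D_dist \<alpha> (Q (replicate j q)) \<phi> =
    (\<Sum>\<beta>s | length \<beta>s = j \<and> sum_list \<beta>s = \<alpha>.
       of_nat (mi_fact \<alpha>) / of_nat (\<Prod>\<beta>\<leftarrow>\<beta>s. mi_fact \<beta>) *
       Q (map (\<lambda>\<beta>. D_dist \<beta> q) \<beta>s) \<phi>)" .
qed

end
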